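(* Let $\mathbf T$ be the universal countable dense meet-tree. Then $\mathbf T$ has a generic automorphism, i.e.\ there is $\sigma\in\Aut(\mathbf T)$ whose conjugacy class is comeagre in $\Aut(\mathbf T)$.
   Context: A meet-tree is a structure $(A,\leq,\mathbin{\wedge})$ where $\leq$ is a partial order such that for every $a\in A$ the set $A_{\leq a}=\{x\in A: x\leq a\}$ is linearly ordered, every two elements have a common lower bound, and $a\mathbin{\wedge} b$ is the largest element of $A_{\leq a}\cap A_{\leq b}$. The class of finite meet-trees (in the language $\{\leq,\mathbin{\wedge}\}$) is a Fraïssé class; $\mathbf T$ denotes its Fraïssé limit, i.e.\ the unique (up to isomorphism) countable ultrahomogeneous meet-tree whose finitely generated substructures are, up to isomorphism, exactly the finite meet-trees. $\Aut(\mathbf T)$ carries the topology of pointwise convergence (a Polish group topology). *)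

theory Defs
  imports "HOL-Analysis.Analysis" "HOL-Algebra.Bij"
begin

section \<open>Structures in the language of meet-trees\<close>

text \<open>The values of \<open>meet\<close> are only meaningful on the carrier.\<close>

record 'a meet_structure = "'a partial_object" +
  leq :: "('a \<times> 'a) set"
  meet :: "'a \<Rightarrow> 'a \<Rightarrow> 'a"

text \<open>The empty structure counts as a (finite) meet-tree, and it is the substructure generated
  by the empty set. None of the notions below depends on this choice of convention.\<close>

definition meet_tree :: "'a meet_structure \<Rightarrow> bool" where
  "meet_tree T \<longleftrightarrow>
     partial_order_on (carrier T) (leq T) \<and>
     (\<forall>a\<in>carrier T. total_on (under (leq T) a) (leq T)) \<and>
     (\<forall>a\<in>carrier T. \<forall>b\<in>carrier T. under (leq T) a \<inter> under (leq T) b \<noteq> {}) \<and>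
     (\<forall>a\<in>carrier T. \<forall>b\<in>carrier T.
        meet T a b \<in> under (leq T) a \<inter> under (leq T) b \<and>
        (\<forall>x\<in>under (leq T) a \<inter> under (leq T) b. (x, meet T a b) \<in> leq T))"

definition substructure_carrier :: "'a meet_structure \<Rightarrow> 'a set \<Rightarrow> bool" where
  "substructure_carrier T B \<longleftrightarrow>
     B \<subseteq> carrier T \<and> (\<forall>a\<in>B. \<forall>b\<in>B. meet T a b \<in> B)"

definition generated_substructure :: "'a meet_structure \<Rightarrow> 'a set \<Rightarrow> 'a meet_structure" where
  "generated_substructure T S =
     \<lparr>carrier = substructure_carrier T hull S,
      leq = Restr (leq T) (substructure_carrier T hull S),
      meet = meet T\<rparr>"

definition isomorphisms :: "'a meet_structure \<Rightarrow> 'b meet_structure \<Rightarrow> ('a \<Rightarrow> 'b) set" where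
  "isomorphisms M N =
     {f. bij_betw f (carrier M) (carrier N) \<and>
         (\<forall>a\<in>carrier M. \<forall>b\<in>carrier M. (a, b) \<in> leq M \<longleftrightarrow> (f a, f b) \<in> leq N) \<and>
         (\<forall>a\<in>carrier M. \<forall>b\<in>carrier M. f (meet M a b) = meet N (f a) (f b))}"

definition isomorphic :: "'a meet_structure \<Rightarrow> 'b meet_structure \<Rightarrow> bool" where
  "isomorphic M N \<longleftrightarrow> isomorphisms M N \<noteq> {}"


section \<open>The automorphism group and its topology\<close>

text \<open>As in \<^const>\<open>BijGroup\<close>, automorphisms are represented by extensional functions on the
  carrier, so that distinct elements of the group are distinct permutations of the carrier.\<close>

definition Aut :: "'a meet_structure \<Rightarrow> ('a \<Rightarrow> 'a) set" where
  "Aut T = isomorphisms T T \<inter> Bij (carrier T)"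

definition AutGroup :: "'a meet_structure \<Rightarrow> ('a \<Rightarrow> 'a) monoid" where
  "AutGroup T = (BijGroup (carrier T))\<lparr>carrier := Aut T\<rparr>"

definition Aut_topology :: "'a meet_structure \<Rightarrow> ('a \<Rightarrow> 'a) topology" where
  "Aut_topology T =
     subtopology (product_topology (\<lambda>_. discrete_topology (carrier T)) (carrier T)) (Aut T)"

definition conjugacy_class :: "('g, 'm) monoid_scheme \<Rightarrow> 'g \<Rightarrow> 'g set" where
  "conjugacy_class G x = {g \<otimes>\<^bsub>G\<^esub> x \<otimes>\<^bsub>G\<^esub> inv\<^bsub>G\<^esub> g | g. g \<in> carrier G}"


section \<open>The Fraisse limit of the finite meet-trees\<close>

definition ultrahomogeneous :: "'a meet_structure \<Rightarrow> bool" where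
  "ultrahomogeneous T \<longleftrightarrow>
     (\<forall>S S' f. finite S \<and> S \<subseteq> carrier T \<and> finite S' \<and> S' \<subseteq> carrier T \<and>
        f \<in> isomorphisms (generated_substructure T S) (generated_substructure T S') \<longrightarrow>
        (\<exists>\<sigma>\<in>Aut T. \<forall>x\<in>carrier (generated_substructure T S). \<sigma> x = f x))"

text \<open>Every finite structure has an isomorphic copy whose carrier is a set of natural numbers, so
  \<^typ>\<open>nat meet_structure\<close> is large enough to represent all finite meet-trees up to isomorphism.\<close>

definition universal_dense_meet_tree :: "'a meet_structure \<Rightarrow> bool" where
  "universal_dense_meet_tree T \<longleftrightarrow>
     meet_tree T \<and> countable (carrier T) \<and> ultrahomogeneous T \<and>
     (\<forall>S. finite S \<and> S \<subseteq> carrier T \<longrightarrow>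
        (\<exists>B :: nat meet_structure. meet_tree B \<and> finite (carrier B) \<and>
           isomorphic (generated_substructure T S) B)) \<and>
     (\<forall>B :: nat meet_structure. meet_tree B \<and> finite (carrier B) \<longrightarrow>
        (\<exists>S. finite S \<and> S \<subseteq> carrier T \<and> isomorphic (generated_substructure T S) B))"


section \<open>Baire category\<close>

definition nowhere_dense_in :: "'a topology \<Rightarrow> 'a set \<Rightarrow> bool" where
  "nowhere_dense_in X S \<longleftrightarrow> S \<subseteq> topspace X \<and> X interior_of (X closure_of S) = {}"

definition meagre_in :: "'a topology \<Rightarrow> 'a set \<Rightarrow> bool" where
  "meagre_in X S \<longleftrightarrow> (\<exists>N :: nat \<Rightarrow> 'a set. (\<forall>n. nowhere_dense_in X (N n)) \<and> S = (\<Union>n. N n))"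

definition comeagre_in :: "'a topology \<Rightarrow> 'a set \<Rightarrow> bool" where
  "comeagre_in X S \<longleftrightarrow> S \<subseteq> topspace X \<and> meagre_in X (topspace X - S)"


section \<open>The automorphisms form a group, carried by the topology\<close>

lemma meet_tree_meet_closed:
  assumes "meet_tree T" "a \<in> carrier T" "b \<in> carrier T"
  shows "meet T a b \<in> carrier T"
  using assms unfolding meet_tree_def partial_order_on_def preorder_on_def under_def by blast

lemma subgroup_Aut:
  assumes T: "meet_tree T"
  shows "subgroup (Aut T) (BijGroup (carrier T))"
proof -
  interpret G: group "BijGroup (carrier T)" by (rule group_BijGroup)
  have sub: "Aut T \<subseteq> Bij (carrier T)" by (auto simp: Aut_def)
  have closed: "\<And>a b. a \<in> carrier T \<Longrightarrow> b \<in> carrier T \<Longrightarrow> meet T a b \<in> carrier T"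
    by (rule meet_tree_meet_closed[OF T])
  show ?thesis
  proof (rule G.subgroupI)
    show "Aut T \<subseteq> carrier (BijGroup (carrier T))" using sub by (simp add: BijGroup_def)
    have "(\<lambda>x\<in>carrier T. x) \<in> Aut T"
      using closed by (auto simp: Aut_def isomorphisms_def Bij_def bij_betw_def inj_on_def)
    then show "Aut T \<noteq> {}" by blast
  next
    fix f assume f: "f \<in> Aut T"
    let ?g = "\<lambda>x\<in>carrier T. inv_into (carrier T) f x"
    have fB: "f \<in> Bij (carrier T)" using f sub by blast
    have bij: "bij_betw f (carrier T) (carrier T)" using fB by (simp add: Bij_def)
    have gB: "?g \<in> Bij (carrier T)" by (rule restrict_inv_into_Bij[OF fB])
    have g: "?g a \<in> carrier T" "f (?g a) = a" if "a \<in> carrier T" for a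
      using that bij by (auto simp: bij_betw_def inv_into_into f_inv_into_f)
    have gf: "?g (f a) = a" if "a \<in> carrier T" for a
      using that bij bij_betwE by (fastforce simp: bij_betw_def)
    have leq: "(a, b) \<in> leq T \<longleftrightarrow> (?g a, ?g b) \<in> leq T"
      if "a \<in> carrier T" "b \<in> carrier T" for a b
    proof -
      have "(?g a, ?g b) \<in> leq T \<longleftrightarrow> (f (?g a), f (?g b)) \<in> leq T"
        using f g(1)[OF that(1)] g(1)[OF that(2)] unfolding Aut_def isomorphisms_def by blast
      then show ?thesis unfolding g(2)[OF that(1)] g(2)[OF that(2)] by simp
    qed
    have meet: "?g (meet T a b) = meet T (?g a) (?g b)"
      if "a \<in> carrier T" "b \<in> carrier T" for a b
    proof -
      have "f (meet T (?g a) (?g b)) = meet T (f (?g a)) (f (?g b))"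
        using f g(1)[OF that(1)] g(1)[OF that(2)] unfolding Aut_def isomorphisms_def by blast
      then have "f (meet T (?g a) (?g b)) = meet T a b"
        unfolding g(2)[OF that(1)] g(2)[OF that(2)] .
      then show ?thesis using gf[OF closed[OF g(1)[OF that(1)] g(1)[OF that(2)]]] by metis
    qed
    have "?g \<in> Aut T"
      using gB leq meet unfolding Aut_def isomorphisms_def Bij_def by blast
    moreover have "inv\<^bsub>BijGroup (carrier T)\<^esub> f = ?g" by (rule inv_BijGroup[OF fB])
    ultimately show "inv\<^bsub>BijGroup (carrier T)\<^esub> f \<in> Aut T" by simp
  next
    fix f g assume fg: "f \<in> Aut T" "g \<in> Aut T"
    then have B: "f \<in> Bij (carrier T)" "g \<in> Bij (carrier T)" using sub by auto
    then have gc: "g a \<in> carrier T" if "a \<in> carrier T" for a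
      using that Bij_imp_funcset by blast
    have "compose (carrier T) f g \<in> Bij (carrier T)" by (rule compose_Bij[OF B])
    then have "compose (carrier T) f g \<in> Aut T"
      using fg closed gc by (auto simp: Aut_def isomorphisms_def Bij_def compose_def)
    then show "f \<otimes>\<^bsub>BijGroup (carrier T)\<^esub> g \<in> Aut T" using B by (simp add: BijGroup_def)
  qed
qed

lemma group_AutGroup: "meet_tree T \<Longrightarrow> group (AutGroup T)"
  unfolding AutGroup_def by (intro group.subgroup_imp_group group_BijGroup subgroup_Aut)

lemma topspace_Aut_topology: "topspace (Aut_topology T) = carrier (AutGroup T)"
  by (auto simp: Aut_topology_def AutGroup_def Aut_def Bij_def PiE_def bij_betw_def)

end

theory Submission
  imports Defs
begin

text \<open>The type of a finite set \<open>A\<close> under an automorphism \<open>f\<close> is the order among the elements generated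
  from \<open>A\<close> by \<open>f\<close>, its inverse and meets. Two automorphisms giving \<open>A\<close> the same type can be
  amalgamated over the generated subtree, because a cut of the subtree can be filled by putting all
  of one tree before all of the other. Hence, over a finite set whose type is locally constant at a
  generic automorphism, every finite piece of an automorphism giving the set the same type is
  realised. If the type of every finite set is locally constant at generic automorphisms, any two of
  them are therefore conjugate by a back-and-forth.

  That the type of \<open>A\<close> is locally constant on a dense set is a Baire category argument: sets with a
  fixed type are closed, so it suffices that almost all automorphisms realise only countably many
  types. Almost all automorphisms have no point whose orbit branches at infinitely many
  levels, since such an orbit can be closed up by changing the automorphism on one cone. Without
  such points the generated subtree consists of finitely many orbits, and its isomorphism type is
  given by finitely many sets \<open>{k. b \<le> f\<^sup>k b'}\<close> of integers, each of which is finite or closed under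
  some translation.\<close>

section \<open>Meet-trees and their automorphisms\<close>

text \<open>Two extensions of a finite partial automorphism need not be compatible, since the finite
  piece leaves open how later images and meets of its points compare. So the base of an amalgamation
  has to be the whole generated subtree. That subtree is usually infinite, while a neighbourhood
  fixes only finitely many values; local constancy of the type says that finitely many values
  nevertheless settle it. The joint order of two amalgamated copies is defined on both infinite
  trees at once, because then its invariance is visible, but only finitely many of its lower sets
  are ever realised in \<open>T\<close>, as universality and ultrahomogeneity speak about finite
  trees. Orbits branching at infinitely many levels are the obstacle to countability: the lengths of
  their cycles at successive levels form an infinite sequence of choices.\<close>

locale meet_tree_struct =
  fixes T :: "'a meet_structure"
  assumes meet_tree: "meet_tree T"
begin

abbreviation le (infix "\<preceq>" 50) where "x \<preceq> y \<equiv> (x, y) \<in> leq T"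
abbreviation mt (infixl "\<curlywedge>" 70) where "x \<curlywedge> y \<equiv> meet T x y"
abbreviation X where "X \<equiv> carrier T"
abbreviation G where "G \<equiv> Aut T"

lemma le_carrier: assumes "x \<preceq> y" shows "x \<in> X" "y \<in> X"
  using assms meet_tree unfolding meet_tree_def partial_order_on_def preorder_on_def by auto

lemma le_refl: "x \<in> X \<Longrightarrow> x \<preceq> x"
  using meet_tree unfolding meet_tree_def partial_order_on_def preorder_on_def refl_on_def by auto

lemma le_trans: "x \<preceq> y \<Longrightarrow> y \<preceq> z \<Longrightarrow> x \<preceq> z"
  using meet_tree unfolding meet_tree_def partial_order_on_def preorder_on_def
  by (meson transD)

lemma le_antisym: "x \<preceq> y \<Longrightarrow> y \<preceq> x \<Longrightarrow> x = y"
  using meet_tree unfolding meet_tree_def partial_order_on_def by (meson antisymD)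

lemma le_linear:
  assumes "x \<preceq> z" "y \<preceq> z"
  shows "x \<preceq> y \<or> y \<preceq> x"
proof -
  have "total_on (under (leq T) z) (leq T)"
    using meet_tree le_carrier[OF assms(1)] unfolding meet_tree_def by blast
  then show ?thesis
    using assms le_refl le_carrier(1) unfolding total_on_def under_def by (cases "x = y") auto
qed

lemma
  assumes "x \<in> X" "y \<in> X"
  shows meet_le1: "x \<curlywedge> y \<preceq> x" and meet_le2: "x \<curlywedge> y \<preceq> y"
    and meet_closed: "x \<curlywedge> y \<in> X"
proof -
  have "x \<curlywedge> y \<in> under (leq T) x \<inter> under (leq T) y"
    using meet_tree assms unfolding meet_tree_def by blast
  then show "x \<curlywedge> y \<preceq> x" "x \<curlywedge> y \<preceq> y" by (auto simp: under_def)
  then show "x \<curlywedge> y \<in> X" using le_carrier by blast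
qed

lemma meet_greatest:
  assumes "z \<preceq> x" "z \<preceq> y"
  shows "z \<preceq> x \<curlywedge> y"
  using meet_tree assms le_carrier[OF assms(1)] le_carrier[OF assms(2)]
  unfolding meet_tree_def under_def by blast

lemma meet_eqI:
  assumes "z \<preceq> x" "z \<preceq> y" "\<And>w. w \<preceq> x \<Longrightarrow> w \<preceq> y \<Longrightarrow> w \<preceq> z"
  shows "x \<curlywedge> y = z"
proof -
  have "x \<in> X" "y \<in> X" using assms le_carrier by blast+
  then show ?thesis
    using assms by (intro le_antisym assms(3) meet_le1 meet_le2 meet_greatest)
qed

lemma meet_absorb1: "x \<preceq> y \<Longrightarrow> x \<curlywedge> y = x"
  using le_carrier by (intro meet_eqI le_refl) auto

lemma meet_idem: "x \<in> X \<Longrightarrow> x \<curlywedge> x = x"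
  by (simp add: meet_absorb1 le_refl)

lemma meet_commute: "x \<in> X \<Longrightarrow> y \<in> X \<Longrightarrow> x \<curlywedge> y = y \<curlywedge> x"
  by (intro le_antisym meet_greatest meet_le1 meet_le2)

text \<open>The branches to \<open>x\<close> and \<open>y\<close> coincide up to
  \<open>x \<curlywedge> y\<close>. As both meets lie below \<open>x\<close>, the hypothesis puts
  \<open>x \<curlywedge> z\<close> strictly lower, so \<open>z\<close> leaves the two branches at
  the same point.\<close>

lemma meet_eq_meet_if_less:
  assumes "x \<in> X" "y \<in> X" "z \<in> X" "\<not> x \<curlywedge> y \<preceq> x \<curlywedge> z"
  shows "x \<curlywedge> z = y \<curlywedge> z"
proof -
  have 1: "x \<curlywedge> z \<preceq> x \<curlywedge> y"
    using assms le_linear meet_le1 by blast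
  then have 2: "x \<curlywedge> z \<preceq> y \<curlywedge> z"
    using assms meet_le2 le_trans meet_greatest by blast
  have "y \<curlywedge> z \<preceq> x \<curlywedge> y"
  proof (rule ccontr)
    assume "\<not> ?thesis"
    then have "x \<curlywedge> y \<preceq> y \<curlywedge> z"
      using assms le_linear[of "y \<curlywedge> z" y "x \<curlywedge> y"] meet_le1 meet_le2 by blast
    then have "x \<curlywedge> y \<preceq> z" using assms meet_le2 le_trans by blast
    then show False using assms meet_greatest meet_le1 by blast
  qed
  then have "y \<curlywedge> z \<preceq> x \<curlywedge> z"
    using assms meet_le1 meet_le2 le_trans meet_greatest by meson
  then show ?thesis using 2 le_antisym by blast
qed

lemma Aut_closed: "f \<in> G \<Longrightarrow> x \<in> X \<Longrightarrow> f x \<in> X"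
  unfolding Aut_def isomorphisms_def using bij_betwE by blast

lemma Aut_le: "f \<in> G \<Longrightarrow> x \<in> X \<Longrightarrow> y \<in> X \<Longrightarrow> f x \<preceq> f y \<longleftrightarrow> x \<preceq> y"
  unfolding Aut_def isomorphisms_def by blast

lemma Aut_meet: "f \<in> G \<Longrightarrow> x \<in> X \<Longrightarrow> y \<in> X \<Longrightarrow> f (x \<curlywedge> y) = f x \<curlywedge> f y"
  unfolding Aut_def isomorphisms_def by blast

lemma Aut_bij: "f \<in> G \<Longrightarrow> bij_betw f X X"
  unfolding Aut_def isomorphisms_def by blast

lemma Aut_eq_iff: "f \<in> G \<Longrightarrow> x \<in> X \<Longrightarrow> y \<in> X \<Longrightarrow> f x = f y \<longleftrightarrow> x = y"
  using Aut_bij bij_betw_imp_inj_on inj_on_eq_iff by metis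

lemma Aut_extensional: "f \<in> G \<Longrightarrow> f \<in> extensional X"
  unfolding Aut_def Bij_def by blast

lemma Aut_eqI: "f \<in> G \<Longrightarrow> g \<in> G \<Longrightarrow> (\<And>x. x \<in> X \<Longrightarrow> f x = g x) \<Longrightarrow> f = g"
  using Aut_extensional extensionalityI by blast

text \<open>Meets are definable from the order, so an order automorphism preserves them; injectivity
  comes from antisymmetry.\<close>

lemma AutI:
  assumes "f \<in> extensional X" "f ` X = X"
    and le: "\<And>x y. x \<in> X \<Longrightarrow> y \<in> X \<Longrightarrow> f x \<preceq> f y \<longleftrightarrow> x \<preceq> y"
  shows "f \<in> G"
proof -
  have "inj_on f X"
    by (intro inj_onI) (metis le le_antisym le_refl)
  then have bij: "bij_betw f X X" using assms(2) by (simp add: bij_betw_def)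
  have "f (x \<curlywedge> y) = f x \<curlywedge> f y" if "x \<in> X" "y \<in> X" for x y
  proof (rule sym, rule meet_eqI)
    show "f (x \<curlywedge> y) \<preceq> f x" "f (x \<curlywedge> y) \<preceq> f y"
      using that le meet_closed meet_le1 meet_le2 by auto
    fix w assume w: "w \<preceq> f x" "w \<preceq> f y"
    then obtain v where "v \<in> X" "w = f v" using assms(2) le_carrier by blast
    then show "w \<preceq> f (x \<curlywedge> y)" using w that le meet_closed meet_greatest by auto
  qed
  then show ?thesis
    using assms(1) bij le unfolding Aut_def isomorphisms_def Bij_def by auto
qed

lemma AutI_inverse:
  assumes "f \<in> extensional X"
    and "\<And>x. x \<in> X \<Longrightarrow> f x \<in> X" "\<And>x. x \<in> X \<Longrightarrow> g x \<in> X \<and> f (g x) = x"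
    and "\<And>x y. x \<in> X \<Longrightarrow> y \<in> X \<Longrightarrow> f x \<preceq> f y \<longleftrightarrow> x \<preceq> y"
  shows "f \<in> G"
proof (rule AutI)
  show "f ` X = X" using assms(2,3) by (metis image_subset_iff rev_image_eqI subsetI subset_antisym)
qed (use assms in auto)

section \<open>Group operations and integer powers of automorphisms\<close>

sublocale A: group "AutGroup T"
  by (rule group_AutGroup[OF meet_tree])

lemma carrier_AutGroup [simp]: "carrier (AutGroup T) = G"
  by (simp add: AutGroup_def)

abbreviation cmp (infixr "\<bullet>" 75) where "f \<bullet> g \<equiv> f \<otimes>\<^bsub>AutGroup T\<^esub> g"
abbreviation iv where "iv f \<equiv> inv\<^bsub>AutGroup T\<^esub> f"
abbreviation pw where "pw f k \<equiv> f [^]\<^bsub>AutGroup T\<^esub> (k::int)"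

lemma cmp_closed [simp]: "f \<in> G \<Longrightarrow> g \<in> G \<Longrightarrow> f \<bullet> g \<in> G"
  using A.m_closed by simp
lemma iv_closed [simp]: "f \<in> G \<Longrightarrow> iv f \<in> G"
  using A.inv_closed by simp
lemma pw_closed [simp]: "f \<in> G \<Longrightarrow> pw f k \<in> G"
  using A.int_pow_closed by simp

lemma cmp_app [simp]: "f \<in> G \<Longrightarrow> g \<in> G \<Longrightarrow> x \<in> X \<Longrightarrow> (f \<bullet> g) x = f (g x)"
  unfolding Aut_def by (simp add: AutGroup_def BijGroup_def compose_def)

lemma one_app [simp]: "x \<in> X \<Longrightarrow> \<one>\<^bsub>AutGroup T\<^esub> x = x"
  by (simp add: AutGroup_def BijGroup_def)

lemma one_Aut [simp]: "\<one>\<^bsub>AutGroup T\<^esub> \<in> G"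
  using A.one_closed by simp

lemma iv_app [simp]: "f \<in> G \<Longrightarrow> x \<in> X \<Longrightarrow> iv f (f x) = x"
  by (metis A.l_inv carrier_AutGroup cmp_app iv_closed one_app)

lemma app_iv [simp]: "f \<in> G \<Longrightarrow> x \<in> X \<Longrightarrow> f (iv f x) = x"
  by (metis A.r_inv carrier_AutGroup cmp_app iv_closed one_app)

lemma iv_eq_iff: "f \<in> G \<Longrightarrow> x \<in> X \<Longrightarrow> y \<in> X \<Longrightarrow> iv f x = y \<longleftrightarrow> x = f y"
  by auto

lemma pw_add: "f \<in> G \<Longrightarrow> x \<in> X \<Longrightarrow> pw f (k + l) x = pw f k (pw f l x)"
  by (simp add: A.int_pow_mult)

lemma pw_0 [simp]: "x \<in> X \<Longrightarrow> pw f 0 x = x"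
  by simp

lemma pw_1 [simp]: "f \<in> G \<Longrightarrow> pw f 1 x = f x"
  by (simp add: A.int_pow_1)

lemma pw_minus1: "f \<in> G \<Longrightarrow> pw f (-1) = iv f"
  by (metis A.int_pow_1 A.int_pow_neg carrier_AutGroup)

lemma pw_mult: "f \<in> G \<Longrightarrow> pw f (k * l) = pw (pw f k) l"
  by (simp add: A.int_pow_pow)

lemma pw_Suc: "f \<in> G \<Longrightarrow> x \<in> X \<Longrightarrow> pw f (1 + k) x = f (pw f k x)"
  by (simp add: pw_add)

lemma pw_cancel [simp]: "f \<in> G \<Longrightarrow> x \<in> X \<Longrightarrow> pw f k (pw f (- k) x) = x"
  by (simp flip: pw_add)

lemma pw_X [simp]: "f \<in> G \<Longrightarrow> x \<in> X \<Longrightarrow> pw f k x \<in> X"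
  using Aut_closed pw_closed by blast

text \<open>Comparisons along orbits depend only on the difference of the exponents. This later
  reduces the order on finitely many orbits to sets of integers.\<close>

lemma pw_le: "f \<in> G \<Longrightarrow> x \<in> X \<Longrightarrow> y \<in> X \<Longrightarrow> pw f k x \<preceq> pw f l y \<longleftrightarrow> x \<preceq> pw f (l - k) y"
  using Aut_le[of "pw f k" x "pw f (l - k) y"] by (simp flip: pw_add)

lemma pw_meet: "f \<in> G \<Longrightarrow> x \<in> X \<Longrightarrow> y \<in> X \<Longrightarrow> pw f k x \<curlywedge> pw f l y = pw f k (x \<curlywedge> pw f (l - k) y)"
  using Aut_meet[of "pw f k" x "pw f (l - k) y"] by (simp flip: pw_add)

end

section \<open>The extension property\<close>

lemma meet_treeI:
  assumes "leq D \<subseteq> carrier D \<times> carrier D"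
    and "\<And>x. x \<in> carrier D \<Longrightarrow> (x, x) \<in> leq D"
    and "\<And>x y z. (x, y) \<in> leq D \<Longrightarrow> (y, z) \<in> leq D \<Longrightarrow> (x, z) \<in> leq D"
    and "\<And>x y. (x, y) \<in> leq D \<Longrightarrow> (y, x) \<in> leq D \<Longrightarrow> x = y"
    and "\<And>x y z. (x, z) \<in> leq D \<Longrightarrow> (y, z) \<in> leq D \<Longrightarrow> (x, y) \<in> leq D \<or> (y, x) \<in> leq D"
    and meet: "\<And>x y. x \<in> carrier D \<Longrightarrow> y \<in> carrier D \<Longrightarrow> (meet D x y, x) \<in> leq D"
      "\<And>x y. x \<in> carrier D \<Longrightarrow> y \<in> carrier D \<Longrightarrow> (meet D x y, y) \<in> leq D"
    and "\<And>x y z. (z, x) \<in> leq D \<Longrightarrow> (z, y) \<in> leq D \<Longrightarrow> (z, meet D x y) \<in> leq D"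
  shows "meet_tree D"
proof -
  have "partial_order_on (carrier D) (leq D)"
    using assms(1-4) unfolding partial_order_on_def preorder_on_def refl_on_def trans_def antisym_def
    by blast
  moreover have "total_on (under (leq D) a) (leq D)" for a
    using assms(5) unfolding total_on_def under_def by blast
  moreover have "meet D a b \<in> under (leq D) a \<inter> under (leq D) b"
    if "a \<in> carrier D" "b \<in> carrier D" for a b
    using meet that unfolding under_def by blast
  ultimately show ?thesis
    using assms(8) unfolding meet_tree_def under_def by blast
qed

text \<open>Universality of \<open>T\<close> is stated for trees of natural numbers, so a finite
  tree of sets has to be copied along an enumeration of its carrier before it can be
  embedded.\<close>

lemma meet_tree_isomorphic_nat:
  assumes "meet_tree D" "finite (carrier D)"
  shows "\<exists>(B :: nat meet_structure) h. meet_tree B \<and> finite (carrier B) \<and> h \<in> isomorphisms D B"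
proof -
  interpret D: meet_tree_struct D by unfold_locales fact
  obtain h where h: "bij_betw h (carrier D) {0..<card (carrier D)}"
    using ex_bij_betw_finite_nat[OF assms(2)] by blast
  define B :: "nat meet_structure" where
    "B = \<lparr>carrier = h ` carrier D, leq = {(h x, h y) | x y. (x, y) \<in> leq D},
          meet = \<lambda>p q. h (meet D (inv_into (carrier D) h p) (inv_into (carrier D) h q))\<rparr>"
  have inj: "inj_on h (carrier D)" using h by (simp add: bij_betw_def)
  have heq: "h x = h y \<longleftrightarrow> x = y" if "x \<in> carrier D" "y \<in> carrier D" for x y
    using inj that by (rule inj_on_eq_iff)
  have le: "(h x, h y) \<in> leq B \<longleftrightarrow> (x, y) \<in> leq D" if "x \<in> carrier D" "y \<in> carrier D" for x y
    using that heq D.le_carrier unfolding B_def by fastforce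
  have le_ex: "\<exists>x\<in>carrier D. \<exists>y\<in>carrier D. p = h x \<and> q = h y \<and> (x, y) \<in> leq D" if "(p, q) \<in> leq B" for p q
    using that D.le_carrier unfolding B_def by fastforce
  have mt: "meet B (h x) (h y) = h (meet D x y)" if "x \<in> carrier D" "y \<in> carrier D" for x y
    using that inj unfolding B_def by simp
  have car: "carrier B = h ` carrier D" by (simp add: B_def)
  have "meet_tree B"
  proof (rule meet_treeI)
    show "leq B \<subseteq> carrier B \<times> carrier B" using le_ex car by fastforce
    show "(x, x) \<in> leq B" if "x \<in> carrier B" for x
      using that le D.le_refl car by auto
    show "(x, z) \<in> leq B" if "(x, y) \<in> leq B" "(y, z) \<in> leq B" for x y z
      using le_ex[OF that(1)] le_ex[OF that(2)] heq le D.le_trans by metis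
    show "x = y" if "(x, y) \<in> leq B" "(y, x) \<in> leq B" for x y
      using le_ex[OF that(1)] le_ex[OF that(2)] heq D.le_antisym by metis
    show "(x, y) \<in> leq B \<or> (y, x) \<in> leq B" if "(x, z) \<in> leq B" "(y, z) \<in> leq B" for x y z
      using le_ex[OF that(1)] le_ex[OF that(2)] heq le D.le_linear by metis
    show "(meet B x y, x) \<in> leq B" "(meet B x y, y) \<in> leq B"
      if "x \<in> carrier B" "y \<in> carrier B" for x y
      using that le mt car D.meet_le1 D.meet_le2 D.meet_closed by auto
    show "(z, meet B x y) \<in> leq B" if zx: "(z, x) \<in> leq B" and zy: "(z, y) \<in> leq B" for x y z
    proof -
      obtain c a where 1: "c \<in> carrier D" "a \<in> carrier D" "z = h c" "x = h a" "(c, a) \<in> leq D"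
        using le_ex[OF zx] by blast
      obtain c' b where 2: "c' \<in> carrier D" "b \<in> carrier D" "z = h c'" "y = h b" "(c', b) \<in> leq D"
        using le_ex[OF zy] by blast
      have "c' = c" using heq[OF 1(1) 2(1)] 1(3) 2(3) by simp
      then show ?thesis using 1 2 le mt D.meet_greatest D.meet_closed by simp
    qed
  qed
  moreover have "finite (carrier B)" using assms(2) car by simp
  moreover have "h \<in> isomorphisms D B"
    using inj le mt car unfolding isomorphisms_def bij_betw_def by auto
  ultimately show ?thesis by blast
qed

text \<open>A partial embedding with domain \<open>S\<close>. The domain is a separate argument, so
  that one notion serves for partial maps of \<open>T\<close> into itself and for whole finite
  trees.\<close>

definition meet_embedding :: "'b meet_structure \<Rightarrow> 'c meet_structure \<Rightarrow> 'b set \<Rightarrow> ('b \<Rightarrow> 'c) \<Rightarrow> bool" where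
  "meet_embedding M N S f \<longleftrightarrow>
     substructure_carrier M S \<and> f ` S \<subseteq> carrier N \<and>
     (\<forall>a\<in>S. \<forall>b\<in>S. (f a, f b) \<in> leq N \<longleftrightarrow> (a, b) \<in> leq M) \<and>
     (\<forall>a\<in>S. \<forall>b\<in>S. f (meet M a b) = meet N (f a) (f b))"

locale universal_meet_tree = meet_tree_struct +
  assumes universal: "universal_dense_meet_tree T"
begin

lemma countable_X: "countable X"
  using universal by (simp add: universal_dense_meet_tree_def)

lemma carrier_generated [simp]:
  "substructure_carrier T S \<Longrightarrow> carrier (generated_substructure T S) = S"
  by (simp add: generated_substructure_def hull_same)

lemma embedding_extends:
  assumes "finite S" and f: "meet_embedding T T S f"
  shows "\<exists>g\<in>G. \<forall>x\<in>S. g x = f x"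
proof -
  have S: "substructure_carrier T S" "S \<subseteq> X" and fX: "f ` S \<subseteq> X"
    and le: "\<And>a b. a \<in> S \<Longrightarrow> b \<in> S \<Longrightarrow> f a \<preceq> f b \<longleftrightarrow> a \<preceq> b"
    and mt: "\<And>a b. a \<in> S \<Longrightarrow> b \<in> S \<Longrightarrow> f (a \<curlywedge> b) = f a \<curlywedge> f b"
    using f unfolding meet_embedding_def substructure_carrier_def by auto
  have closed: "a \<curlywedge> b \<in> S" if "a \<in> S" "b \<in> S" for a b
    using S(1) that unfolding substructure_carrier_def by blast
  have fS: "substructure_carrier T (f ` S)"
    using fX closed unfolding substructure_carrier_def by (auto simp flip: mt)
  have "inj_on f S"
    by (intro inj_onI) (metis le S(2) le_antisym le_refl subsetD)
  then have "f \<in> isomorphisms (generated_substructure T S) (generated_substructure T (f ` S))"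
    using S(1) fS le mt by (auto simp: isomorphisms_def bij_betw_def generated_substructure_def hull_same)
  moreover have "ultrahomogeneous T" using universal by (simp add: universal_dense_meet_tree_def)
  ultimately have "\<exists>\<sigma>\<in>Aut T. \<forall>x\<in>carrier (generated_substructure T S). \<sigma> x = f x"
    using assms(1) S(2) fX unfolding ultrahomogeneous_def by blast
  then show ?thesis using S(1) by simp
qed

text \<open>Universality gives a copy of \<open>D\<close> somewhere in \<open>T\<close>. Then
  \<open>e \<circ> j\<close> is a finite partial isomorphism of \<open>T\<close>; homogeneity
  extends it to some \<open>g\<close>, and \<open>iv g\<close> moves the copy so that it sits over
  \<open>S\<close>.\<close>

lemma extension_property:
  fixes D :: "'b meet_structure"
  assumes D: "meet_tree D" "finite (carrier D)" and "finite S" and j: "meet_embedding T D S j"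
  shows "\<exists>e. meet_embedding D T (carrier D) e \<and> (\<forall>a\<in>S. e (j a) = a)"
proof -
  interpret D: meet_tree_struct D by unfold_locales fact
  obtain B :: "nat meet_structure" and h where
    B: "meet_tree B" "finite (carrier B)" and h: "h \<in> isomorphisms D B"
    using meet_tree_isomorphic_nat[OF D] by blast
  obtain S' k where S': "finite S'" "S' \<subseteq> X" and k: "k \<in> isomorphisms (generated_substructure T S') B"
    using universal B unfolding universal_dense_meet_tree_def isomorphic_def by blast
  define H where "H = carrier (generated_substructure T S')"
  have "substructure_carrier T H"
    unfolding H_def generated_substructure_def hull_def substructure_carrier_def
    using S'(2) meet_closed by auto
  then have Hm: "a \<curlywedge> b \<in> H" if "a \<in> H" "b \<in> H" for a b
    using that unfolding substructure_carrier_def by auto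
  have HX: "H \<subseteq> X"
    using \<open>substructure_carrier T H\<close> unfolding substructure_carrier_def by blast
  have kb: "bij_betw k H (carrier B)"
    and kle: "\<And>a b. a \<in> H \<Longrightarrow> b \<in> H \<Longrightarrow> (k a, k b) \<in> leq B \<longleftrightarrow> a \<preceq> b"
    and km: "\<And>a b. a \<in> H \<Longrightarrow> b \<in> H \<Longrightarrow> k (a \<curlywedge> b) = meet B (k a) (k b)"
    using k unfolding isomorphisms_def H_def generated_substructure_def by auto
  have hb: "bij_betw h (carrier D) (carrier B)"
    and hle: "\<And>a b. a \<in> carrier D \<Longrightarrow> b \<in> carrier D \<Longrightarrow> (h a, h b) \<in> leq B \<longleftrightarrow> (a, b) \<in> leq D"
    and hm: "\<And>a b. a \<in> carrier D \<Longrightarrow> b \<in> carrier D \<Longrightarrow> h (meet D a b) = meet B (h a) (h b)"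
    using h unfolding isomorphisms_def by auto
  define e where "e x = inv_into H k (h x)" for x
  have eH: "e x \<in> H" and ke: "k (e x) = h x" if "x \<in> carrier D" for x
  proof -
    have "h x \<in> k ` H" using that hb kb by (auto simp: bij_betw_def)
    then show "e x \<in> H" "k (e x) = h x"
      unfolding e_def by (auto intro: inv_into_into f_inv_into_f)
  qed
  have kinj: "a = b" if "a \<in> H" "b \<in> H" "k a = k b" for a b
    using kb that unfolding bij_betw_def inj_on_def by blast
  have ele: "e x \<preceq> e y \<longleftrightarrow> (x, y) \<in> leq D" if "x \<in> carrier D" "y \<in> carrier D" for x y
    using that kle[OF eH eH] hle ke by metis
  have em: "e (meet D x y) = e x \<curlywedge> e y" if "x \<in> carrier D" "y \<in> carrier D" for x y
    using that eH ke hm km D.meet_closed Hm by (intro kinj) auto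
  have S: "S \<subseteq> X" and Sm: "\<And>a b. a \<in> S \<Longrightarrow> b \<in> S \<Longrightarrow> a \<curlywedge> b \<in> S"
    and jD: "\<And>a. a \<in> S \<Longrightarrow> j a \<in> carrier D"
    and jle: "\<And>a b. a \<in> S \<Longrightarrow> b \<in> S \<Longrightarrow> (j a, j b) \<in> leq D \<longleftrightarrow> a \<preceq> b"
    and jm: "\<And>a b. a \<in> S \<Longrightarrow> b \<in> S \<Longrightarrow> j (a \<curlywedge> b) = meet D (j a) (j b)"
    using j unfolding meet_embedding_def substructure_carrier_def by auto
  have "meet_embedding T T S (e \<circ> j)"
    using S Sm jD jle jm ele em eH HX
    unfolding meet_embedding_def substructure_carrier_def by auto
  then obtain g where g: "g \<in> G" "\<And>a. a \<in> S \<Longrightarrow> g a = e (j a)"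
    using embedding_extends[OF \<open>finite S\<close>] by fastforce
  have "meet_embedding D T (carrier D) (iv g \<circ> e)"
    using g(1) eH HX ele em Aut_le[OF iv_closed[OF g(1)]] Aut_meet[OF iv_closed[OF g(1)]]
      Aut_closed[OF iv_closed[OF g(1)]] D.meet_closed
    unfolding meet_embedding_def substructure_carrier_def by (auto simp: subset_iff)
  moreover have "(iv g \<circ> e) (j a) = a" if "a \<in> S" for a
    using g that S by (auto simp flip: g(2))
  ultimately show ?thesis by blast
qed

end

section \<open>Types and amalgamation of automorphisms\<close>

text \<open>Terms are formal, so that one term can be evaluated under different automorphisms and
  the resulting types can be compared as sets.\<close>

datatype 'a shift_term = Gen 'a | Shift "'a shift_term" | Unshift "'a shift_term"
  | Meet "'a shift_term" "'a shift_term"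

abbreviation terms :: "'a set \<Rightarrow> 'a shift_term set" where
  "terms A \<equiv> {t. set_shift_term t \<subseteq> A}"

context meet_tree_struct
begin

primrec ev :: "('a \<Rightarrow> 'a) \<Rightarrow> 'a shift_term \<Rightarrow> 'a" where
  "ev f (Gen a) = a"
| "ev f (Shift t) = f (ev f t)"
| "ev f (Unshift t) = iv f (ev f t)"
| "ev f (Meet s t) = ev f s \<curlywedge> ev f t"

lemma ev_closed: "f \<in> G \<Longrightarrow> set_shift_term t \<subseteq> X \<Longrightarrow> ev f t \<in> X"
  by (induction t) (auto simp: Aut_closed meet_closed)

text \<open>The quantifier-free type of \<open>A\<close> in the tree expanded by \<open>f\<close>.
  Equality of values is comparability both ways, so the order records it too.\<close>

definition tp :: "('a \<Rightarrow> 'a) \<Rightarrow> 'a set \<Rightarrow> ('a shift_term \<times> 'a shift_term) set" where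
  "tp f A = {(s, t). s \<in> terms A \<and> t \<in> terms A \<and> ev f s \<preceq> ev f t}"

text \<open>The three candidates lie below \<open>a\<close>, so they form a chain, and the least of
  them lies below all four points. Hence one round of pairwise meets already closes a set under
  meets.\<close>

lemma meet_pairs_closed:
  assumes "a \<in> X" "b \<in> X" "c \<in> X" "d \<in> X"
  shows "(a \<curlywedge> b) \<curlywedge> (c \<curlywedge> d) \<in> {a \<curlywedge> b, a \<curlywedge> c, a \<curlywedge> d}"
proof -
  have "\<exists>w\<in>{a \<curlywedge> b, a \<curlywedge> c, a \<curlywedge> d}. w \<preceq> a \<curlywedge> b \<and> w \<preceq> a \<curlywedge> c \<and> w \<preceq> a \<curlywedge> d"
  proof -
    have "\<exists>w\<in>{p, q, r}. w \<preceq> p \<and> w \<preceq> q \<and> w \<preceq> r" if "p \<preceq> a" "q \<preceq> a" "r \<preceq> a" for p q r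
      using le_linear[OF that(1,2)] le_linear[OF that(1,3)] le_linear[OF that(2,3)]
        le_refl[OF le_carrier(1)[OF that(1)]] le_refl[OF le_carrier(1)[OF that(2)]]
        le_refl[OF le_carrier(1)[OF that(3)]] le_trans by blast
    then show ?thesis using assms meet_le1 by blast
  qed
  then obtain w where w: "w \<in> {a \<curlywedge> b, a \<curlywedge> c, a \<curlywedge> d}" "w \<preceq> a \<curlywedge> b" "w \<preceq> a \<curlywedge> c" "w \<preceq> a \<curlywedge> d"
    by blast
  have "(a \<curlywedge> b) \<curlywedge> (c \<curlywedge> d) = w"
  proof (rule meet_eqI)
    show "w \<preceq> a \<curlywedge> b" by fact
    show "w \<preceq> c \<curlywedge> d"
      using w(3,4) assms meet_le2 le_trans by (blast intro: meet_greatest)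
    fix v assume v: "v \<preceq> a \<curlywedge> b" "v \<preceq> c \<curlywedge> d"
    then have "v \<preceq> a" "v \<preceq> b" "v \<preceq> c" "v \<preceq> d"
      using assms meet_le1 meet_le2 le_trans by blast+
    then show "v \<preceq> w" using w(1) meet_greatest by auto
  qed
  then show ?thesis using w(1) by simp
qed

definition meet_hull :: "'a set \<Rightarrow> 'a set" where
  "meet_hull S = {a \<curlywedge> b | a b. a \<in> S \<and> b \<in> S}"

lemma finite_meet_hull: "finite S \<Longrightarrow> finite (meet_hull S)"
  by (simp add: meet_hull_def finite_image_set2)

lemma meet_hull_X: "S \<subseteq> X \<Longrightarrow> meet_hull S \<subseteq> X"
  using meet_closed by (auto simp: meet_hull_def)

lemma subset_meet_hull: "S \<subseteq> X \<Longrightarrow> S \<subseteq> meet_hull S"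
  using meet_idem by (force simp: meet_hull_def)

lemma meet_hull_closed:
  assumes "S \<subseteq> X" "x \<in> meet_hull S" "y \<in> meet_hull S"
  shows "x \<curlywedge> y \<in> meet_hull S"
proof -
  obtain a b c d where "x = a \<curlywedge> b" "y = c \<curlywedge> d" "a \<in> S" "b \<in> S" "c \<in> S" "d \<in> S"
    using assms unfolding meet_hull_def by auto
  then show ?thesis
    using meet_pairs_closed[of a b c d] assms(1) unfolding meet_hull_def
    by blast
qed

lemma substructure_meet_hull: "S \<subseteq> X \<Longrightarrow> substructure_carrier T (meet_hull S)"
  unfolding substructure_carrier_def using meet_hull_X meet_hull_closed by blast

end

section \<open>A joint preorder on two copies of the tree\<close>

locale amalgamation = universal_meet_tree +
  fixes \<sigma> \<rho> :: "'a \<Rightarrow> 'a" and A :: "'a set"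
  assumes \<sigma>: "\<sigma> \<in> G" and \<rho>: "\<rho> \<in> G" and A: "A \<subseteq> X" and tp_eq: "tp \<sigma> A = tp \<rho> A"
begin

abbreviation I where "I \<equiv> terms A"

lemma ev_le: "s \<in> I \<Longrightarrow> t \<in> I \<Longrightarrow> ev \<sigma> s \<preceq> ev \<sigma> t \<longleftrightarrow> ev \<rho> s \<preceq> ev \<rho> t"
  using tp_eq unfolding tp_def by blast

lemma ev_X: "t \<in> I \<Longrightarrow> ev \<sigma> t \<in> X" "t \<in> I \<Longrightarrow> ev \<rho> t \<in> X"
  using ev_closed[OF \<sigma>] ev_closed[OF \<rho>] A by blast+

text \<open>The cut of \<open>x\<close> in the generated subtree is recorded by terms instead of
  values, which makes cuts in the two copies comparable.\<close>

definition lo where "lo f x = {t \<in> I. ev f t \<preceq> x}"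
definition up where "up f x = {t \<in> I. x \<preceq> ev f t}"

lemma lo_mono: "x \<preceq> y \<Longrightarrow> lo f x \<subseteq> lo f y"
  unfolding lo_def using le_trans by blast
lemma up_mono: "x \<preceq> y \<Longrightarrow> up f y \<subseteq> up f x"
  unfolding up_def using le_trans by blast

text \<open>A preorder on two copies of the tree, the first acted on by \<open>\<sigma>\<close> and the second by \<open>\<rho>\<close>, that
  identifies the values of each term in the two copies. In a cut of the common part, every
  element of the first copy is placed below every element of the second copy; this choice does
  not refer to individual elements, so \<open>\<sigma>\<close> and \<open>\<rho>\<close> together preserve the preorder.\<close>

fun joint_le :: "'a + 'a \<Rightarrow> 'a + 'a \<Rightarrow> bool" where
  "joint_le (Inl x) (Inl y) \<longleftrightarrow> x \<preceq> y"
| "joint_le (Inr x) (Inr y) \<longleftrightarrow> x \<preceq> y"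
| "joint_le (Inl x) (Inr y) \<longleftrightarrow> (\<exists>y'. y' \<preceq> y \<and> up \<rho> y' \<noteq> {} \<and> lo \<sigma> x \<subseteq> lo \<rho> y' \<and> up \<rho> y' \<subseteq> up \<sigma> x)"
| "joint_le (Inr y) (Inl x) \<longleftrightarrow> (\<exists>t\<in>I. y \<preceq> ev \<rho> t \<and> ev \<sigma> t \<preceq> x)"

text \<open>The witness \<open>y'\<close> in the definition is a point on the branch of
  \<open>y\<close> below some common value, since \<open>y\<close> itself may have left the common
  part and have empty \<open>up\<close>. The inclusions between the cuts of \<open>x\<close> and
  \<open>y'\<close> carry a term from one copy to the other when two mixed comparisons are
  composed.\<close>

lemma joint_le_trans:
  assumes "joint_le u v" "joint_le v w"
  shows "joint_le u w"
proof (cases u; cases v; cases w)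
  fix x y z assume uvw: "u = Inl x" "v = Inl y" "w = Inl z"
  show ?thesis using assms unfolding uvw joint_le.simps by (rule le_trans)
next
  fix x y z assume uvw: "u = Inl x" "v = Inl y" "w = Inr z"
  show ?thesis using assms lo_mono[of x y \<sigma>] up_mono[of x y \<sigma>] unfolding uvw joint_le.simps by blast
next
  fix x y z assume uvw: "u = Inl x" "v = Inr y" "w = Inl z"
  obtain y' t where t: "y' \<preceq> y" "up \<rho> y' \<subseteq> up \<sigma> x" "t \<in> I" "y \<preceq> ev \<rho> t" "ev \<sigma> t \<preceq> z"
    using assms unfolding uvw joint_le.simps by blast
  then have "t \<in> up \<rho> y'" using le_trans unfolding up_def by blast
  then have "x \<preceq> ev \<sigma> t" using t unfolding up_def by blast
  then show ?thesis using t unfolding uvw joint_le.simps by (blast intro: le_trans)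
next
  fix x y z assume uvw: "u = Inl x" "v = Inr y" "w = Inr z"
  show ?thesis using assms unfolding uvw joint_le.simps by (blast intro: le_trans)
next
  fix x y z assume uvw: "u = Inr x" "v = Inl y" "w = Inl z"
  show ?thesis using assms unfolding uvw joint_le.simps by (blast intro: le_trans)
next
  fix x y z assume uvw: "u = Inr x" "v = Inl y" "w = Inr z"
  obtain t y' where t: "t \<in> I" "x \<preceq> ev \<rho> t" "ev \<sigma> t \<preceq> y" "y' \<preceq> z" "lo \<sigma> y \<subseteq> lo \<rho> y'"
    using assms unfolding uvw joint_le.simps by blast
  then have "ev \<rho> t \<preceq> y'" unfolding lo_def by blast
  then show ?thesis using t unfolding uvw joint_le.simps by (blast intro: le_trans)
next
  fix x y z assume uvw: "u = Inr x" "v = Inr y" "w = Inl z"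
  show ?thesis using assms unfolding uvw joint_le.simps by (blast intro: le_trans)
next
  fix x y z assume uvw: "u = Inr x" "v = Inr y" "w = Inr z"
  show ?thesis using assms unfolding uvw joint_le.simps by (rule le_trans)
qed

text \<open>If both inclusions between the cuts hold, \<open>y\<close> is its own witness for lying
  above \<open>x\<close>. A term violating one of them separates the points in the other
  direction.\<close>

lemma joint_le_linear_below:
  assumes t: "t \<in> I" and x: "x \<preceq> ev \<sigma> t" and y: "y \<preceq> ev \<rho> t"
  shows "joint_le (Inl x) (Inr y) \<or> joint_le (Inr y) (Inl x)"
proof -
  consider "lo \<sigma> x \<subseteq> lo \<rho> y" "up \<rho> y \<subseteq> up \<sigma> x"
    | s where "s \<in> lo \<sigma> x" "s \<notin> lo \<rho> y" | s where "s \<in> up \<rho> y" "s \<notin> up \<sigma> x"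
    by blast
  then show ?thesis
  proof cases
    case 1
    moreover have "t \<in> up \<rho> y" using t y by (simp add: up_def)
    ultimately show ?thesis using le_refl le_carrier(1)[OF y] by auto
  next
    case 2
    then have s: "s \<in> I" "ev \<sigma> s \<preceq> x" "\<not> ev \<rho> s \<preceq> y" by (auto simp: lo_def)
    then have "ev \<rho> s \<preceq> ev \<rho> t" using ev_le t x le_trans by blast
    then have "y \<preceq> ev \<rho> s" using s le_linear y by blast
    then show ?thesis using s by auto
  next
    case 3
    then have s: "s \<in> I" "y \<preceq> ev \<rho> s" "\<not> x \<preceq> ev \<sigma> s" by (auto simp: up_def)
    \<comment> \<open>\<open>s\<close> may be off the branch of \<open>t\<close> and incomparable
      with \<open>x\<close>. The meet lies below \<open>ev \<sigma> t\<close>, as \<open>x\<close>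
      does, and cannot be above \<open>x\<close> because \<open>ev \<sigma> s\<close> is not; so it
      is below \<open>x\<close>.\<close>
    have "Meet s t \<in> I" using s t by simp
    moreover have "y \<preceq> ev \<rho> (Meet s t)" using s y meet_greatest by simp
    moreover have "ev \<sigma> (Meet s t) \<preceq> x"
      using s t x ev_X(1) le_linear[of "ev \<sigma> (Meet s t)" "ev \<sigma> t" x] le_trans[of x _ "ev \<sigma> s"] meet_le1 meet_le2
      by (metis ev.simps(4))
    ultimately show ?thesis using joint_le.simps(4) by blast
  qed
qed

text \<open>A mixed pair is comparable at once or lies below the value of one term, where
  \<open>joint_le_linear_below\<close> applies. Two points of one copy below a point of the other
  also lie below one common value, since their witnesses form a chain.\<close>

lemma joint_le_linear:
  assumes "joint_le u w" "joint_le v w"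
  shows "joint_le u v \<or> joint_le v u"
proof -
  have *: "joint_le (Inl x) (Inr y) \<or> joint_le (Inr y) (Inl x)" if "joint_le (Inl x) w" "joint_le (Inr y) w" for x y
  proof (cases w)
    case [simp]: (Inl z)
    then obtain t where t: "t \<in> I" "y \<preceq> ev \<rho> t" "ev \<sigma> t \<preceq> z" and "x \<preceq> z" using \<open>joint_le (Inr y) w\<close> \<open>joint_le (Inl x) w\<close> by auto
    then consider "x \<preceq> ev \<sigma> t" | "ev \<sigma> t \<preceq> x" using le_linear by blast
    then show ?thesis using joint_le_linear_below t by cases auto
  next
    case [simp]: (Inr z)
    obtain y' where y': "y' \<preceq> z" "up \<rho> y' \<noteq> {}" "lo \<sigma> x \<subseteq> lo \<rho> y'" "up \<rho> y' \<subseteq> up \<sigma> x"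
      and "y \<preceq> z" using \<open>joint_le (Inr y) w\<close> \<open>joint_le (Inl x) w\<close> by auto
    then consider "y' \<preceq> y" | "y \<preceq> y'" using le_linear by blast
    then show ?thesis
    proof cases
      case 2
      obtain t where "t \<in> up \<rho> y'" "t \<in> up \<sigma> x" using y' by blast
      then show ?thesis using joint_le_linear_below[of t x y] 2 le_trans unfolding up_def by blast
    qed (use y' in auto)
  qed
  show ?thesis
  proof (cases u; cases v)
    fix x y assume uv [simp]: "u = Inl x" "v = Inl y"
    show ?thesis
    proof (cases w)
      case (Inl z)
      then show ?thesis using assms le_linear by auto
    next
      case (Inr z)
      obtain x' where x': "x' \<preceq> z" "up \<rho> x' \<noteq> {}" "up \<rho> x' \<subseteq> up \<sigma> x" using assms Inr by auto
      obtain y' where y': "y' \<preceq> z" "up \<rho> y' \<noteq> {}" "up \<rho> y' \<subseteq> up \<sigma> y" using assms Inr by auto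
      have "up \<rho> x' \<subseteq> up \<rho> y' \<or> up \<rho> y' \<subseteq> up \<rho> x'"
        using le_linear[OF x'(1) y'(1)] up_mono by blast
      then obtain t where "t \<in> up \<sigma> x" "t \<in> up \<sigma> y" using x' y' by blast
      then show ?thesis using le_linear by (auto simp: up_def)
    qed
  next
    fix x y assume uv [simp]: "u = Inr x" "v = Inr y"
    show ?thesis
    proof (cases w)
      case (Inr z)
      then show ?thesis using assms le_linear by auto
    next
      case (Inl z)
      obtain s t where "s \<in> I" "x \<preceq> ev \<rho> s" "ev \<sigma> s \<preceq> z" "t \<in> I" "y \<preceq> ev \<rho> t" "ev \<sigma> t \<preceq> z"
        using assms Inl by auto
      moreover from this have "ev \<rho> s \<preceq> ev \<rho> t \<or> ev \<rho> t \<preceq> ev \<rho> s"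
        using le_linear[of "ev \<sigma> s" z "ev \<sigma> t"] ev_le by blast
      ultimately have "x \<preceq> ev \<rho> t \<and> y \<preceq> ev \<rho> t \<or> x \<preceq> ev \<rho> s \<and> y \<preceq> ev \<rho> s"
        using le_trans by blast
      then show ?thesis using le_linear by auto
    qed
  qed (use assms * in blast)+
qed

text \<open>Needed so that both copies embed together with their meets. The delicate case is a point
  of the first copy below two points of the second, whose witnesses have to be merged into one below
  the meet.\<close>

lemma joint_le_meet:
  assumes "x \<in> X" "y \<in> X"
  shows joint_le_Inl_meet: "joint_le w (Inl (x \<curlywedge> y)) \<longleftrightarrow> joint_le w (Inl x) \<and> joint_le w (Inl y)" (is ?l)
    and joint_le_Inr_meet: "joint_le w (Inr (x \<curlywedge> y)) \<longleftrightarrow> joint_le w (Inr x) \<and> joint_le w (Inr y)" (is ?r)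
proof -
  have "joint_le (Inl (x \<curlywedge> y)) (Inl x)" "joint_le (Inl (x \<curlywedge> y)) (Inl y)"
    "joint_le (Inr (x \<curlywedge> y)) (Inr x)" "joint_le (Inr (x \<curlywedge> y)) (Inr y)"
    using assms meet_le1 meet_le2 by auto
  note below = this[THEN joint_le_trans[rotated]]
  show ?l
  proof (intro iffI conjI; (elim conjE)?)
    assume w: "joint_le w (Inl x)" "joint_le w (Inl y)"
    show "joint_le w (Inl (x \<curlywedge> y))"
    proof (cases w)
      case (Inl z)
      then show ?thesis using w meet_greatest by auto
    next
      case [simp]: (Inr z)
      obtain s t where st: "s \<in> I" "z \<preceq> ev \<rho> s" "ev \<sigma> s \<preceq> x" "t \<in> I" "z \<preceq> ev \<rho> t" "ev \<sigma> t \<preceq> y"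
        using w by auto
      then have "Meet s t \<in> I" "z \<preceq> ev \<rho> (Meet s t)" using meet_greatest by auto
      moreover have "ev \<sigma> (Meet s t) \<preceq> x \<curlywedge> y"
        using st ev_X(1) meet_le1 meet_le2 le_trans meet_greatest ev.simps(4) by metis
      ultimately show ?thesis unfolding Inr joint_le.simps by blast
    qed
  qed (use below in auto)
  show ?r
  proof (intro iffI conjI; (elim conjE)?)
    assume w: "joint_le w (Inr x)" "joint_le w (Inr y)"
    show "joint_le w (Inr (x \<curlywedge> y))"
    proof (cases w)
      case (Inr z)
      then show ?thesis using w meet_greatest by auto
    next
      case Inl: (Inl z)
      obtain x' where x': "x' \<preceq> x" "up \<rho> x' \<noteq> {}" "lo \<sigma> z \<subseteq> lo \<rho> x'" "up \<rho> x' \<subseteq> up \<sigma> z"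
        using w Inl by auto
      obtain y' where y': "y' \<preceq> y" "up \<rho> y' \<noteq> {}" "lo \<sigma> z \<subseteq> lo \<rho> y'" "up \<rho> y' \<subseteq> up \<sigma> z"
        using w Inl by auto
      obtain s t where s: "s \<in> up \<rho> x'" "s \<in> up \<sigma> z" and t: "t \<in> up \<rho> y'" "t \<in> up \<sigma> z"
        using x' y' by blast
      \<comment> \<open>Either one of the two witnesses lies below both \<open>x\<close> and
        \<open>y\<close>, or the value of \<open>b\<close> does. In the latter case this value is
        itself a witness, because \<open>z\<close> lies below the value of \<open>b\<close> in the
        first copy.\<close>
      define b where "b = Meet s t"
      have b: "b \<in> I" "z \<preceq> ev \<sigma> b" using s t meet_greatest by (auto simp: up_def b_def)
      have bs: "ev \<rho> b \<preceq> ev \<rho> s" "ev \<rho> b \<preceq> ev \<rho> t"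
        using s t ev_X(2) meet_le1 meet_le2 by (auto simp: up_def b_def)
      have xs: "x' \<preceq> ev \<rho> s" "y' \<preceq> ev \<rho> t" using s t by (auto simp: up_def)
      consider "x' \<preceq> y" | "y' \<preceq> x" | "ev \<rho> b \<preceq> x" "ev \<rho> b \<preceq> y"
      proof -
        consider "ev \<rho> b \<preceq> x'" "ev \<rho> b \<preceq> y'" | "x' \<preceq> ev \<rho> b" | "y' \<preceq> ev \<rho> b"
          using le_linear bs xs by blast
        then show thesis
        proof cases
          case 1
          then show thesis using that(3) le_trans x'(1) y'(1) by blast
        next
          case 2
          then have "x' \<preceq> y' \<or> y' \<preceq> x'" using le_linear le_trans bs xs by blast
          then show thesis using that(1,2) le_trans x'(1) y'(1) by blast
        next
          case 3
          then have "x' \<preceq> y' \<or> y' \<preceq> x'" using le_linear le_trans bs xs by blast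
          then show thesis using that(1,2) le_trans x'(1) y'(1) by blast
        qed
      qed
      then show ?thesis
      proof cases
        case 1
        then show ?thesis using x' meet_greatest[OF x'(1)] unfolding Inl joint_le.simps by blast
      next
        case 2
        then show ?thesis using y' meet_greatest[OF _ y'(1)] unfolding Inl joint_le.simps by blast
      next
        case 3
        have "b \<in> up \<rho> (ev \<rho> b)" using b ev_X le_refl by (simp add: up_def)
        moreover have "lo \<sigma> z \<subseteq> lo \<rho> (ev \<rho> b)" "up \<rho> (ev \<rho> b) \<subseteq> up \<sigma> z"
          using b ev_le le_trans unfolding lo_def up_def by blast+
        ultimately show ?thesis using meet_greatest[OF 3] unfolding Inl joint_le.simps by blast
      qed
    qed
  qed (use below in auto)
qed

definition V where "V = Inl ` X \<union> Inr ` X"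

text \<open>Principal lower sets turn the preorder into inclusion and identify equivalent points of
  the two copies.\<close>

definition lower where "lower w = {u. joint_le u w}"

lemma V_simps [simp]: "Inl x \<in> V \<longleftrightarrow> x \<in> X" "Inr x \<in> V \<longleftrightarrow> x \<in> X"
  by (auto simp: V_def)

lemma joint_le_V: "joint_le u w \<Longrightarrow> u \<in> V"
proof (induction u w rule: joint_le.induct)
  case (3 x y)
  then obtain t where "t \<in> up \<sigma> x" unfolding joint_le.simps by blast
  then show ?case by (auto simp: up_def dest: le_carrier)
qed (auto dest: le_carrier)

lemma joint_le_refl: "w \<in> V \<Longrightarrow> joint_le w w"
  by (auto simp: V_def le_refl)

lemma lower_subset_iff: "u \<in> V \<Longrightarrow> lower u \<subseteq> lower w \<longleftrightarrow> joint_le u w"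
  using joint_le_refl joint_le_trans unfolding lower_def by blast

lemma lower_Inl_meet: "x \<in> X \<Longrightarrow> y \<in> X \<Longrightarrow> lower (Inl (x \<curlywedge> y)) = lower (Inl x) \<inter> lower (Inl y)"
  by (auto simp: lower_def joint_le_Inl_meet simp del: joint_le.simps)

lemma lower_Inr_meet: "x \<in> X \<Longrightarrow> y \<in> X \<Longrightarrow> lower (Inr (x \<curlywedge> y)) = lower (Inr x) \<inter> lower (Inr y)"
  by (auto simp: lower_def joint_le_Inr_meet simp del: joint_le.simps)

lemma lower_base:
  assumes "a \<in> A"
  shows "lower (Inl a) = lower (Inr a)"
proof -
  have a: "Gen a \<in> I" "a \<preceq> a" using assms A le_refl by auto
  have "lo \<sigma> a \<subseteq> lo \<rho> a" "up \<rho> a \<subseteq> up \<sigma> a"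
    using ev_le[OF _ a(1)] ev_le[OF a(1)] by (auto simp: lo_def up_def)
  moreover have "Gen a \<in> up \<rho> a" using a by (simp add: up_def)
  ultimately have "joint_le (Inl a) (Inr a)" using a(2) by auto
  moreover have "joint_le (Inr a) (Inl a)"
    unfolding joint_le.simps using a by (intro bexI[of _ "Gen a"]) simp_all
  ultimately show ?thesis using joint_le_trans unfolding lower_def by blast
qed

section \<open>The joint automorphism and its action on cuts\<close>

definition \<Phi> where "\<Phi> = map_sum \<sigma> \<rho>"

lemma Shift_lo: "f \<in> G \<Longrightarrow> x \<in> X \<Longrightarrow> Shift t \<in> lo f (f x) \<longleftrightarrow> t \<in> lo f x"
  using Aut_le[of f "ev f t" x] ev_closed[of f t] A by (auto simp: lo_def)
lemma Shift_up: "f \<in> G \<Longrightarrow> x \<in> X \<Longrightarrow> Shift t \<in> up f (f x) \<longleftrightarrow> t \<in> up f x"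
  using Aut_le[of f x "ev f t"] ev_closed[of f t] A by (auto simp: up_def)
lemma Unshift_lo: "f \<in> G \<Longrightarrow> x \<in> X \<Longrightarrow> Unshift t \<in> lo f x \<longleftrightarrow> t \<in> lo f (f x)"
  using Aut_le[of f "iv f (ev f t)" x] ev_closed[of f t] A Aut_closed[of "iv f"] by (auto simp: lo_def)
lemma Unshift_up: "f \<in> G \<Longrightarrow> x \<in> X \<Longrightarrow> Unshift t \<in> up f x \<longleftrightarrow> t \<in> up f (f x)"
  using Aut_le[of f x "iv f (ev f t)"] ev_closed[of f t] A Aut_closed[of "iv f"] by (auto simp: up_def)

text \<open>\<open>Shift\<close> maps the cut of a point into that of its image and
  \<open>Unshift\<close> goes back, in both copies alike; so inclusions between cuts are
  invariant.\<close>

lemma lo_shift: "f \<in> G \<Longrightarrow> g \<in> G \<Longrightarrow> x \<in> X \<Longrightarrow> y \<in> X \<Longrightarrow> lo f (f x) \<subseteq> lo g (g y) \<longleftrightarrow> lo f x \<subseteq> lo g y"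
  using Shift_lo Unshift_lo by blast
lemma up_shift: "f \<in> G \<Longrightarrow> g \<in> G \<Longrightarrow> x \<in> X \<Longrightarrow> y \<in> X \<Longrightarrow> up f (f x) \<subseteq> up g (g y) \<longleftrightarrow> up f x \<subseteq> up g y"
  using Shift_up Unshift_up by blast
lemma up_shift_empty: "f \<in> G \<Longrightarrow> x \<in> X \<Longrightarrow> up f (f x) = {} \<longleftrightarrow> up f x = {}"
  using Shift_up Unshift_up by blast

lemma joint_le_\<Phi>:
  assumes "u \<in> V" "w \<in> V"
  shows "joint_le (\<Phi> u) (\<Phi> w) \<longleftrightarrow> joint_le u w"
proof (cases u; cases w)
  fix x y assume uw: "u = Inl x" "w = Inr y"
  then have xy: "x \<in> X" "y \<in> X" using assms by (auto simp: V_def)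
  show ?thesis
  proof
    assume "joint_le u w"
    then obtain y' where y': "y' \<preceq> y" "up \<rho> y' \<noteq> {}" "lo \<sigma> x \<subseteq> lo \<rho> y'" "up \<rho> y' \<subseteq> up \<sigma> x"
      unfolding uw joint_le.simps by blast
    then have "\<rho> y' \<preceq> \<rho> y" "up \<rho> (\<rho> y') \<noteq> {}" "lo \<sigma> (\<sigma> x) \<subseteq> lo \<rho> (\<rho> y')" "up \<rho> (\<rho> y') \<subseteq> up \<sigma> (\<sigma> x)"
      using xy le_carrier(1)[OF y'(1)] Aut_le \<rho> \<sigma> by (auto simp: lo_shift up_shift up_shift_empty)
    then show "joint_le (\<Phi> u) (\<Phi> w)" unfolding uw \<Phi>_def map_sum.simps joint_le.simps by blast
  next
    assume "joint_le (\<Phi> u) (\<Phi> w)"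
    then obtain z where z: "z \<preceq> \<rho> y" "up \<rho> z \<noteq> {}" "lo \<sigma> (\<sigma> x) \<subseteq> lo \<rho> z" "up \<rho> z \<subseteq> up \<sigma> (\<sigma> x)"
      unfolding uw \<Phi>_def map_sum.simps joint_le.simps by blast
    define y' where "y' = iv \<rho> z"
    have y': "y' \<in> X" "z = \<rho> y'"
      using le_carrier(1)[OF z(1)] Aut_closed[OF iv_closed[OF \<rho>]] \<rho> by (auto simp: y'_def)
    then have "y' \<preceq> y" "up \<rho> y' \<noteq> {}" "lo \<sigma> x \<subseteq> lo \<rho> y'" "up \<rho> y' \<subseteq> up \<sigma> x"
      using z xy Aut_le \<rho> \<sigma> by (auto simp: lo_shift up_shift up_shift_empty)
    then show "joint_le u w" unfolding uw joint_le.simps by blast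
  qed
next
  fix y x assume uw: "u = Inr y" "w = Inl x"
  then have xy: "x \<in> X" "y \<in> X" using assms by (auto simp: V_def)
  have joint_le_up_lo: "joint_le (Inr y) (Inl x) \<longleftrightarrow> (\<exists>t. t \<in> up \<rho> y \<and> t \<in> lo \<sigma> x)" for x y
    by (auto simp: up_def lo_def)
  show ?thesis
    unfolding uw \<Phi>_def map_sum.simps joint_le_up_lo
    using Shift_up[OF \<rho> xy(2)] Unshift_up[OF \<rho> xy(2)] Shift_lo[OF \<sigma> xy(1)] Unshift_lo[OF \<sigma> xy(1)]
    by blast
qed (use assms Aut_le \<sigma> \<rho> in \<open>auto simp: V_def \<Phi>_def\<close>)

lemma V_\<Phi>: "w \<in> V \<Longrightarrow> \<exists>u\<in>V. w = \<Phi> u"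
proof -
  assume "w \<in> V"
  then have "map_sum (iv \<sigma>) (iv \<rho>) w \<in> V" "w = \<Phi> (map_sum (iv \<sigma>) (iv \<rho>) w)"
    using \<sigma> \<rho> Aut_closed[OF iv_closed] by (auto simp: V_def \<Phi>_def)
  then show ?thesis by blast
qed

lemma lower_\<Phi>: "w \<in> V \<Longrightarrow> lower (\<Phi> w) = \<Phi> ` lower w"
proof (intro equalityI subsetI)
  fix v assume w: "w \<in> V" and v: "v \<in> lower (\<Phi> w)"
  then obtain u where "u \<in> V" "v = \<Phi> u" using joint_le_V V_\<Phi> unfolding lower_def by blast
  then show "v \<in> \<Phi> ` lower w" using w v joint_le_\<Phi> unfolding lower_def by blast
next
  fix v assume w: "w \<in> V" and v: "v \<in> \<Phi> ` lower w"
  then show "v \<in> lower (\<Phi> w)" using joint_le_\<Phi> joint_le_V unfolding lower_def by blast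
qed

lemma inj_\<Phi>: "inj_on \<Phi> V"
  using Aut_eq_iff \<sigma> \<rho> by (auto simp: inj_on_def V_def \<Phi>_def)

text \<open>Meets in the amalgam are intersections of principal lower sets. Elements of the two copies
  may lack a meet in \<open>joint_le\<close>, and then the intersection is a new element, possibly the empty set.\<close>

definition pairs where "pairs P = {lower u \<inter> lower v | u v. u \<in> P \<and> v \<in> P}"

lemma lower_in_pairs: "u \<in> P \<Longrightarrow> lower u \<in> pairs P"
  unfolding pairs_def by blast

lemma pairs_mono: "P \<subseteq> P' \<Longrightarrow> pairs P \<subseteq> pairs P'"
  unfolding pairs_def by blast

lemma pairs_down: "Z \<in> pairs P \<Longrightarrow> u \<in> Z \<Longrightarrow> joint_le v u \<Longrightarrow> v \<in> Z"
  unfolding pairs_def lower_def using joint_le_trans by blast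

text \<open>Both sets are closed downwards inside a linearly preordered set: if \<open>u\<close>
  lies in \<open>Y\<close> only, each element of \<open>Z\<close> is comparable with
  \<open>u\<close> but not above it, hence in \<open>Y\<close>.\<close>

lemma pairs_linear:
  assumes "Y \<subseteq> lower w" "Z \<subseteq> lower w" "Y \<in> pairs P" "Z \<in> pairs P"
  shows "Y \<subseteq> Z \<or> Z \<subseteq> Y"
  using assms joint_le_linear pairs_down unfolding lower_def by blast

text \<open>The counterpart of \<open>meet_pairs_closed\<close>: three intersections inside
  \<open>lower a\<close> form a chain, so a finite family is already closed.\<close>

lemma pairs_Int:
  assumes "Y \<in> pairs P" "Z \<in> pairs P"
  shows "Y \<inter> Z \<in> pairs P"
proof -
  obtain a b c d where abcd: "a \<in> P" "b \<in> P" "c \<in> P" "d \<in> P"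
    and Y: "Y = lower a \<inter> lower b" and Z: "Z = lower c \<inter> lower d"
    using assms unfolding pairs_def by blast
  have in_pairs: "lower a \<inter> lower b \<in> pairs P" "lower a \<inter> lower c \<in> pairs P" "lower a \<inter> lower d \<in> pairs P"
    using abcd unfolding pairs_def by blast+
  have "Y \<inter> Z = (lower a \<inter> lower b) \<inter> (lower a \<inter> lower c) \<inter> (lower a \<inter> lower d)"
    using Y Z by blast
  also have "\<dots> \<in> {lower a \<inter> lower b, lower a \<inter> lower c, lower a \<inter> lower d}"
    using pairs_linear[OF Int_lower1 Int_lower1 in_pairs(1,2)]
      pairs_linear[OF Int_lower1 Int_lower1 in_pairs(1,3)]
      pairs_linear[OF Int_lower1 Int_lower1 in_pairs(2,3)]
    by blast
  finally show ?thesis using in_pairs by auto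
qed

lemma finite_pairs: "finite P \<Longrightarrow> finite (pairs P)"
  by (simp add: pairs_def finite_image_set2)

lemma pairs_\<Phi>:
  assumes "P \<subseteq> V" "Z \<in> pairs P"
  shows "\<Phi> ` Z \<in> pairs (\<Phi> ` P)"
proof -
  obtain u v where uv: "u \<in> P" "v \<in> P" "Z = lower u \<inter> lower v" using assms unfolding pairs_def by blast
  have "lower u \<subseteq> V" "lower v \<subseteq> V" using joint_le_V unfolding lower_def by blast+
  then have "\<Phi> ` Z = \<Phi> ` lower u \<inter> \<Phi> ` lower v"
    unfolding uv(3) by (intro inj_on_image_Int[OF inj_\<Phi>])
  also have "\<dots> = lower (\<Phi> u) \<inter> lower (\<Phi> v)" using uv assms(1) lower_\<Phi>[of u] lower_\<Phi>[of v] by (simp add: subset_iff)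
  finally show ?thesis using uv unfolding pairs_def by blast
qed

lemma pairs_V: "P \<subseteq> V \<Longrightarrow> Z \<in> pairs P \<Longrightarrow> Z \<subseteq> V"
  using joint_le_V unfolding pairs_def lower_def by blast

definition pairs_tree :: "('a + 'a) set \<Rightarrow> ('a + 'a) set meet_structure" where
  "pairs_tree E = \<lparr>carrier = pairs E, leq = {(Y, Z). Y \<in> pairs E \<and> Z \<in> pairs E \<and> Y \<subseteq> Z}, meet = (\<inter>)\<rparr>"

lemma meet_tree_pairs: "meet_tree (pairs_tree E)"
proof (rule meet_treeI)
  show "(Y, Z) \<in> leq (pairs_tree E) \<or> (Z, Y) \<in> leq (pairs_tree E)"
    if YW: "(Y, W) \<in> leq (pairs_tree E)" and ZW: "(Z, W) \<in> leq (pairs_tree E)" for Y Z W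
  proof -
    have in_pairs: "Y \<in> pairs E" "Z \<in> pairs E" "W \<in> pairs E" and sub: "Y \<subseteq> W" "Z \<subseteq> W"
      using YW ZW by (auto simp: pairs_tree_def)
    obtain w where "W \<subseteq> lower w" using in_pairs(3) unfolding pairs_def by blast
    then have "Y \<subseteq> Z \<or> Z \<subseteq> Y" using pairs_linear in_pairs(1,2) sub by (meson subset_trans)
    then show ?thesis using in_pairs by (auto simp: pairs_tree_def)
  qed
qed (auto simp: pairs_tree_def pairs_Int)

text \<open>The last clause says that \<open>\<sigma>'\<close> conjugated by \<open>g\<close> agrees
  with \<open>\<rho>\<close> on \<open>R\<close>. A finite part of the amalgam is embedded into
  \<open>T\<close> with the first copy kept in place; \<open>g\<close> carries the second copy onto
  its image, and \<open>\<sigma>'\<close> extends the action of \<open>\<Phi>\<close>.\<close>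

lemma amalgam:
  assumes "finite A" "finite F" "F \<subseteq> X" "finite R" "R \<subseteq> X"
  shows "\<exists>\<sigma>'\<in>G. \<exists>g\<in>G. (\<forall>x\<in>F. \<sigma>' x = \<sigma> x) \<and> (\<forall>a\<in>A. g a = a) \<and> (\<forall>x\<in>R. \<sigma>' (g x) = g (\<rho> x))"
proof -
  \<comment> \<open>Images are included so that the finite tree contains both the part on which
    \<open>\<Phi>\<close> is to be realised and the image of that part.\<close>
  define S where "S = A \<union> F \<union> \<sigma> ` F"
  define S' where "S' = A \<union> R \<union> \<rho> ` R"
  define E where "E = Inl ` S \<union> Inr ` S'"
  have S: "finite S" "S \<subseteq> X" and S': "finite S'" "S' \<subseteq> X"
    using assms A Aut_closed \<sigma> \<rho> unfolding S_def S'_def by auto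
  have E: "finite E" "E \<subseteq> V" using S S' unfolding E_def V_def by auto
  let ?D = "pairs_tree E"
  have D: "meet_tree ?D" "finite (carrier ?D)"
    using meet_tree_pairs finite_pairs E by (auto simp: pairs_tree_def)
  have car: "carrier ?D = pairs E" by (simp add: pairs_tree_def)
  have Sj: "lower (Inl x) \<in> pairs E" if "x \<in> meet_hull S" for x
    using that S lower_Inl_meet unfolding meet_hull_def pairs_def E_def by (fastforce simp: subset_iff)
  have S'j: "lower (Inr x) \<in> pairs E" if "x \<in> meet_hull S'" for x
    using that S' lower_Inr_meet unfolding meet_hull_def pairs_def E_def by (fastforce simp: subset_iff)
  have "meet_embedding T ?D (meet_hull S) (\<lambda>x. lower (Inl x))"
    unfolding meet_embedding_def
    using substructure_meet_hull[OF S(2)] Sj meet_hull_X[OF S(2)] lower_Inl_meet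
      lower_subset_iff[of "Inl _" "Inl _"]
    by (auto simp: pairs_tree_def V_def subset_iff[of "meet_hull S"])
  then obtain e where e: "meet_embedding ?D T (pairs E) e" and eS: "\<And>x. x \<in> meet_hull S \<Longrightarrow> e (lower (Inl x)) = x"
    using extension_property[OF D finite_meet_hull[OF S(1)]] car by metis
  have eX: "e Z \<in> X" if "Z \<in> pairs E" for Z
    using e that unfolding meet_embedding_def by blast
  have ele: "e Y \<preceq> e Z \<longleftrightarrow> Y \<subseteq> Z" if "Y \<in> pairs E" "Z \<in> pairs E" for Y Z
    using e that unfolding meet_embedding_def by (auto simp: pairs_tree_def)
  have em: "e (Y \<inter> Z) = e Y \<curlywedge> e Z" if "Y \<in> pairs E" "Z \<in> pairs E" for Y Z
    using e that unfolding meet_embedding_def by (auto simp: pairs_tree_def)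
  have einj: "inj_on e (pairs E)"
    by (intro inj_onI equalityI) (metis ele eX le_refl)+
  have "meet_embedding T T (meet_hull S') (\<lambda>y. e (lower (Inr y)))"
    unfolding meet_embedding_def
    using substructure_meet_hull[OF S'(2)] S'j meet_hull_X[OF S'(2)] lower_Inr_meet eX ele em
      lower_subset_iff[of "Inr _" "Inr _"]
    by (auto simp: V_def subset_iff[of "meet_hull S'"])
  then obtain g where g: "g \<in> G" and gS': "\<And>y. y \<in> meet_hull S' \<Longrightarrow> g y = e (lower (Inr y))"
    using embedding_extends[OF finite_meet_hull[OF S'(1)]] by blast
  have SS: "S \<subseteq> meet_hull S" "S' \<subseteq> meet_hull S'" using subset_meet_hull S(2) S'(2) by auto
  have gA: "g a = a" if "a \<in> A" for a
  proof -
    have "g a = e (lower (Inr a))" using gS' SS that S'_def by auto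
    also have "\<dots> = a"
    proof -
      have "a \<in> meet_hull S" using SS that S_def by auto
      then show ?thesis using lower_base[OF that] eS[of a] by simp
    qed
    finally show ?thesis .
  qed
  define P where "P = Inl ` F \<union> Inr ` R"
  have P: "P \<subseteq> E" "\<Phi> ` P \<subseteq> E" "P \<subseteq> V" using E(2) unfolding P_def E_def S_def S'_def \<Phi>_def by auto
  have PE: "pairs P \<subseteq> pairs E" "pairs (\<Phi> ` P) \<subseteq> pairs E" using P pairs_mono by auto
  have \<Phi>E: "\<Phi> ` Z \<in> pairs E" if "Z \<in> pairs P" for Z
    using pairs_\<Phi>[OF P(3) that] PE by blast
  define s where "s x = e (\<Phi> ` inv_into (pairs E) e x)" for x
  have s: "s (e Z) = e (\<Phi> ` Z)" if "Z \<in> pairs P" for Z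
    using that PE einj unfolding s_def by (simp add: subset_iff)
  have \<Phi>sub: "\<Phi> ` Y \<subseteq> \<Phi> ` Z \<longleftrightarrow> Y \<subseteq> Z" if "Y \<in> pairs P" "Z \<in> pairs P" for Y Z
    using inj_on_image_subset_iff[OF inj_\<Phi>] pairs_V[OF P(3)] that by blast
  have \<Phi>Int: "\<Phi> ` (Y \<inter> Z) = \<Phi> ` Y \<inter> \<Phi> ` Z" if "Y \<in> pairs P" "Z \<in> pairs P" for Y Z
    using inj_on_image_Int[OF inj_\<Phi>] pairs_V[OF P(3)] that by blast
  have "meet_embedding T T (e ` pairs P) s"
    unfolding meet_embedding_def substructure_carrier_def
  proof (intro conjI ballI)
    show "e ` pairs P \<subseteq> X" "s ` e ` pairs P \<subseteq> X" using PE eX \<Phi>E by (auto simp: s)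
    fix a b assume "a \<in> e ` pairs P" "b \<in> e ` pairs P"
    then obtain Y Z where YZ: "Y \<in> pairs P" "Z \<in> pairs P" and ab: "a = e Y" "b = e Z" by blast
    have m: "a \<curlywedge> b = e (Y \<inter> Z)" using em YZ PE ab by (simp add: subset_iff)
    show "a \<curlywedge> b \<in> e ` pairs P" unfolding m using YZ pairs_Int by blast
    show "s a \<preceq> s b \<longleftrightarrow> a \<preceq> b"
      using YZ PE ele \<Phi>E \<Phi>sub unfolding ab by (auto simp: s subset_iff)
    show "s (a \<curlywedge> b) = s a \<curlywedge> s b"
      unfolding m unfolding ab using YZ pairs_Int em \<Phi>E by (simp add: s \<Phi>Int)
  qed
  moreover have "finite (e ` pairs P)" using finite_pairs assms unfolding P_def by auto
  ultimately obtain \<sigma>' where \<sigma>': "\<sigma>' \<in> G" "\<And>Z. Z \<in> pairs P \<Longrightarrow> \<sigma>' (e Z) = e (\<Phi> ` Z)"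
    using embedding_extends s by (metis imageI)
  have \<sigma>'lower: "\<sigma>' (e (lower w)) = e (lower (\<Phi> w))" if "w \<in> P" for w
    using \<sigma>'(2)[OF lower_in_pairs[OF that]] lower_\<Phi> P that by auto
  have "\<sigma>' x = \<sigma> x" if "x \<in> F" for x
  proof -
    have "x \<in> meet_hull S" "\<sigma> x \<in> meet_hull S" using that SS S_def by auto
    then show ?thesis using \<sigma>'lower[of "Inl x"] that eS by (simp add: P_def \<Phi>_def)
  qed
  moreover have "\<sigma>' (g x) = g (\<rho> x)" if "x \<in> R" for x
  proof -
    have "x \<in> meet_hull S'" "\<rho> x \<in> meet_hull S'" using that SS S'_def by auto
    then show ?thesis using \<sigma>'lower[of "Inr x"] that gS' by (simp add: P_def \<Phi>_def)
  qed
  ultimately show ?thesis using \<sigma>'(1) g gA by blast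
qed

end

section \<open>Points with infinitely branching orbits\<close>

context meet_tree_struct
begin

text \<open>For \<open>z \<preceq> x\<close> these are the points that separate from
  \<open>x\<close> strictly above \<open>z\<close>.\<close>

definition cone :: "'a \<Rightarrow> 'a \<Rightarrow> 'a set" where
  "cone z x = {u \<in> X. \<not> u \<curlywedge> x \<preceq> z}"

text \<open>Both given meets lie below \<open>q\<close>, so they are comparable, and the lower one
  lies below \<open>p \<curlywedge> r\<close>.\<close>

lemma not_meet_le_trans:
  assumes "p \<in> X" "q \<in> X" "r \<in> X" "\<not> p \<curlywedge> q \<preceq> z" "\<not> q \<curlywedge> r \<preceq> z"
  shows "\<not> p \<curlywedge> r \<preceq> z"
proof -
  have "p \<curlywedge> q \<preceq> q \<curlywedge> r \<or> q \<curlywedge> r \<preceq> p \<curlywedge> q"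
    using assms meet_le1 meet_le2 le_linear by blast
  then have "p \<curlywedge> q \<preceq> p \<curlywedge> r \<or> q \<curlywedge> r \<preceq> p \<curlywedge> r"
    using assms meet_le1 meet_le2 le_trans meet_greatest by meson
  then show ?thesis using assms(4,5) le_trans by blast
qed

lemma cone_above:
  assumes "z \<preceq> x" "u \<in> cone z x"
  shows "z \<preceq> u"
proof -
  have u: "u \<in> X" "\<not> u \<curlywedge> x \<preceq> z" and x: "x \<in> X"
    using assms le_carrier by (auto simp: cone_def)
  then have "z \<preceq> u \<curlywedge> x" using le_linear[OF assms(1) meet_le2[OF u(1) x]] by blast
  then show ?thesis using meet_le1[OF u(1) x] le_trans by blast
qed

lemma cone_invariant:
  assumes f: "f \<in> G" "f z = z" "f x \<in> cone z x" and x: "x \<in> X" "z \<in> X" and u: "u \<in> X"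
  shows "f u \<in> cone z x \<longleftrightarrow> u \<in> cone z x"
proof -
  have fX: "f u \<in> X" "f x \<in> X" using f(1) x u Aut_closed by auto
  have fx: "\<not> f x \<curlywedge> x \<preceq> z" "\<not> x \<curlywedge> f x \<preceq> z"
    using f(3) meet_commute[of x "f x"] x fX by (auto simp: cone_def)
  have "u \<in> cone z x \<longleftrightarrow> \<not> f u \<curlywedge> f x \<preceq> z"
    using Aut_le[OF f(1) meet_closed[OF u x(1)] x(2)] Aut_meet[OF f(1) u x(1)] f(2) u
    by (simp add: cone_def)
  also have "\<dots> \<longleftrightarrow> \<not> f u \<curlywedge> x \<preceq> z"
    using not_meet_le_trans[OF fX x(1)] not_meet_le_trans[OF fX(1) x(1) fX(2)] fx by blast
  finally show ?thesis using fX by (simp add: cone_def)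
qed

text \<open>A point outside the cone is never above a point of the cone, and is below one only if it
  is below \<open>z\<close>. So \<open>f\<close> inside the cone and the identity outside fit
  together.\<close>

lemma cone_surgery:
  assumes f: "f \<in> G" "f z = z" "f x \<in> cone z x" and zx: "z \<preceq> x"
  shows "(\<lambda>u\<in>X. if u \<in> cone z x then f u else u) \<in> G" (is "?g \<in> G")
proof -
  let ?C = "cone z x"
  have X: "x \<in> X" "z \<in> X" using zx le_carrier by auto
  have CX: "?C \<subseteq> X" by (auto simp: cone_def)
  have inv: "f u \<in> ?C \<longleftrightarrow> u \<in> ?C" if "u \<in> X" for u
    by (rule cone_invariant[OF f X that])
  have C1: "\<not> u \<preceq> v" if "u \<in> ?C" "v \<in> X" "v \<notin> ?C" for u v
  proof
    assume "u \<preceq> v"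
    then have "u \<curlywedge> x \<preceq> v \<curlywedge> x" using that CX X meet_le1 meet_le2 le_trans by (blast intro: meet_greatest)
    then show False using that CX le_trans unfolding cone_def by blast
  qed
  have C2: "u \<preceq> v \<longleftrightarrow> u \<preceq> z" if u: "u \<in> X" "u \<notin> ?C" and v: "v \<in> ?C" for u v
  proof
    assume "u \<preceq> z" then show "u \<preceq> v" using cone_above[OF zx v] le_trans by blast
  next
    assume uv: "u \<preceq> v"
    have v': "v \<in> X" "\<not> v \<curlywedge> x \<preceq> z" and u': "u \<curlywedge> x \<preceq> z" using u v by (auto simp: cone_def)
    have "\<not> v \<curlywedge> x \<preceq> u"
    proof
      assume "v \<curlywedge> x \<preceq> u"
      then have "v \<curlywedge> x \<preceq> u \<curlywedge> x" using v' X meet_le2 by (blast intro: meet_greatest)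
      then show False using u' v' le_trans by blast
    qed
    then have "u \<preceq> v \<curlywedge> x" using le_linear[OF uv meet_le1[OF v'(1) X(1)]] by blast
    then have "u \<preceq> x" using meet_le2[OF v'(1) X(1)] le_trans by blast
    then show "u \<preceq> z" using u' meet_absorb1 by simp
  qed
  show ?thesis
  proof (rule AutI_inverse)
    let ?h = "\<lambda>u. if u \<in> ?C then iv f u else u"
    show "?g u \<in> X" if "u \<in> X" for u using that f(1) Aut_closed by auto
    show "?h u \<in> X \<and> ?g (?h u) = u" if "u \<in> X" for u
      using that f(1) Aut_closed[OF iv_closed[OF f(1)]] inv[of "iv f u"] by auto
    show "?g u \<preceq> ?g v \<longleftrightarrow> u \<preceq> v" if uv: "u \<in> X" "v \<in> X" for u v
    proof -
      consider "u \<in> ?C" "v \<in> ?C" | "u \<in> ?C" "v \<notin> ?C" | "u \<notin> ?C" "v \<in> ?C" | "u \<notin> ?C" "v \<notin> ?C" by blast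
      then show ?thesis
      proof cases
        case 2
        then have "\<not> f u \<preceq> v" "\<not> u \<preceq> v" using C1 inv uv by auto
        then show ?thesis using 2 uv by simp
      next
        case 3
        then have "u \<preceq> f v \<longleftrightarrow> u \<preceq> v" using C2 inv uv by simp
        then show ?thesis using 3 uv by simp
      qed (use uv Aut_le f(1) in auto)
    qed
  qed simp
qed

lemma pw_iterate_le:
  assumes f: "f \<in> G" and y: "y \<preceq> pw f l y"
  shows "y \<preceq> pw f (l * int n) y"
proof (induction n)
  case 0
  then show ?case using le_carrier(1)[OF y] le_refl by simp
next
  case (Suc n)
  have yX: "y \<in> X" using le_carrier y by blast
  have "pw f (l * int n) y \<preceq> pw f (l * int n) (pw f l y)"
    using Aut_le[OF pw_closed[OF f] yX pw_X[OF f yX]] y by blast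
  then have "pw f (l * int n) y \<preceq> pw f (l * int (Suc n)) y"
    using f yX by (simp flip: pw_add add: algebra_simps)
  then show ?case using Suc le_trans by blast
qed

text \<open>Iterating gives \<open>y \<preceq> pw f l y \<preceq> pw f (l * int m) y\<close>, and
  the last point is \<open>y\<close> again.\<close>

lemma pw_periodic_eq:
  assumes f: "f \<in> G" and y: "y \<preceq> pw f l y" and m: "pw f (int m) y = y" "m \<ge> 1"
  shows "pw f l y = y"
proof -
  have yX: "y \<in> X" using le_carrier y by blast
  have per: "pw f (int m * k) y = y" if "k \<ge> 0" for k
    using that
  proof (induction k rule: int_ge_induct)
    case (step k)
    have "pw f (int m * (k + 1)) y = pw f (int m) (pw f (int m * k) y)"
      using f yX by (simp flip: pw_add add: algebra_simps)
    then show ?case using step m by simp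
  qed (use yX in simp)
  have per': "pw f (int m * k) y = y" for k
  proof (cases "k \<ge> 0")
    case False
    then have "pw f (int m * (- k)) y = y" using per[of "- k"] by simp
    then show ?thesis using pw_cancel[OF f yX, of "int m * k"] by simp
  qed (use per in simp)
  have ly: "pw f l y \<in> X" using f yX by simp
  have "pw f l y \<preceq> pw f l (pw f l y)"
    using Aut_le[OF pw_closed[OF f] yX ly] y by blast
  then have "pw f l y \<preceq> pw f (l * int (m - 1)) (pw f l y)"
    using pw_iterate_le[OF f] by blast
  also have "pw f (l * int (m - 1)) (pw f l y) = pw f (int m * l) y"
    using f yX m(2) by (simp flip: pw_add add: algebra_simps of_nat_diff)
  finally show ?thesis using per' y le_antisym by metis
qed

text \<open>The orbit of \<open>x\<close> branches off from \<open>x\<close> at infinitely many levels.\<close>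

definition odometer :: "('a \<Rightarrow> 'a) \<Rightarrow> 'a \<Rightarrow> bool" where
  "odometer f x \<longleftrightarrow> (\<forall>m::nat. m \<ge> 1 \<longrightarrow>
     pw f (int m) (x \<curlywedge> pw f (int m) x) = x \<curlywedge> pw f (int m) x \<and>
     (\<exists>k::nat. k \<ge> 1 \<and> x \<curlywedge> pw f (int (m * k)) x \<noteq> x \<curlywedge> pw f (int m) x))"

text \<open>The cones of \<open>x\<close> above the branching point at level \<open>(card F)!\<close> form a cycle of more than
  \<open>card F\<close> disjoint cones, so one of them avoids \<open>F\<close>; changing \<open>f\<close> there closes the orbit of \<open>x\<close>.\<close>

lemma odometer_perturb:
  assumes f: "f \<in> G" and x: "x \<in> X" and F: "finite F" "F \<subseteq> X" and odo: "odometer f x"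
  shows "\<exists>f'\<in>G. (\<forall>u\<in>F. f' u = f u) \<and> (\<exists>d::nat. d \<ge> 1 \<and> pw f' (int d) x = x)"
proof -
  define m :: nat where "m = fact (card F)"
  have m: "m \<ge> 1" by (simp add: m_def)
  define z where "z = x \<curlywedge> pw f (int m) x"
  have pX [simp]: "pw f k x \<in> X" for k using f x by simp
  have zX [simp]: "z \<in> X" and zx: "z \<preceq> x" using x meet_closed meet_le1 by (auto simp: z_def)
  have pz [simp]: "pw f k z \<in> X" for k using f by simp
  have mz: "pw f (int m) z = z" using odo m unfolding odometer_def z_def by blast
  obtain k :: nat where k: "k \<ge> 1" "x \<curlywedge> pw f (int (m * k)) x \<noteq> z"
    using odo m unfolding odometer_def z_def by blast
  have mkz: "pw f (int (m * k)) z = z"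
  proof -
    have "z \<preceq> pw f (int (m * k)) z"
      using pw_iterate_le[OF f, of z "int m" k] mz le_refl by simp
    then show ?thesis using pw_periodic_eq[OF f _ mz m] by blast
  qed
  have shift_not_le: "\<not> pw f i x \<curlywedge> pw f j x \<preceq> pw f i z \<longleftrightarrow> \<not> x \<curlywedge> pw f (j - i) x \<preceq> z" for i j
    using pw_meet[OF f x x, of i j] Aut_le[OF pw_closed[OF f], of "x \<curlywedge> pw f (j - i) x" z i] x meet_closed
    by simp
  \<comment> \<open>The return times of \<open>x\<close> to its own cone above the fixed point
    \<open>z\<close>. The least one is the length of the cycle of cones.\<close>
  define D where "D = {d::nat. d \<ge> 1 \<and> pw f (int d) z = z \<and> \<not> x \<curlywedge> pw f (int d) x \<preceq> z}"
  have mkD: "m * k \<in> D"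
  proof -
    have "z \<preceq> pw f (int (m * k)) x"
      using Aut_le[OF pw_closed[OF f] zX x, of "int (m * k)"] zx mkz by simp
    then have "z \<preceq> x \<curlywedge> pw f (int (m * k)) x" using zx meet_greatest by blast
    then show ?thesis using k m mkz le_antisym unfolding D_def by auto
  qed
  define d where "d = (LEAST d. d \<in> D)"
  have dD: "d \<in> D" unfolding d_def using mkD by (rule LeastI)
  have dmin: "d' \<notin> D" if "d' < d" for d' using that not_less_Least unfolding d_def by blast
  have d: "d \<ge> 1" "pw f (int d) z = z" "\<not> x \<curlywedge> pw f (int d) x \<preceq> z" using dD by (auto simp: D_def)
  have xz: "\<not> x \<preceq> z"
    using d(3) meet_le1[OF x pX] le_trans by blast
  define C where "C i = cone (pw f i z) (pw f i x)" for i
  have C_iff: "u \<in> C i \<longleftrightarrow> u \<in> X \<and> \<not> u \<curlywedge> pw f i x \<preceq> pw f i z" for u i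
    by (simp add: C_def cone_def)
  have self: "pw f i x \<in> C i" for i
    using shift_not_le[of i i] x xz by (simp add: C_iff meet_idem)
  have zi_le: "pw f i z \<preceq> pw f i x" for i using Aut_le[OF pw_closed[OF f] zX x] zx by blast
  have dz: "pw f (int d) (pw f i z) = pw f i z" for i
    using d(2) f by (simp flip: pw_add add: add.commute) (simp add: pw_add)
  have dz': "pw f (- int d) (pw f i z) = pw f i z" for i
    using f by (metis add.inverse_inverse dz pw_cancel pz)
  have in_d: "pw f (i - int d) x \<in> C i" for i
  proof -
    have "\<not> pw f (i - int d) x \<curlywedge> pw f i x \<preceq> pw f (i - int d) z"
      using shift_not_le[of "i - int d" i] d(3) by simp
    moreover have "pw f (i - int d) z = pw f i z"
      using dz'[of i] f by (simp flip: pw_add)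
    ultimately show ?thesis by (simp add: C_iff)
  qed
  \<comment> \<open>A cycle length of at most \<open>card F\<close> would divide the factorial
    \<open>m\<close>. Then the \<open>m\<close>-th image of \<open>x\<close> would lie in the cone
    of \<open>x\<close>, but it separates from \<open>x\<close> at \<open>z\<close>.\<close>
  have "card F < d"
  proof (rule ccontr)
    assume "\<not> card F < d"
    then have "d dvd m" using d(1) by (simp add: m_def dvd_fact)
    then obtain q where q: "m = d * q" by blast
    let ?h = "pw f (int d)"
    have h: "?h \<in> G" "?h z = z" using f d(2) by auto
    have hx: "?h x \<in> cone z x"
      using d(3) meet_commute[OF x pX] by (simp add: cone_def)
    have "pw f (int (d * n)) x \<in> cone z x" for n
    proof (induction n)
      case 0
      then show ?case using self[of 0] x by (simp add: C_def)
    next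
      case (Suc n)
      then have "?h (pw f (int (d * n)) x) \<in> cone z x"
        using cone_invariant[OF h hx x zX] by simp
      then show ?case using f x by (simp flip: pw_add)
    qed
    then have "\<not> pw f (int m) x \<curlywedge> x \<preceq> z" using q by (auto simp: cone_def)
    then show False using meet_commute[OF x pX] le_refl[OF zX] z_def by metis
  qed
  \<comment> \<open>Overlapping cones have comparable base points, which are equal because they are
    periodic; then \<open>j - i\<close> would be a return time smaller than
    \<open>d\<close>.\<close>
  have disj: "C (int i) \<inter> C (int j) = {}" if ij: "i < j" "j < d" for i j :: nat
  proof (rule ccontr)
    assume "\<not> ?thesis"
    then obtain u where u: "u \<in> C (int i)" "u \<in> C (int j)" by blast
    have uX: "u \<in> X" using u by (simp add: C_iff)
    have above: "pw f (int i) z \<preceq> u" "pw f (int j) z \<preceq> u"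
      using u cone_above[OF zi_le] by (auto simp: C_def)
    have per: "pw f (int m) (pw f l z) = pw f l z" for l
      using mz f by (simp flip: pw_add add: add.commute) (simp add: pw_add)
    have step: "pw f (b - a) (pw f a z) = pw f b z" for a b
      using f by (simp flip: pw_add)
    have zij: "pw f (int i) z = pw f (int j) z"
      using le_linear[OF above] pw_periodic_eq[OF f _ per m] step by metis
    then have z1: "pw f (int j - int i) z = z"
      using f by (metis diff_self pw_0 pw_add pz uminus_add_conv_diff zX)
    have "\<not> pw f (int i) x \<curlywedge> u \<preceq> pw f (int i) z"
      using u(1) meet_commute[OF uX pX] by (simp add: C_iff)
    moreover have "\<not> u \<curlywedge> pw f (int j) x \<preceq> pw f (int i) z"
      using u(2) zij by (simp add: C_iff)
    ultimately have "\<not> pw f (int i) x \<curlywedge> pw f (int j) x \<preceq> pw f (int i) z"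
      using not_meet_le_trans pX uX by blast
    then have "j - i \<in> D"
      using shift_not_le z1 ij by (simp add: D_def of_nat_diff)
    then show False using dmin[of "j - i"] ij by simp
  qed
  have "\<exists>i<d. C (int i) \<inter> F = {}"
  proof (rule ccontr)
    assume "\<not> ?thesis"
    then have "\<forall>i\<in>{..<d}. \<exists>u. u \<in> C (int i) \<inter> F" by blast
    then obtain w where w: "\<And>i. i < d \<Longrightarrow> w i \<in> C (int i) \<inter> F" using bchoice[of "{..<d}"] by (metis lessThan_iff)
    have "inj_on w {..<d}"
    proof (rule linorder_inj_onI)
      fix i j assume "i < j" "i \<in> {..<d}" "j \<in> {..<d}"
      then show "w i \<noteq> w j" using disj[of i j] w[of i] w[of j] by auto
    qed auto
    then have "d \<le> card F" using card_inj_on_le[of w "{..<d}" F] w F by auto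
    then show False using \<open>card F < d\<close> by simp
  qed
  then obtain i where i: "i < d" "C (int i) \<inter> F = {}" by blast
  have C_Suc: "f u \<in> C (1 + l) \<longleftrightarrow> u \<in> C l" if u: "u \<in> X" for u l
  proof -
    have "f u \<curlywedge> pw f (1 + l) x = f (u \<curlywedge> pw f l x)" "pw f (1 + l) z = f (pw f l z)"
      using f u x by (simp_all add: pw_Suc Aut_meet)
    then show ?thesis
      using Aut_le[OF f meet_closed[OF u pX] pz] Aut_closed[OF f u] u by (simp add: C_iff)
  qed
  let ?z = "pw f (1 + int i) z" and ?x = "pw f (1 + int i) x" and ?h = "pw f (- int d)"
  \<comment> \<open>\<open>\<pi>\<close> undoes one full cycle on the cone that follows
    \<open>C (int i)\<close>. Composing it with \<open>f\<close> changes \<open>f\<close> only on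
    \<open>C (int i)\<close>, which avoids \<open>F\<close>.\<close>
  define \<pi> where "\<pi> = (\<lambda>u\<in>X. if u \<in> cone ?z ?x then ?h u else u)"
  have "?h ?x \<in> cone ?z ?x"
    using in_d[of "1 + int i"] f x by (simp flip: pw_add add: C_def algebra_simps)
  then have \<pi>: "\<pi> \<in> G"
    unfolding \<pi>_def using cone_surgery[OF pw_closed[OF f] dz'[of "1 + int i"] _ zi_le] by simp
  define f' where "f' = \<pi> \<bullet> f"
  have f': "f' \<in> G" using \<pi> f by (simp add: f'_def)
  have f'_app: "f' u = (if u \<in> C (int i) then ?h (f u) else f u)" if "u \<in> X" for u
    using C_Suc[of u "int i"] that f \<pi> Aut_closed[OF f that] by (simp add: f'_def \<pi>_def C_def)
  have "f' u = f u" if "u \<in> F" for u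
  proof -
    have "u \<in> X" "u \<notin> C (int i)" using that F i(2) by auto
    then show ?thesis using f'_app by simp
  qed
  \<comment> \<open>Up to index \<open>i\<close> the orbit is that of \<open>f\<close>; entering the
    next cone subtracts \<open>d\<close> from the exponent once. At \<open>n = d\<close> the
    exponent is 0.\<close>
  moreover have "pw f' (int n) x = (if n \<le> i then pw f (int n) x else pw f (int n - int d) x)"
    if "n \<le> d" for n
    using that
  proof (induction n)
    case 0
    then show ?case using x by simp
  next
    case (Suc n)
    define y where "y = pw f' (int n) x"
    have y: "y = (if n \<le> i then pw f (int n) x else pw f (int n - int d) x)"
      using Suc by (simp add: y_def)
    have yX: "y \<in> X" and yC: "y \<in> C (int n)" using in_d self by (auto simp: y)
    have "pw f' (int (Suc n)) x = f' y" using pw_Suc[OF f' x, of "int n"] by (simp add: y_def)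
    also have "\<dots> = (if n = i then ?h (f y) else f y)"
    proof (cases "n = i")
      case True
      then show ?thesis using f'_app[OF yX] yC by simp
    next
      case False
      then have "C (int n) \<inter> C (int i) = {}"
        using disj[of n i] disj[of i n] i(1) Suc.prems by (cases "n < i") auto
      then have "y \<notin> C (int i)" using yC by blast
      then show ?thesis using f'_app[OF yX] False by simp
    qed
    also have "\<dots> = (if Suc n \<le> i then pw f (int (Suc n)) x else pw f (int (Suc n) - int d) x)"
      using f x pw_Suc[OF f x, of "int n"] pw_Suc[OF f x, of "int n - int d"]
        pw_add[OF f x, of "- int d" "1 + int n"]
      by (auto simp: y algebra_simps)
    finally show ?case .
  qed
  from this[of d] have "pw f' (int d) x = x" using i(1) x by simp
  ultimately show ?thesis using f' d(1) by blast
qed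

end

section \<open>Countability of tame types\<close>

text \<open>In each residue class modulo \<open>m\<close> the set is empty, everything or an upward
  ray. So it is given by \<open>m\<close>, the set \<open>R\<close> of full classes and the finite
  set \<open>J\<close> of first points of rays.\<close>

lemma countable_periodic_up: "countable {K :: int set. \<exists>m\<ge>1. \<forall>k\<in>K. k + m \<in> K}" (is "countable ?U")
proof -
  define dec where "dec = (\<lambda>(m::int, R, J). {k. k mod m \<in> R} \<union> {k. \<exists>j\<in>J. j \<le> k \<and> (k - j) mod m = 0})"
  have "?U \<subseteq> dec ` (UNIV \<times> Collect finite \<times> Collect finite)"
  proof
    fix K assume "K \<in> ?U"
    then obtain m where m: "m \<ge> 1" and K: "\<And>k. k \<in> K \<Longrightarrow> k + m \<in> K" by blast
    define R where "R = {r \<in> {0..<m}. \<forall>k. k mod m = r \<longrightarrow> k \<in> K}"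
    have "finite R" by (rule finite_subset[of _ "{0..<m}"]) (auto simp: R_def)
    define J where "J = {j \<in> K. j - m \<notin> K}"
    have K_add: "k + m * int n \<in> K" if "k \<in> K" for k n
    proof (induction n)
      case (Suc n)
      then show ?case using K[of "k + m * int n"] by (simp add: algebra_simps)
    qed (use that in simp)
    have K_ge: "l \<in> K" if k: "k \<in> K" and kl: "k \<le> l" "(l - k) mod m = 0" for k l
    proof -
      obtain q where q: "l - k = m * q" using kl(2) by (metis dvd_def mod_0_imp_dvd)
      then have "0 \<le> m * q" using kl(1) by simp
      then have "q \<ge> 0" using m by (simp add: zero_le_mult_iff)
      then show ?thesis using K_add[OF k, of "nat q"] q by (simp add: algebra_simps)
    qed
    have "inj_on (\<lambda>j. j mod m) J"
    proof (rule linorder_inj_onI)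
      fix i j assume ij: "i < j" "i \<in> J" "j \<in> J"
      show "i mod m \<noteq> j mod m"
      proof
        assume eq: "i mod m = j mod m"
        then have dvd: "m dvd j - i" by (metis mod_eq_dvd_iff)
        then have "j - i \<ge> m" using ij(1) zdvd_imp_le by simp
        moreover have "(j - m - i) mod m = 0"
        proof -
          have "j - m - i = (j - i) - m" by simp
          then show ?thesis using dvd_diff[OF dvd dvd_refl] dvd_imp_mod_0 by metis
        qed
        ultimately have "j - m \<in> K" using K_ge[of i "j - m"] ij(2) by (auto simp: J_def)
        then show False using ij(3) by (simp add: J_def)
      qed
    qed auto
    moreover have "finite ((\<lambda>j. j mod m) ` J)"
      by (rule finite_subset[of _ "{0..<m}"]) (use m in auto)
    ultimately have "finite J" using finite_imageD by blast
    have "K = dec (m, R, J)"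
    proof (intro equalityI subsetI)
      fix k assume k: "k \<in> K"
      show "k \<in> dec (m, R, J)"
      proof (cases "\<forall>n::nat. k - m * int n \<in> K")
        case True
        have "l \<in> K" if l: "l mod m = k mod m" for l
        proof -
          obtain q where q: "l - k = m * q" using l by (metis dvd_def mod_eq_dvd_iff)
          show ?thesis
          proof (cases "q \<ge> 0")
            case True
            then show ?thesis using K_add[OF k, of "nat q"] q by (simp add: algebra_simps)
          next
            case False
            then show ?thesis using spec[OF \<open>\<forall>n. _ n\<close>, of "nat (- q)"] q by (simp add: algebra_simps)
          qed
        qed
        then show ?thesis using m by (simp add: dec_def R_def)
      next
        case False
        define n where "n = (LEAST n. k - m * int n \<notin> K)"
        have n: "k - m * int n \<notin> K" unfolding n_def using False by (metis (mono_tags, lifting) LeastI_ex)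
        then obtain n' where n': "n = Suc n'" using k by (cases n) auto
        have "k - m * int n' \<in> K" using not_less_Least[of n' "\<lambda>n. k - m * int n \<notin> K"] n' n_def by auto
        then have "k - m * int n' \<in> J" using n n' by (simp add: J_def algebra_simps)
        moreover have "k - m * int n' \<le> k" using m by simp
        ultimately show ?thesis by (auto simp: dec_def intro!: bexI[of _ "k - m * int n'"])
      qed
    next
      fix k assume "k \<in> dec (m, R, J)"
      then show "k \<in> K" using K_ge by (auto simp: dec_def R_def J_def)
    qed
    then show "K \<in> dec ` (UNIV \<times> Collect finite \<times> Collect finite)"
      using \<open>finite J\<close> \<open>finite R\<close> by (intro image_eqI[of _ _ "(m, R, J)"]) auto
  qed
  moreover have "countable (UNIV \<times> Collect finite \<times> Collect finite :: (int \<times> int set \<times> int set) set)"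
    by (intro countable_SIGMA countable_Collect_finite) auto
  ultimately show ?thesis by (meson countable_image countable_subset)
qed

definition tame_sets :: "int set set" where
  "tame_sets = {K. finite K} \<union> {K. \<exists>m\<ge>1. \<forall>k\<in>K. k + m \<in> K} \<union> {K. \<exists>m\<ge>1. \<forall>k\<in>K. k - m \<in> K}"

lemma countable_tame_sets: "countable tame_sets"
proof -
  have "{K :: int set. \<exists>m\<ge>1. \<forall>k\<in>K. k - m \<in> K} \<subseteq> (`) uminus ` {K :: int set. \<exists>m\<ge>1. \<forall>k\<in>K. k + m \<in> K}"
  proof
    fix K :: "int set" assume "K \<in> {K. \<exists>m\<ge>1. \<forall>k\<in>K. k - m \<in> K}"
    then obtain m where "m \<ge> 1" "\<forall>k\<in>K. k - m \<in> K" by blast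
    then have "uminus ` K \<in> {K. \<exists>m\<ge>1. \<forall>k\<in>K. k + m \<in> K}"
      by (auto intro!: exI[of _ m] image_eqI[of _ uminus "_ - m"])
    moreover have "K = uminus ` uminus ` K" by (simp add: image_image)
    ultimately show "K \<in> (`) uminus ` {K. \<exists>m\<ge>1. \<forall>k\<in>K. k + m \<in> K}" by blast
  qed
  then show ?thesis
    unfolding tame_sets_def
    by (intro countable_Un countable_Collect_finite countable_periodic_up)
      (rule countable_subset[OF _ countable_image[OF countable_periodic_up]])
qed

context meet_tree_struct
begin

section \<open>Orbits, and codes for types with finitely many orbits\<close>

definition orb :: "('a \<Rightarrow> 'a) \<Rightarrow> 'a set \<Rightarrow> 'a set" where
  "orb f B = {pw f k b | k b. b \<in> B}"

lemma orbI: "b \<in> B \<Longrightarrow> pw f k b \<in> orb f B"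
  by (auto simp: orb_def)

lemma orb_mono: "B \<subseteq> B' \<Longrightarrow> orb f B \<subseteq> orb f B'"
  by (auto simp: orb_def)

lemma orb_X: "f \<in> G \<Longrightarrow> B \<subseteq> X \<Longrightarrow> orb f B \<subseteq> X"
  by (auto simp: orb_def)

lemma subset_orb: "f \<in> G \<Longrightarrow> B \<subseteq> X \<Longrightarrow> B \<subseteq> orb f B"
  using orbI[of _ B f 0] by fastforce

lemma pw_orb: "f \<in> G \<Longrightarrow> B \<subseteq> X \<Longrightarrow> u \<in> orb f B \<Longrightarrow> pw f k u \<in> orb f B"
  unfolding orb_def using pw_add[of f _ k] by (smt (verit, best) mem_Collect_eq subsetD)

text \<open>Two exponents \<open>k < l\<close> in the set put two points of the orbit of
  \<open>b\<close> below \<open>b'\<close>. These are comparable, so \<open>b\<close> lies below its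
  image under the power \<open>l - k\<close> or \<open>k - l\<close>, and the set is closed under
  that translation.\<close>

lemma tame_set_le:
  assumes f: "f \<in> G" and b: "b \<in> X" "b' \<in> X"
  shows "{k. b \<preceq> pw f k b'} \<in> tame_sets" (is "?K \<in> _")
proof (cases "\<exists>k l. k < l \<and> k \<in> ?K \<and> l \<in> ?K")
  case False
  then have "\<forall>k\<in>?K. \<forall>l\<in>?K. k = l" by (metis linorder_neqE_linordered_idom)
  then have "finite ?K" by (metis finite.emptyI finite.insertI finite_subset insertI1 subsetI)
  then show ?thesis by (simp add: tame_sets_def)
next
  case True
  then obtain k l where kl: "k < l" "b \<preceq> pw f k b'" "b \<preceq> pw f l b'" by blast
  have "pw f (- k) b \<preceq> b'" "pw f (- l) b \<preceq> b'"
    using kl pw_le[OF f b, of "- k" 0] pw_le[OF f b, of "- l" 0] b by auto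
  then have "b \<preceq> pw f (l - k) b \<or> b \<preceq> pw f (- (l - k)) b"
    using le_linear[of "pw f (- k) b" b' "pw f (- l) b"] pw_le[OF f b(1) b(1)] by force
  moreover have "b \<preceq> pw f (j + p) b'" if "b \<preceq> pw f j b'" "b \<preceq> pw f p b" for j p
    using pw_le[OF f b, of p "j + p"] that le_trans[of b "pw f p b" "pw f (j + p) b'"] by simp
  ultimately have "(\<forall>j\<in>?K. j + (l - k) \<in> ?K) \<or> (\<forall>j\<in>?K. j - (l - k) \<in> ?K)"
    by (metis mem_Collect_eq diff_conv_add_uminus)
  moreover have "l - k \<ge> 1" using kl(1) by simp
  ultimately show ?thesis unfolding tame_sets_def by blast
qed

text \<open>The subtree generated by \<open>A\<close> is covered by finitely many orbits that
  themselves form a subtree.\<close>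

definition tame_via :: "('a \<Rightarrow> 'a) \<Rightarrow> 'a set \<Rightarrow> 'a set \<Rightarrow> bool" where
  "tame_via f A B \<longleftrightarrow> f \<in> G \<and> finite B \<and> A \<subseteq> B \<and> B \<subseteq> X \<and>
     (\<forall>u\<in>orb f B. \<forall>v\<in>orb f B. u \<curlywedge> v \<in> orb f B)"

definition leq_times :: "('a \<Rightarrow> 'a) \<Rightarrow> 'a set \<Rightarrow> 'a \<times> 'a \<Rightarrow> int set" where
  "leq_times f B = (\<lambda>(b, b')\<in>B \<times> B. {k. b \<preceq> pw f k b'})"

lemma tp_cong_ev:
  assumes "\<And>s t. s \<in> terms A \<Longrightarrow> t \<in> terms A \<Longrightarrow> ev f s \<preceq> ev f t \<longleftrightarrow> ev g s \<preceq> ev g t"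
  shows "tp f A = tp g A"
  using assms unfolding tp_def by blast

text \<open>By \<open>pw_le\<close> the sets of integers determine the order on the orbits of
  \<open>B\<close>, and this order determines the meets. So equal powers correspond, and with them
  the values of every term.\<close>

lemma tp_determined:
  assumes f: "tame_via f A B" and g: "tame_via g A B" and eq: "leq_times f B = leq_times g B"
  shows "tp f A = tp g A"
proof -
  have fG: "f \<in> G" and gG: "g \<in> G" and AB: "A \<subseteq> B" and BX: "B \<subseteq> X"
    using f g by (auto simp: tame_via_def)
  have leq_eq: "b \<preceq> pw f k b' \<longleftrightarrow> b \<preceq> pw g k b'" if "b \<in> B" "b' \<in> B" for b b' k
    using fun_cong[OF eq, of "(b, b')"] that by (auto simp: leq_times_def)
  define H where "H = {(pw f k b, pw g k b) | k b. b \<in> B}"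
  have HX: "u \<in> X" "v \<in> X" if "(u, v) \<in> H" for u v
    using that fG gG BX by (auto simp: H_def)
  have H_le: "u \<preceq> u' \<longleftrightarrow> v \<preceq> v'" if "(u, v) \<in> H" "(u', v') \<in> H" for u v u' v'
    using that BX fG gG leq_eq by (auto simp: H_def pw_le subset_iff)
  have H_pw: "(pw f k u, pw g k v) \<in> H" if "(u, v) \<in> H" for u v k
  proof -
    obtain l b where lb: "u = pw f l b" "v = pw g l b" "b \<in> B" using \<open>(u, v) \<in> H\<close> by (auto simp: H_def)
    then have "pw f k u = pw f (k + l) b" "pw g k v = pw g (k + l) b"
      using BX fG gG by (auto simp: pw_add)
    then show ?thesis using lb by (auto simp: H_def)
  qed
  have H_meet: "(u \<curlywedge> u', v \<curlywedge> v') \<in> H" if uv: "(u, v) \<in> H" "(u', v') \<in> H" for u v u' v'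
  proof -
    have "u \<in> orb f B" "u' \<in> orb f B" "v \<in> orb g B" "v' \<in> orb g B"
      using uv by (auto simp: H_def orb_def)
    then have "u \<curlywedge> u' \<in> orb f B" "v \<curlywedge> v' \<in> orb g B" using f g by (auto simp: tame_via_def)
    \<comment> \<open>\<open>w\<close> is the partner of the meet on the \<open>f\<close> side and
      \<open>w'\<close> that of the meet on the \<open>g\<close> side; since both meets are greatest
      lower bounds, \<open>w\<close> equals \<open>v \<curlywedge> v'\<close>.\<close>
    then obtain w w' where w: "(u \<curlywedge> u', w) \<in> H" and w': "(w', v \<curlywedge> v') \<in> H"
      by (auto simp: H_def orb_def)
    have "w \<preceq> v" "w \<preceq> v'"
      using H_le[OF w uv(1)] H_le[OF w uv(2)] uv HX meet_le1 meet_le2 by auto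
    then have "w \<preceq> v \<curlywedge> v'" by (rule meet_greatest)
    moreover have "w' \<preceq> u" "w' \<preceq> u'"
      using H_le[OF w' uv(1)] H_le[OF w' uv(2)] uv HX meet_le1 meet_le2 by auto
    then have "w' \<preceq> u \<curlywedge> u'" by (rule meet_greatest)
    then have "v \<curlywedge> v' \<preceq> w" using H_le[OF w' w] by simp
    ultimately show ?thesis using w le_antisym by auto
  qed
  have "(ev f t, ev g t) \<in> H" if "t \<in> terms A" for t
    using that
  proof (induction t)
    case (Gen a)
    then have "a \<in> B" using AB by auto
    then have "(pw f 0 a, pw g 0 a) \<in> H" "a \<in> X" using BX unfolding H_def by blast+
    then show ?case by simp
  next
    case (Shift t)
    then show ?case using H_pw[of "ev f t" "ev g t" 1] HX fG gG by auto
  next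
    case (Unshift t)
    then show ?case using H_pw[of "ev f t" "ev g t" "-1"] HX by (auto simp: pw_minus1 fG gG)
  next
    case (Meet s t)
    then show ?case using H_meet by auto
  qed
  then show ?thesis using H_le by (intro tp_cong_ev) blast
qed

text \<open>A type is coded by \<open>B\<close> and its sets of integers. Decoding may choose any
  automorphism with this code, as all of them give \<open>A\<close> the same type.\<close>

lemma countable_tame_tps:
  assumes "countable X"
  shows "countable {tp f A | f B. tame_via f A B}"
proof -
  define codes where "codes = (SIGMA B:{B. finite B \<and> B \<subseteq> X}. PiE (B \<times> B) (\<lambda>_. tame_sets))"
  have "countable codes"
    unfolding codes_def using assms countable_tame_sets
    by (intro countable_SIGMA countable_Collect_finite_subset countable_PiE) auto
  define dec where "dec = (\<lambda>(B, L). tp (SOME f. tame_via f A B \<and> leq_times f B = L) A)"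
  have "{tp f A | f B. tame_via f A B} \<subseteq> dec ` codes"
  proof clarify
    fix f B assume f: "tame_via f A B"
    then have fB: "f \<in> G" "finite B" "B \<subseteq> X" by (auto simp: tame_via_def)
    have "leq_times f B \<in> PiE (B \<times> B) (\<lambda>_. tame_sets)"
      unfolding leq_times_def using tame_set_le[OF fB(1)] fB(3) by auto
    then have "(B, leq_times f B) \<in> codes" using fB by (simp add: codes_def)
    define g where "g = (SOME g. tame_via g A B \<and> leq_times g B = leq_times f B)"
    have "tame_via g A B \<and> leq_times g B = leq_times f B"
      unfolding g_def by (rule someI[of _ f]) (use f in simp)
    then have "tp f A = tp g A" by (intro tp_determined[OF f]) auto
    also have "\<dots> = dec (B, leq_times f B)" by (simp add: dec_def g_def)
    finally have "tp f A = dec (B, leq_times f B)" .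
    then show "tp f A \<in> dec ` codes" using \<open>(B, leq_times f B) \<in> codes\<close> by blast
  qed
  then show ?thesis using \<open>countable codes\<close> by (meson countable_image countable_subset)
qed

text \<open>Of the three pairwise meets of \<open>a\<close>, \<open>y\<close>, \<open>y'\<close>, two coincide and are the least. So every
  \<open>a \<curlywedge> y\<close> that is not the greatest one is a meet of two elements of \<open>Y\<close>.\<close>

lemma meet_eq_or_orbit:
  assumes "a \<in> X" "Y \<subseteq> X" "\<And>y y'. y \<in> Y \<Longrightarrow> y' \<in> Y \<Longrightarrow> y \<curlywedge> y' \<in> M"
  shows "\<exists>c\<in>X. \<forall>y\<in>Y. a \<curlywedge> y = c \<or> a \<curlywedge> y \<in> M"
proof -
  have *: "a \<curlywedge> y \<in> M" if "y \<in> Y" "y' \<in> Y" "\<not> a \<curlywedge> y' \<preceq> a \<curlywedge> y" for y y'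
  proof -
    have "a \<curlywedge> y = y' \<curlywedge> y" using that assms(1,2) by (intro meet_eq_meet_if_less) auto
    then show ?thesis using assms(3) that by simp
  qed
  show ?thesis
  proof (cases "\<exists>y0\<in>Y. \<forall>y\<in>Y. a \<curlywedge> y \<preceq> a \<curlywedge> y0")
    case True
    then obtain y0 where y0: "y0 \<in> Y" "\<And>y. y \<in> Y \<Longrightarrow> a \<curlywedge> y \<preceq> a \<curlywedge> y0" by blast
    have "a \<curlywedge> y = a \<curlywedge> y0 \<or> a \<curlywedge> y \<in> M" if "y \<in> Y" for y
      using *[OF that y0(1)] y0(2)[OF that] le_antisym by blast
    then show ?thesis using assms(1,2) y0(1) meet_closed by blast
  next
    case False
    then show ?thesis using * assms(1) by blast
  qed
qed

text \<open>\<open>z = x \<curlywedge> h x\<close> and \<open>h z\<close> both lie below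
  \<open>h x\<close>, so they are comparable and distinct. If \<open>h z\<close> is higher, all
  later images leave \<open>x\<close> at \<open>z\<close>; if it is lower, the branching points
  descend along the orbit of \<open>z\<close>.\<close>

lemma meet_pw_orbit_nat:
  fixes n :: nat
  assumes h: "h \<in> G" and x: "x \<in> X" and hz: "h (x \<curlywedge> h x) \<noteq> x \<curlywedge> h x"
  shows "x \<curlywedge> pw h (1 + int n) x \<in> orb h {x \<curlywedge> h x}"
proof -
  define z where "z = x \<curlywedge> h x"
  have hx: "h x \<in> X" and z: "z \<in> X" using h x Aut_closed meet_closed by (auto simp: z_def)
  have px: "pw h k x \<in> X" for k using h x by simp
  have "h z \<preceq> h x" using Aut_le[OF h z x] meet_le1[OF x hx] by (simp add: z_def)
  then consider "\<not> h z \<preceq> z" | "h z \<preceq> z" "\<not> z \<preceq> h z"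
    using hz le_antisym by (auto simp: z_def)
  then show ?thesis
  proof cases
    case 1
    have "x \<curlywedge> pw h (1 + int n) x = z"
    proof (induction n)
      case 0
      then show ?case using h x by (simp add: z_def)
    next
      case (Suc n)
      let ?y = "pw h (1 + int (Suc n)) x"
      have "h x \<curlywedge> ?y = h (x \<curlywedge> pw h (1 + int n) x)"
        using pw_Suc[OF h x, of "1 + int n"] Aut_meet[OF h x px] by simp
      then have "h x \<curlywedge> ?y = h z" using Suc by simp
      moreover have "h x \<curlywedge> x = z" using meet_commute[OF x hx] by (simp add: z_def)
      ultimately have "h x \<curlywedge> x = ?y \<curlywedge> x"
        using 1 by (intro meet_eq_meet_if_less hx px x) simp
      then show ?case using \<open>h x \<curlywedge> x = z\<close> meet_commute[OF x px] by simp
    qed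
    then show ?thesis using orbI[of z "{z}" h 0] z by (simp add: z_def)
  next
    case 2
    have "x \<curlywedge> pw h (1 + int n) x = pw h (int n) z \<and> pw h (int n) z \<preceq> z"
    proof (induction n)
      case 0
      then show ?case using h x z le_refl by (simp add: z_def)
    next
      case (Suc n)
      let ?y = "pw h (1 + int (Suc n)) x"
      have "h x \<curlywedge> ?y = h (x \<curlywedge> pw h (1 + int n) x)"
        using pw_Suc[OF h x, of "1 + int n"] Aut_meet[OF h x px] by simp
      then have y: "h x \<curlywedge> ?y = pw h (int (Suc n)) z"
        using Suc pw_Suc[OF h z, of "int n"] by simp
      have "pw h (int (Suc n)) z \<preceq> h z"
        using Suc Aut_le[OF h pw_X[OF h z] z, of "int n"] pw_Suc[OF h z, of "int n"] by simp
      then have le: "pw h (int (Suc n)) z \<preceq> z" "\<not> z \<preceq> pw h (int (Suc n)) z"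
        using 2 le_trans by blast+
      have "h x \<curlywedge> x = z" using meet_commute[OF x hx] by (simp add: z_def)
      then have "h x \<curlywedge> ?y = x \<curlywedge> ?y"
        using le y by (intro meet_eq_meet_if_less hx px x) simp
      then show ?case using y le by simp
    qed
    then show ?thesis using orbI[of z "{z}" h "int n"] by (simp add: z_def)
  qed
qed

text \<open>For negative \<open>q\<close> the meet is the \<open>q\<close>-th image of
  \<open>x \<curlywedge> pw h (- q) x\<close>. The exponent 0 contributes \<open>x\<close>
  itself.\<close>

lemma meet_pw_orbit_int:
  assumes h: "h \<in> G" and x: "x \<in> X" and B: "B \<subseteq> X"
    and nat: "\<And>n::nat. x \<curlywedge> pw h (1 + int n) x \<in> orb h B"
  shows "x \<curlywedge> pw h q x \<in> orb h (insert x B)"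
proof -
  have B': "insert x B \<subseteq> X" using x B by simp
  have pos: "x \<curlywedge> pw h q x \<in> orb h (insert x B)" if "q > 0" for q
  proof -
    have "q = 1 + int (nat (q - 1))" using that by simp
    then show ?thesis using nat[of "nat (q - 1)"] orb_mono[of B "insert x B" h] by auto
  qed
  consider "q > 0" | "q = 0" | "q < 0" by linarith
  then show ?thesis
  proof cases
    case 2
    then show ?thesis using subset_orb[OF h B'] x by (auto simp: meet_idem)
  next
    case 3
    have "x \<curlywedge> pw h q x = pw h q x \<curlywedge> pw h 0 x"
      using meet_commute[OF x pw_X[OF h x]] x by simp
    also have "\<dots> = pw h q (x \<curlywedge> pw h (- q) x)"
      using pw_meet[OF h x x, of q 0] by simp
    finally show ?thesis using pw_orb[OF h B' pos[of "- q"]] 3 by simp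
  qed (rule pos)
qed

lemma orb_pw: "f \<in> G \<Longrightarrow> B \<subseteq> X \<Longrightarrow> orb (pw f m) B \<subseteq> orb f B"
  by (auto simp: orb_def pw_mult[symmetric])

lemma pairwise_meets_orbit:
  assumes h: "h \<in> G" and x: "x \<in> X" and B: "B \<subseteq> X"
    and "\<And>q. x \<curlywedge> pw h q x \<in> orb h B" "y \<in> orb h {x}" "y' \<in> orb h {x}"
  shows "y \<curlywedge> y' \<in> orb h B"
  using assms(5,6) pw_orb[OF h B assms(4)] by (auto simp: orb_def[of h "{x}"] pw_meet[OF h x x])

text \<open>At a level \<open>m\<close> where the odometer condition fails, the meets of
  \<open>x\<close> with its images under \<open>h = pw f (int m)\<close> fall into the orbits of
  \<open>x\<close> and \<open>z\<close>. Each residue class of exponents modulo \<open>m\<close>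
  then adds only one point, by \<open>meet_eq_or_orbit\<close>.\<close>

lemma finitely_many_meet_orbits:
  assumes f: "f \<in> G" and x: "x \<in> X" and odo: "\<not> odometer f x"
  shows "\<exists>B. finite B \<and> B \<subseteq> X \<and> (\<forall>k. x \<curlywedge> pw f k x \<in> orb f B)"
proof -
  obtain m :: nat where m: "m \<ge> 1"
    and not_odo: "pw f (int m) (x \<curlywedge> pw f (int m) x) \<noteq> x \<curlywedge> pw f (int m) x \<or>
      (\<forall>k::nat. k \<ge> 1 \<longrightarrow> x \<curlywedge> pw f (int (m * k)) x = x \<curlywedge> pw f (int m) x)"
    using odo unfolding odometer_def by blast
  define h where "h = pw f (int m)"
  define z where "z = x \<curlywedge> h x"
  have h: "h \<in> G" using f by (simp add: h_def)
  have z: "z \<in> X" using x Aut_closed[OF h x] meet_closed by (simp add: z_def)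
  have hpw: "pw h q = pw f (int m * q)" for q using f by (simp add: h_def pw_mult)
  have "x \<curlywedge> pw h (1 + int n) x \<in> orb h {z}" for n :: nat
  proof (cases "h z = z")
    case True
    then have "x \<curlywedge> pw f (int (m * Suc n)) x = z"
    proof -
      have "\<forall>k::nat. k \<ge> 1 \<longrightarrow> x \<curlywedge> pw f (int (m * k)) x = z"
        using not_odo True unfolding z_def h_def by blast
      moreover have "Suc n \<ge> 1" by simp
      ultimately show ?thesis by blast
    qed
    then have "x \<curlywedge> pw h (1 + int n) x = z" by (simp add: hpw algebra_simps)
    then show ?thesis using subset_orb[OF h, of "{z}"] z by auto
  next
    case False
    then show ?thesis using meet_pw_orbit_nat[OF h x] by (simp add: z_def)
  qed
  then have hB: "x \<curlywedge> pw h q x \<in> orb h {x, z}" for q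
    using meet_pw_orbit_int[OF h x, of "{z}"] z by simp
  define M where "M = orb h {x, z}"
  have Y: "orb h {x} \<subseteq> X" using orb_X[OF h] x by simp
  have Mf: "M \<subseteq> orb f {x, z}" unfolding M_def h_def using orb_pw[OF f] x z by simp
  have "\<exists>c\<in>X. \<forall>y\<in>orb h {x}. a \<curlywedge> y = c \<or> a \<curlywedge> y \<in> M" if "a \<in> X" for a
    using pairwise_meets_orbit[OF h x _ hB] x z unfolding M_def
    by (intro meet_eq_or_orbit[OF that Y]) auto
  then have "\<forall>a\<in>X. \<exists>c. c \<in> X \<and> (\<forall>y\<in>orb h {x}. a \<curlywedge> y = c \<or> a \<curlywedge> y \<in> M)" by blast
  from bchoice[OF this]
  obtain c where c': "\<forall>a\<in>X. c a \<in> X \<and> (\<forall>y\<in>orb h {x}. a \<curlywedge> y = c a \<or> a \<curlywedge> y \<in> M)" ..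
  have c: "c a \<in> X" "y \<in> orb h {x} \<Longrightarrow> a \<curlywedge> y = c a \<or> a \<curlywedge> y \<in> M" if "a \<in> X" for a y
    using bspec[OF c' that] by auto
  \<comment> \<open>The points \<open>pw f (- r) x\<close> arise because
    \<open>x \<curlywedge> pw f (r + int m * q) x\<close> is the \<open>r\<close>-th image of
    \<open>pw f (- r) x \<curlywedge> pw h q x\<close>.\<close>
  define B where "B = {x, z} \<union> (\<lambda>r. c (pw f (- r) x)) ` {0..<int m}"
  have B: "finite B" "B \<subseteq> X"
    unfolding B_def using x z c(1)[OF pw_X[OF f x]] by (simp, blast)
  have "x \<curlywedge> pw f k x \<in> orb f B" for k
  proof -
    define r where "r = k mod int m"
    define q where "q = k div int m"
    have k: "k = r + int m * q" by (simp add: r_def q_def)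
    have r: "r \<in> {0..<int m}" using m by (simp add: r_def)
    let ?a = "pw f (- r) x"
    have a: "?a \<in> X" using f x by simp
    have "?a \<curlywedge> pw h q x = c ?a \<or> ?a \<curlywedge> pw h q x \<in> M"
      using c(2)[OF a] by (simp add: orbI)
    moreover have "c ?a \<in> orb f B" using subset_orb[OF f B(2)] r by (auto simp: B_def)
    moreover have "M \<subseteq> orb f B" using Mf orb_mono[of "{x, z}" B f] by (auto simp: B_def)
    ultimately have "?a \<curlywedge> pw h q x \<in> orb f B" by auto
    then have "pw f r (?a \<curlywedge> pw h q x) \<in> orb f B" by (rule pw_orb[OF f B(2)])
    moreover have "pw f r (?a \<curlywedge> pw h q x) = x \<curlywedge> pw f k x"
      using Aut_meet[OF pw_closed[OF f] a pw_X[OF h x], of r q] f x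
      by (simp add: hpw k pw_add)
    ultimately show ?thesis by simp
  qed
  then show ?thesis using B by blast
qed

text \<open>Meets of one point of \<open>A\<close> with the orbit of another lie in the orbits of
  meets inside that orbit, up to one extra point. Finitely many orbits thus contain all meets of
  images of \<open>A\<close>, and one round of meets suffices.\<close>

lemma tame_if_not_odometer:
  assumes f: "f \<in> G" and A: "finite A" "A \<subseteq> X" and odo: "\<And>a. a \<in> A \<Longrightarrow> \<not> odometer f a"
  shows "\<exists>B. tame_via f A B"
proof -
  have "\<exists>B. finite B \<and> B \<subseteq> X \<and> (\<forall>y\<in>orb f {b}. a \<curlywedge> y \<in> orb f B)" if a: "a \<in> A" and b: "b \<in> A" for a b
  proof -
    have X: "a \<in> X" "b \<in> X" using a b A by auto
    obtain B where B: "finite B" "B \<subseteq> X" "\<And>k. b \<curlywedge> pw f k b \<in> orb f B"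
      using finitely_many_meet_orbits[OF f X(2) odo[OF b]] by blast
    have "orb f {b} \<subseteq> X" using orb_X[OF f] X by simp
    then obtain c where c: "c \<in> X" "\<And>y. y \<in> orb f {b} \<Longrightarrow> a \<curlywedge> y = c \<or> a \<curlywedge> y \<in> orb f B"
      using meet_eq_or_orbit[OF X(1)] pairwise_meets_orbit[OF f X(2) B(2,3)] by (metis (no_types, lifting))
    have "a \<curlywedge> y \<in> orb f (insert c B)" if "y \<in> orb f {b}" for y
      using c(2)[OF that] orb_mono[of B "insert c B" f] subset_orb[OF f, of "insert c B"] B(2) c(1) by auto
    then show ?thesis using B c(1) by (intro exI[of _ "insert c B"]) auto
  qed
  then obtain D where D: "\<And>a b. a \<in> A \<Longrightarrow> b \<in> A \<Longrightarrow> finite (D a b) \<and> D a b \<subseteq> X \<and>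
      (\<forall>y\<in>orb f {b}. a \<curlywedge> y \<in> orb f (D a b))"
    by metis
  define B0 where "B0 = (\<Union>a\<in>A. \<Union>b\<in>A. D a b)"
  have B0: "finite B0" "B0 \<subseteq> X" using D A by (auto simp: B0_def)
  define M where "M = meet_hull (orb f A)"
  have oX: "orb f A \<subseteq> X" using orb_X[OF f A(2)] .
  have MX: "M \<subseteq> X" unfolding M_def using meet_hull_X[OF oX] .
  have M_pw: "pw f k u \<in> M" if u: "u \<in> M" for u k
  proof -
    obtain p q where pq: "u = p \<curlywedge> q" "p \<in> orb f A" "q \<in> orb f A" using u by (auto simp: M_def meet_hull_def)
    then have "pw f k u = pw f k p \<curlywedge> pw f k q" using Aut_meet[OF pw_closed[OF f]] oX by blast
    then show ?thesis using pw_orb[OF f A(2)] pq by (auto simp: M_def meet_hull_def)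
  qed
  have M_orb: "M \<subseteq> orb f B0"
  proof
    fix u assume "u \<in> M"
    then obtain i j a b where u: "u = pw f i a \<curlywedge> pw f j b" "a \<in> A" "b \<in> A"
      by (auto simp: M_def meet_hull_def orb_def)
    have "a \<curlywedge> pw f (j - i) b \<in> orb f (D a b)" using D[OF u(2,3)] by (simp add: orbI)
    also have "orb f (D a b) \<subseteq> orb f B0" using u by (intro orb_mono) (auto simp: B0_def)
    finally have "pw f i (a \<curlywedge> pw f (j - i) b) \<in> orb f B0" by (rule pw_orb[OF f B0(2)])
    moreover have "a \<in> X" "b \<in> X" using u A(2) by auto
    ultimately show "u \<in> orb f B0" using u(1) pw_meet[OF f, of a b i j] by simp
  qed
  have AM: "A \<subseteq> M" unfolding M_def using subset_meet_hull[OF oX] subset_orb[OF f A(2)] by blast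
  \<comment> \<open>\<open>B0\<close> may contain points outside \<open>M\<close>, whose orbits
    could create new meets. As \<open>M\<close> is invariant, discarding them makes the orbits of
    \<open>B\<close> exactly \<open>M\<close>.\<close>
  define B where "B = A \<union> (B0 \<inter> M)"
  have B: "finite B" "A \<subseteq> B" "B \<subseteq> X" "B \<subseteq> M" using A B0 AM by (auto simp: B_def)
  have "orb f B = M"
  proof
    show "orb f B \<subseteq> M" using B(4) M_pw by (auto simp: orb_def)
    show "M \<subseteq> orb f B"
    proof
      fix u assume u: "u \<in> M"
      then obtain k b where kb: "u = pw f k b" "b \<in> B0" using M_orb by (auto simp: orb_def)
      have "pw f (- k) u = b" using kb f B0(2) by (simp flip: pw_add add: subset_iff)
      then have "b \<in> M" using M_pw[OF u] by metis
      then show "u \<in> orb f B" using kb by (simp add: orbI B_def)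
    qed
  qed
  then have "tame_via f A B"
    unfolding tame_via_def using f B meet_hull_closed[OF oX] by (simp add: M_def)
  then show ?thesis by blast
qed

section \<open>Baire category in the automorphism group\<close>

definition near :: "'a set \<Rightarrow> ('a \<Rightarrow> 'a) \<Rightarrow> ('a \<Rightarrow> 'a) set" where
  "near F f = {g \<in> G. \<forall>x\<in>F. g x = f x}"

text \<open>\<open>f\<close> is an interior point of the set described by \<open>P\<close>; the sets
  \<open>near F f\<close> with finite \<open>F\<close> are the basic neighbourhoods.\<close>

definition locally_true :: "(('a \<Rightarrow> 'a) \<Rightarrow> bool) \<Rightarrow> ('a \<Rightarrow> 'a) \<Rightarrow> bool" where
  "locally_true P f \<longleftrightarrow> f \<in> G \<and> (\<exists>F. finite F \<and> F \<subseteq> X \<and> (\<forall>g\<in>near F f. P g))"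

lemma near_mono: "F \<subseteq> F' \<Longrightarrow> near F' f \<subseteq> near F f"
  by (auto simp: near_def)

lemma near_refl: "f \<in> G \<Longrightarrow> f \<in> near F f"
  by (simp add: near_def)

lemma near_trans: "g \<in> near F f \<Longrightarrow> h \<in> near F g \<Longrightarrow> h \<in> near F f"
  by (simp add: near_def)

lemma locally_trueI: "f \<in> G \<Longrightarrow> finite F \<Longrightarrow> F \<subseteq> X \<Longrightarrow> (\<And>g. g \<in> near F f \<Longrightarrow> P g) \<Longrightarrow> locally_true P f"
  unfolding locally_true_def by blast

lemma locally_true_conj:
  assumes "locally_true P f" "locally_true Q f"
  shows "locally_true (\<lambda>g. P g \<and> Q g) f"
proof -
  obtain F F' where F: "finite F" "F \<subseteq> X" "\<forall>g\<in>near F f. P g"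
    and F': "finite F'" "F' \<subseteq> X" "\<forall>g\<in>near F' f. Q g" and f: "f \<in> G"
    using assms unfolding locally_true_def by blast
  show ?thesis
    by (rule locally_trueI[of _ "F \<union> F'"]) (use F F' f near_mono[of F "F \<union> F'" f] near_mono[of F' "F \<union> F'" f] in auto)
qed

lemma locally_true_mono: "locally_true P f \<Longrightarrow> (\<And>g. g \<in> G \<Longrightarrow> P g \<Longrightarrow> Q g) \<Longrightarrow> locally_true Q f"
  unfolding locally_true_def near_def by blast

lemma locally_true_idem:
  assumes "locally_true P f"
  shows "locally_true (locally_true P) f"
proof -
  obtain F where F: "f \<in> G" "finite F" "F \<subseteq> X" "\<forall>g\<in>near F f. P g"
    using assms unfolding locally_true_def by blast
  show ?thesis
  proof (rule locally_trueI[OF F(1-3)])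
    fix g assume "g \<in> near F f"
    then show "locally_true P g"
      using F near_trans by (intro locally_trueI[of g F]) (auto simp: near_def)
  qed
qed

lemma locally_trueD: "locally_true P f \<Longrightarrow> P f"
  unfolding locally_true_def using near_refl by blast

definition dense_open :: "('a \<Rightarrow> 'a) set \<Rightarrow> bool" where
  "dense_open W \<longleftrightarrow> (\<forall>f\<in>W. locally_true (\<lambda>g. g \<in> W) f) \<and>
     (\<forall>f\<in>G. \<forall>F. finite F \<longrightarrow> F \<subseteq> X \<longrightarrow> (\<exists>g\<in>W. g \<in> near F f))"

text \<open>A pointwise limit of automorphisms is in general only an embedding. Surjectivity comes
  from freezing values on sets whose images exhaust \<open>X\<close> as well.\<close>

lemma chain_limit:
  fixes h :: "nat \<Rightarrow> 'a \<Rightarrow> 'a"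
  assumes h: "\<And>n. h n \<in> G" and mono: "\<And>n. F n \<subseteq> F (Suc n)"
    and step: "\<And>n. h (Suc n) \<in> near (F n) (h n)"
    and dom: "(\<Union>n. F n) = X" and ran: "X \<subseteq> (\<Union>n. h n ` F n)"
  shows "\<exists>f\<in>G. \<forall>n. f \<in> near (F n) (h n)"
proof -
  have F_mono: "F n \<subseteq> F k" if "n \<le> k" for n k using lift_Suc_mono_le[of F] mono that by blast
  have h_eq: "h k x = h n x" if "n \<le> k" "x \<in> F n" for n k x
    using that(1)
  proof (induction k rule: dec_induct)
    case (step k)
    then show ?case using assms(3)[of k] F_mono[OF step.hyps(1)] that(2) by (auto simp: near_def)
  qed simp
  define f where "f = (\<lambda>x\<in>X. h (LEAST n. x \<in> F n) x)"
  have f: "f x = h n x" if "x \<in> F n" for x n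
  proof -
    have "x \<in> X" using that dom by blast
    moreover have "x \<in> F (LEAST n. x \<in> F n)" using that by (rule LeastI)
    ultimately show ?thesis using h_eq[of "LEAST n. x \<in> F n" n x] that Least_le[of "\<lambda>n. x \<in> F n" n]
      by (simp add: f_def)
  qed
  have FX: "F n \<subseteq> X" for n using dom by blast
  have "f \<in> G"
  proof (rule AutI)
    show "f \<in> extensional X" by (simp add: f_def)
    show "f ` X = X"
    proof
      show "f ` X \<subseteq> X" using h Aut_closed by (auto simp: f_def)
      show "X \<subseteq> f ` X"
      proof
        fix y assume "y \<in> X"
        then obtain n x where "y = h n x" "x \<in> F n" using ran by blast
        then show "y \<in> f ` X" using f[of x n] FX by (metis image_eqI subsetD)
      qed
    qed
    fix x y assume xy: "x \<in> X" "y \<in> X"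
    then obtain n k where "x \<in> F n" "y \<in> F k" using dom by blast
    then have "x \<in> F (max n k)" "y \<in> F (max n k)" using F_mono by (meson max.cobounded1 max.cobounded2 subsetD)+
    then show "f x \<preceq> f y \<longleftrightarrow> x \<preceq> y" using f Aut_le[OF h xy] by metis
  qed
  then show ?thesis using f by (auto simp: near_def)
qed

lemma dense_open_Int_near:
  assumes W: "dense_open W" and f: "f \<in> G" and F: "finite F" "F \<subseteq> X"
  shows "\<exists>g F'. g \<in> near F f \<and> finite F' \<and> F \<subseteq> F' \<and> F' \<subseteq> X \<and> near F' g \<subseteq> W"
proof -
  obtain g where g: "g \<in> W" "g \<in> near F f" using W f F unfolding dense_open_def by blast
  have "locally_true (\<lambda>g. g \<in> W) g" using W g(1) unfolding dense_open_def by blast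
  then obtain F' where F': "finite F'" "F' \<subseteq> X" "near F' g \<subseteq> W"
    unfolding locally_true_def by blast
  then have "near (F \<union> F') g \<subseteq> W" using near_mono[of F' "F \<union> F'" g] by blast
  then show ?thesis using g F F' by (intro exI[of _ g] exI[of _ "F \<union> F'"]) auto
qed

text \<open>Approximations are pairs of an automorphism and the finite set on which it is frozen.
  Each step enters one of the dense open sets and freezes enough points to exhaust domain and range
  in the limit.\<close>

theorem Baire:
  assumes X: "countable X" and Ws: "countable Ws" "\<And>W. W \<in> Ws \<Longrightarrow> dense_open W"
    and f: "f \<in> G" and F: "finite F" "F \<subseteq> X"
  shows "\<exists>g\<in>near F f. \<forall>W\<in>Ws. g \<in> W"
proof -
  \<comment> \<open>Adding \<open>G\<close> makes the family nonempty, so that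
    \<open>from_nat_into\<close> enumerates it.\<close>
  have G: "dense_open G"
    unfolding dense_open_def using near_refl
    by (auto intro!: locally_trueI[of _ "{}"] simp: near_def)
  define W where "W = from_nat_into (insert G Ws)"
  have W: "dense_open (W n)" for n
    using from_nat_into[of "insert G Ws" n] Ws(2) G unfolding W_def by auto
  have W_range: "Ws \<subseteq> range W"
    unfolding W_def using range_from_nat_into[of "insert G Ws"] Ws(1) by auto
  define E where "E n = {x \<in> X. to_nat_on X x < n}" for n
  have E: "finite (E n)" "E n \<subseteq> X" for n
    unfolding E_def using finite_vimage_IntI[of "{..<n}" "to_nat_on X" X] X
    by (auto simp: inj_on_to_nat_on vimage_def Int_def conj_commute)
  define P where "P n s \<longleftrightarrow> fst s \<in> G \<and> finite (snd s) \<and> snd s \<subseteq> X \<and> (n = 0 \<longrightarrow> s = (f, F))"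
    for n :: nat and s :: "('a \<Rightarrow> 'a) \<times> 'a set"
  define R where "R n s t \<longleftrightarrow> fst t \<in> near (snd s) (fst s) \<and> snd s \<subseteq> snd t \<and> near (snd t) (fst t) \<subseteq> W n \<and>
      E n \<subseteq> snd t \<and> E n \<subseteq> fst t ` snd t" for n and s t :: "('a \<Rightarrow> 'a) \<times> 'a set"
  have "\<exists>t. P (Suc n) t \<and> R n s t" if s: "P n s" for n s
  proof -
    obtain g F' where g: "g \<in> near (snd s) (fst s)" "finite F'" "snd s \<subseteq> F'" "F' \<subseteq> X" "near F' g \<subseteq> W n"
      using dense_open_Int_near[OF W, of "fst s" "snd s"] s unfolding P_def by blast
    have gG: "g \<in> G" using g(1) by (simp add: near_def)
    \<comment> \<open>Freezing the preimages of \<open>E n\<close> as well puts \<open>E n\<close>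
      into the range of the limit.\<close>
    define F'' where "F'' = F' \<union> E n \<union> iv g ` E n"
    have "E n \<subseteq> g ` F''"
      using E(2)[of n] gG by (force simp: F''_def image_Un image_image)
    moreover have "near F'' g \<subseteq> W n" using g(5) near_mono[of F' F'' g] by (auto simp: F''_def)
    moreover have "F'' \<subseteq> X" using g E(2)[of n] Aut_closed[OF iv_closed[OF gG]] by (auto simp: F''_def)
    ultimately have "P (Suc n) (g, F'') \<and> R n s (g, F'')"
      using g gG E(1)[of n] by (auto simp: P_def R_def F''_def)
    then show ?thesis by blast
  qed
  moreover have "P 0 (f, F)" using f F by (simp add: P_def)
  ultimately obtain s where s: "\<And>n. P n (s n)" "\<And>n. R n (s n) (s (Suc n))"
    using dependent_nat_choice[of P R] by blast
  have "\<exists>g\<in>G. \<forall>n. g \<in> near (snd (s n)) (fst (s n))"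
  proof (rule chain_limit)
    show "fst (s n) \<in> G" for n using s(1) by (auto simp: P_def)
    show "snd (s n) \<subseteq> snd (s (Suc n))" "fst (s (Suc n)) \<in> near (snd (s n)) (fst (s n))" for n
      using s(2) by (auto simp: R_def)
    have EX: "x \<in> E (Suc (to_nat_on X x))" if "x \<in> X" for x using that by (simp add: E_def)
    show "(\<Union>n. snd (s n)) = X"
    proof
      show "(\<Union>n. snd (s n)) \<subseteq> X" using s(1) by (auto simp: P_def)
      show "X \<subseteq> (\<Union>n. snd (s n))"
      proof
        fix x assume "x \<in> X"
        then have "x \<in> snd (s (Suc (Suc (to_nat_on X x))))"
          using EX[of x] s(2)[of "Suc (to_nat_on X x)"] unfolding R_def by blast
        then show "x \<in> (\<Union>n. snd (s n))" by blast
      qed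
    qed
    show "X \<subseteq> (\<Union>n. fst (s n) ` snd (s n))"
    proof
      fix x assume "x \<in> X"
      then have "x \<in> fst (s (Suc (Suc (to_nat_on X x)))) ` snd (s (Suc (Suc (to_nat_on X x))))"
        using EX[of x] s(2)[of "Suc (to_nat_on X x)"] unfolding R_def by blast
      then show "x \<in> (\<Union>n. fst (s n) ` snd (s n))" by blast
    qed
  qed
  then obtain g where g: "\<And>n. g \<in> near (snd (s n)) (fst (s n))" by blast
  have "g \<in> W n" for n using g[of "Suc n"] s(2)[of n] by (auto simp: R_def)
  moreover have "g \<in> near F f" using g[of 0] s(1)[of 0] by (simp add: P_def)
  ultimately show ?thesis using W_range by blast
qed

text \<open>Evaluating a term uses only finitely many values of \<open>f\<close>. For
  \<open>Unshift\<close> the value of \<open>f\<close> at the preimage has to be frozen.\<close>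

lemma ev_locally_constant:
  assumes f: "f \<in> G" and "t \<in> terms X"
  shows "locally_true (\<lambda>g. ev g t = ev f t) f"
  using assms(2)
proof (induction t)
  case (Gen a)
  then show ?case by (intro locally_trueI[of _ "{}"]) (auto simp: f)
next
  case (Shift t)
  have "locally_true (\<lambda>g. g (ev f t) = f (ev f t)) f"
    by (rule locally_trueI[of _ "{ev f t}"]) (use f Shift ev_closed in \<open>auto simp: near_def\<close>)
  then have "locally_true (\<lambda>g. ev g t = ev f t \<and> g (ev f t) = f (ev f t)) f"
    using Shift by (intro locally_true_conj) auto
  then show ?case by (rule locally_true_mono) simp
next
  case (Unshift t)
  let ?w = "iv f (ev f t)"
  have w: "?w \<in> X" "f ?w = ev f t"
    using f Unshift ev_closed[OF f] Aut_closed[OF iv_closed[OF f]] by auto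
  have "locally_true (\<lambda>g. g ?w = ev f t) f"
    by (rule locally_trueI[of _ "{?w}"]) (use f w in \<open>auto simp: near_def\<close>)
  then have "locally_true (\<lambda>g. ev g t = ev f t \<and> g ?w = ev f t) f"
    using Unshift by (intro locally_true_conj) auto
  then show ?case
  proof (rule locally_true_mono)
    fix g assume "g \<in> G" "ev g t = ev f t \<and> g ?w = ev f t"
    then show "ev g (Unshift t) = ev f (Unshift t)" using w(1) by (metis ev.simps(3) iv_app)
  qed
next
  case (Meet s t)
  then have "locally_true (\<lambda>g. ev g s = ev f s \<and> ev g t = ev f t) f"
    by (intro locally_true_conj) auto
  then show ?case by (rule locally_true_mono) simp
qed

text \<open>Two terms witnessing the difference keep their values nearby. So the automorphisms
  giving \<open>A\<close> a fixed realised type form a closed set.\<close>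

lemma tp_neq_locally:
  assumes f: "f \<in> G" and A: "A \<subseteq> X" and neq: "tp f A \<noteq> tp g A"
  shows "locally_true (\<lambda>f'. tp f' A \<noteq> tp g A) f"
proof -
  obtain s t where st: "s \<in> terms A" "t \<in> terms A" "ev f s \<preceq> ev f t \<longleftrightarrow> \<not> ev g s \<preceq> ev g t"
    using neq tp_cong_ev by blast
  have "locally_true (\<lambda>f'. ev f' s = ev f s \<and> ev f' t = ev f t) f"
    using st A by (intro locally_true_conj ev_locally_constant f) auto
  then show ?thesis
  proof (rule locally_true_mono)
    fix h assume h: "ev h s = ev f s \<and> ev h t = ev f t"
    have "(s, t) \<in> tp h A \<longleftrightarrow> (s, t) \<notin> tp g A" using st h by (simp add: tp_def)
    then show "tp h A \<noteq> tp g A" by blast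
  qed
qed

text \<open>By \<open>odometer_perturb\<close> an odometer can be changed so that \<open>x\<close>
  becomes periodic. A finite orbit is fixed by finitely many values and excludes an odometer, since
  at the level of the period all meets equal \<open>x\<close>.\<close>

lemma dense_open_not_odometer:
  assumes x: "x \<in> X"
  shows "dense_open {f. locally_true (\<lambda>g. \<not> odometer g x) f}"
  unfolding dense_open_def
proof (intro conjI ballI allI impI)
  fix f assume "f \<in> {f. locally_true (\<lambda>g. \<not> odometer g x) f}"
  then show "locally_true (\<lambda>g. g \<in> {f. locally_true (\<lambda>g. \<not> odometer g x) f}) f"
    using locally_true_idem by simp
next
  fix f F assume f: "f \<in> G" and F: "finite F" "F \<subseteq> X"
  show "\<exists>g\<in>{f. locally_true (\<lambda>g. \<not> odometer g x) f}. g \<in> near F f"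
  proof (cases "\<exists>g\<in>near F f. odometer g x")
    case False
    then have "locally_true (\<lambda>g. \<not> odometer g x) f" using f F by (intro locally_trueI) auto
    then show ?thesis using near_refl[OF f] by blast
  next
    case True
    then obtain g where g: "g \<in> near F f" "odometer g x" by blast
    then have "g \<in> G" by (simp add: near_def)
    then obtain f' and d :: nat where f': "f' \<in> G" "\<forall>u\<in>F. f' u = g u" and d: "d \<ge> 1" "pw f' (int d) x = x"
      using odometer_perturb[OF _ x F g(2)] by blast
    have "locally_true (\<lambda>g. \<not> odometer g x) f'"
    proof (rule locally_trueI[OF f'(1)])
      let ?H = "(\<lambda>n. pw f' (int n) x) ` {..<d}"
      show "finite ?H" "?H \<subseteq> X" using f' x by auto
      fix h assume h: "h \<in> near ?H f'"
      then have hG: "h \<in> G" by (simp add: near_def)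
      have "pw h (int n) x = pw f' (int n) x" if "n \<le> d" for n
        using that
      proof (induction n)
        case (Suc n)
        then have "h (pw f' (int n) x) = f' (pw f' (int n) x)" using h by (auto simp: near_def)
        then show ?case using Suc pw_Suc[OF hG x, of "int n"] pw_Suc[OF f'(1) x, of "int n"] by simp
      qed (use x in simp)
      then have hd: "pw h (int d) x = x" using d by simp
      have per: "pw h (int (d * k)) x = x" for k
      proof (induction k)
        case (Suc k)
        then show ?case using pw_add[OF hG x, of "int d" "int (d * k)"] hd by simp
      qed (use x in simp)
      show "\<not> odometer h x" unfolding odometer_def using d(1) hd per x by metis
    qed
    moreover have "f' \<in> near F f" using f' g by (simp add: near_def)
    ultimately show ?thesis by blast
  qed
qed

text \<open>Away from the boundaries of the countably many closed sets of automorphisms with a given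
  type, the type is locally constant.\<close>

lemma dense_locally_constant_tp:
  assumes X: "countable X" and A: "finite A" "A \<subseteq> X" and f: "f \<in> G" and F: "finite F" "F \<subseteq> X"
  shows "\<exists>g\<in>near F f. locally_true (\<lambda>h. tp h A = tp g A) g"
proof -
  \<comment> \<open>For a realised type \<open>t\<close>, the complement of the boundary of the
    closed set of automorphisms with that type.\<close>
  define W where "W t = {f. locally_true (\<lambda>g. tp g A = t) f \<or> locally_true (\<lambda>g. tp g A \<noteq> t) f}" for t
  have W: "dense_open (W t)" if "t = tp r A" for t r
    unfolding dense_open_def
  proof (intro conjI ballI allI impI)
    fix f assume "f \<in> W t"
    then have "locally_true (locally_true (\<lambda>g. tp g A = t)) f \<or>
        locally_true (locally_true (\<lambda>g. tp g A \<noteq> t)) f"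
      unfolding W_def using locally_true_idem by blast
    then show "locally_true (\<lambda>g. g \<in> W t) f"
      by (elim disjE; elim locally_true_mono) (simp_all add: W_def)
  next
    fix f F assume f: "f \<in> G" and F: "finite F" "F \<subseteq> X"
    show "\<exists>g\<in>W t. g \<in> near F f"
    proof (cases "\<exists>g\<in>near F f. tp g A \<noteq> t")
      case True
      then obtain g where g: "g \<in> near F f" "tp g A \<noteq> t" by blast
      then have "locally_true (\<lambda>g. tp g A \<noteq> t) g"
        using tp_neq_locally[of g A r] A that by (auto simp: near_def)
      then show ?thesis using g by (auto simp: W_def)
    next
      case False
      then have "locally_true (\<lambda>g. tp g A = t) f" using f F by (intro locally_trueI) auto
      then show ?thesis using near_refl[OF f] by (auto simp: W_def)
    qed
  qed
  \<comment> \<open>Only the countably many tame types are treated; avoiding odometers at the points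
    of \<open>A\<close> ensures that the type of the automorphism obtained is one of them.\<close>
  define Ws where "Ws = (\<lambda>x. {f. locally_true (\<lambda>g. \<not> odometer g x) f}) ` A \<union>
      W ` {tp f A | f B. tame_via f A B}"
  have "countable Ws"
    unfolding Ws_def using countable_tame_tps[OF X, of A] A(1) by (auto intro: countable_finite)
  moreover have "dense_open W'" if "W' \<in> Ws" for W'
    using that W dense_open_not_odometer A(2) unfolding Ws_def by blast
  ultimately obtain g where g: "g \<in> near F f" "\<forall>W\<in>Ws. g \<in> W"
    using Baire[OF X _ _ f F] by blast
  have gG: "g \<in> G" using g by (simp add: near_def)
  have "\<not> odometer g a" if "a \<in> A" for a
  proof -
    have "{f. locally_true (\<lambda>g. \<not> odometer g a) f} \<in> Ws" using that by (simp add: Ws_def)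
    then have "locally_true (\<lambda>g. \<not> odometer g a) g" using g(2) by fast
    then show ?thesis using locally_trueD[of "\<lambda>g. \<not> odometer g a"] by simp
  qed
  then obtain B where "tame_via g A B" using tame_if_not_odometer[OF gG A] by blast
  then have "W (tp g A) \<in> Ws" unfolding Ws_def by blast
  then have "g \<in> W (tp g A)" using g(2) by blast
  then have "locally_true (\<lambda>h. tp h A = tp g A) g"
    using locally_trueD[of "\<lambda>h. tp h A \<noteq> tp g A" g] by (auto simp: W_def)
  then show ?thesis using g(1) by blast
qed

section \<open>Conjugacy of generic automorphisms\<close>

abbreviation conj_by :: "('a \<Rightarrow> 'a) \<Rightarrow> ('a \<Rightarrow> 'a) \<Rightarrow> 'a \<Rightarrow> 'a" where
  "conj_by g f \<equiv> iv g \<bullet> f \<bullet> g"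

text \<open>\<open>g\<close> is an isomorphism from the tree with \<open>conj_by g f\<close> to the
  tree with \<open>f\<close>, so it commutes with evaluation.\<close>

lemma ev_conj_by:
  assumes "g \<in> G" "f \<in> G" "t \<in> terms X"
  shows "g (ev (conj_by g f) t) = ev f (map_shift_term g t)"
  using assms(3)
proof (induction t)
  case (Shift t)
  let ?u = "ev (conj_by g f) t"
  have "?u \<in> X" using ev_closed[of "conj_by g f" t] Shift assms by simp
  then have "g (conj_by g f ?u) = f (g ?u)"
    using assms Aut_closed[of f "g ?u"] Aut_closed[of g ?u] by simp
  then show ?case using Shift by simp
next
  case (Unshift t)
  let ?u = "ev (conj_by g f) t"
  have u: "?u \<in> X" using ev_closed[of "conj_by g f" t] Unshift assms by simp
  have "iv (conj_by g f) = conj_by g (iv f)"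
    using assms by (simp add: A.inv_mult_group A.m_assoc)
  then have "g (iv (conj_by g f) ?u) = iv f (g ?u)"
    using u assms Aut_closed[of "iv f"] Aut_closed[of g] by simp
  then show ?case using Unshift by simp
next
  case (Meet s t)
  then show ?case using Aut_meet[OF assms(1)] ev_closed[of "conj_by g f"] assms by simp
qed simp

lemma tp_conj_by:
  assumes g: "g \<in> G" and f: "f \<in> G" and A: "A \<subseteq> X"
  shows "tp (conj_by g f) A = {(s, t). s \<in> terms A \<and> t \<in> terms A \<and> (map_shift_term g s, map_shift_term g t) \<in> tp f (g ` A)}"
proof -
  have "ev (conj_by g f) s \<preceq> ev (conj_by g f) t \<longleftrightarrow>
      ev f (map_shift_term g s) \<preceq> ev f (map_shift_term g t)" if "s \<in> terms A" "t \<in> terms A" for s t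
  proof -
    have st: "s \<in> terms X" "t \<in> terms X" using that A by auto
    then have "ev (conj_by g f) s \<in> X" "ev (conj_by g f) t \<in> X"
      using ev_closed[of "conj_by g f"] f g by auto
    then show ?thesis using Aut_le[OF g] ev_conj_by[OF g f st(1)] ev_conj_by[OF g f st(2)] by metis
  qed
  then show ?thesis by (auto simp: tp_def shift_term.set_map)
qed

definition decided :: "('a \<Rightarrow> 'a) \<Rightarrow> 'a set \<Rightarrow> bool" where
  "decided f A \<longleftrightarrow> locally_true (\<lambda>h. tp h A = tp f A) f"

text \<open>The conjugates of \<open>f\<close> by automorphisms fixing \<open>A\<close> pointwise
  come arbitrarily close to every automorphism giving \<open>A\<close> the same type.\<close>

definition realizing :: "('a \<Rightarrow> 'a) \<Rightarrow> 'a set \<Rightarrow> bool" where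
  "realizing f A \<longleftrightarrow> (\<forall>r\<in>G. tp r A = tp f A \<longrightarrow>
     (\<forall>F. finite F \<longrightarrow> F \<subseteq> X \<longrightarrow> (\<exists>g\<in>near A \<one>\<^bsub>AutGroup T\<^esub>. conj_by g f \<in> near F r)))"

definition generic :: "('a \<Rightarrow> 'a) \<Rightarrow> bool" where
  "generic f \<longleftrightarrow> f \<in> G \<and> (\<forall>A. finite A \<longrightarrow> A \<subseteq> X \<longrightarrow> decided f A \<and> realizing f A)"

lemma conj_by_comp: "g \<in> G \<Longrightarrow> h \<in> G \<Longrightarrow> f \<in> G \<Longrightarrow> conj_by (g \<bullet> h) f = conj_by h (conj_by g f)"
  by (simp add: A.inv_mult_group A.m_assoc)

lemma conj_by_iv: "g \<in> G \<Longrightarrow> f \<in> G \<Longrightarrow> conj_by g (conj_by (iv g) f) = f"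
proof -
  assume g: "g \<in> G" and f: "f \<in> G"
  have "iv g \<bullet> g = \<one>\<^bsub>AutGroup T\<^esub>" using g by simp
  then have "conj_by (iv g \<bullet> g) f = f" using f by simp
  then show ?thesis using conj_by_comp[of "iv g" g f] g f by (metis iv_closed)
qed

lemma near_one_iff: "A \<subseteq> X \<Longrightarrow> g \<in> near A \<one>\<^bsub>AutGroup T\<^esub> \<longleftrightarrow> g \<in> G \<and> (\<forall>a\<in>A. g a = a)"
  by (auto simp: near_def subset_iff)

text \<open>A state of the back-and-forth, in which only the values of \<open>g\<close> on
  \<open>A\<close> are final. Keeping a total \<open>g\<close> allows a state to be refined by
  composition with an automorphism fixing \<open>A\<close>.\<close>

definition matches :: "('a \<Rightarrow> 'a) \<Rightarrow> ('a \<Rightarrow> 'a) \<Rightarrow> 'a set \<Rightarrow> ('a \<Rightarrow> 'a) \<Rightarrow> bool" where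
  "matches \<sigma> \<tau> A g \<longleftrightarrow> g \<in> G \<and> finite A \<and> A \<subseteq> X \<and> tp \<sigma> A = tp (conj_by g \<tau>) A"

lemma matches_iv:
  assumes m: "matches \<sigma> \<tau> A g" and \<sigma>: "\<sigma> \<in> G" and \<tau>: "\<tau> \<in> G"
  shows "matches \<tau> \<sigma> (g ` A) (iv g)"
proof -
  have g: "g \<in> G" and A: "finite A" "A \<subseteq> X" and eq: "tp \<sigma> A = tp (conj_by g \<tau>) A"
    using m by (auto simp: matches_def)
  have gA: "g ` A \<subseteq> X" using A g Aut_closed by auto
  have A_eq: "iv g ` g ` A = A" using A g by (force simp: image_image)
  have "tp \<tau> (g ` A) = tp (conj_by (iv g) (conj_by g \<tau>)) (g ` A)"
    using conj_by_iv[of "iv g" \<tau>] g \<tau> by simp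
  also have "\<dots> = tp (conj_by (iv g) \<sigma>) (g ` A)"
    using tp_conj_by[of "iv g" _ "g ` A"] g \<sigma> \<tau> gA A_eq eq by simp
  finally show ?thesis using g A gA by (simp add: matches_def)
qed

text \<open>Transport along \<open>g\<close>: an automorphism \<open>h\<close> found over the image
  of \<open>A\<close> is pulled back to \<open>conj_by g h\<close>.\<close>

lemma realizing_conj_by:
  assumes real: "realizing f (g ` A)" and g: "g \<in> G" and f: "f \<in> G" and A: "A \<subseteq> X"
  shows "realizing (conj_by g f) A"
  unfolding realizing_def
proof (intro ballI allI impI)
  fix r F assume r: "r \<in> G" "tp r A = tp (conj_by g f) A" and F: "finite F" "F \<subseteq> X"
  let ?r = "conj_by (iv g) r"
  have gA: "g ` A \<subseteq> X" using A g Aut_closed by auto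
  have A_eq: "iv g ` g ` A = A" using A g by (force simp: image_image)
  have "tp ?r (g ` A) = tp (conj_by (iv g) (conj_by g f)) (g ` A)"
    using tp_conj_by[of "iv g" _ "g ` A"] g f r gA A_eq by simp
  also have "\<dots> = tp f (g ` A)" using conj_by_iv[of "iv g" f] g f by simp
  finally have "tp ?r (g ` A) = tp f (g ` A)" .
  moreover have "?r \<in> G" "finite (g ` F)" "g ` F \<subseteq> X" using g r F Aut_closed by auto
  ultimately obtain h where h: "h \<in> near (g ` A) \<one>\<^bsub>AutGroup T\<^esub>" "conj_by h f \<in> near (g ` F) ?r"
    using real unfolding realizing_def by blast
  have hG: "h \<in> G" using h by (simp add: near_def)
  define k where "k = conj_by g h"
  have kG: "k \<in> G" using g hG by (simp add: k_def)
  have "conj_by k (conj_by g f) = conj_by (g \<bullet> k) f" using conj_by_comp g kG f by simp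
  also have "g \<bullet> k = h \<bullet> g" using g hG by (simp add: k_def A.m_assoc[symmetric])
  also have "conj_by (h \<bullet> g) f = conj_by g (conj_by h f)" using conj_by_comp g hG f by simp
  finally have eq: "conj_by k (conj_by g f) = conj_by g (conj_by h f)" .
  have "conj_by g (conj_by h f) x = r x" if "x \<in> F" for x
  proof -
    have x: "x \<in> X" "g x \<in> X" using that F g Aut_closed by auto
    have "conj_by g (conj_by h f) x = iv g ((conj_by h f) (g x))"
      using x g hG f Aut_closed by simp
    also have "(conj_by h f) (g x) = ?r (g x)" using h(2) that by (simp add: near_def)
    also have "iv g (?r (g x)) = r x" using x g r Aut_closed by simp
    finally show ?thesis .
  qed
  then have "conj_by k (conj_by g f) \<in> near F r" using eq g hG f by (simp add: near_def)
  moreover have "k \<in> near A \<one>\<^bsub>AutGroup T\<^esub>"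
  proof -
    have "h (g a) = g a" if "a \<in> A" for a using h(1) that by (simp add: near_one_iff[OF gA])
    then have "k a = a" if "a \<in> A" for a using that A g hG Aut_closed by (auto simp: k_def)
    then show ?thesis using kG by (simp add: near_one_iff[OF A])
  qed
  ultimately show "\<exists>k\<in>near A \<one>\<^bsub>AutGroup T\<^esub>. conj_by k (conj_by g f) \<in> near F r" by blast
qed

text \<open>\<open>decided\<close> for \<open>\<sigma>\<close> on the larger set tells on which
  finite set agreement with \<open>\<sigma>\<close> fixes the type; \<open>realizing\<close> for
  \<open>\<tau>\<close> over the image of the smaller set provides a conjugate with this
  agreement.\<close>

lemma matches_forth:
  assumes gen: "generic \<sigma>" "generic \<tau>" and m: "matches \<sigma> \<tau> A g" and Y: "finite Y" "Y \<subseteq> X"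
  shows "\<exists>g'. matches \<sigma> \<tau> (A \<union> Y) g' \<and> g' \<in> near A g"
proof -
  have g: "g \<in> G" and A: "finite A" "A \<subseteq> X" and eq: "tp \<sigma> A = tp (conj_by g \<tau>) A"
    using m by (auto simp: matches_def)
  have \<sigma>: "\<sigma> \<in> G" and \<tau>: "\<tau> \<in> G" using gen by (auto simp: generic_def)
  have "decided \<sigma> (A \<union> Y)" using gen(1) A Y by (simp add: generic_def)
  then obtain F where F: "finite F" "F \<subseteq> X" "\<And>h. h \<in> near F \<sigma> \<Longrightarrow> tp h (A \<union> Y) = tp \<sigma> (A \<union> Y)"
    unfolding decided_def locally_true_def by blast
  have "finite (g ` A)" "g ` A \<subseteq> X" using A g Aut_closed by auto
  then have "realizing \<tau> (g ` A)" using gen(2) by (simp add: generic_def)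
  then have "realizing (conj_by g \<tau>) A" using realizing_conj_by g \<tau> A by blast
  then obtain h where h: "h \<in> near A \<one>\<^bsub>AutGroup T\<^esub>" "conj_by h (conj_by g \<tau>) \<in> near F \<sigma>"
    using \<sigma> eq F(1,2) unfolding realizing_def by blast
  have hG: "h \<in> G" "\<And>a. a \<in> A \<Longrightarrow> h a = a" using h(1) A by (auto simp: near_one_iff)
  have "tp \<sigma> (A \<union> Y) = tp (conj_by (g \<bullet> h) \<tau>) (A \<union> Y)"
    using F(3)[OF h(2)] conj_by_comp g hG(1) \<tau> by simp
  then have "matches \<sigma> \<tau> (A \<union> Y) (g \<bullet> h)" using g hG A Y by (simp add: matches_def)
  moreover have "g \<bullet> h \<in> near A g" using g hG A by (auto simp: near_def)
  ultimately show ?thesis by blast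
qed

lemma matches_back:
  assumes gen: "generic \<sigma>" "generic \<tau>" and m: "matches \<sigma> \<tau> A g" and Y: "finite Y" "Y \<subseteq> X"
  shows "\<exists>A' g'. matches \<sigma> \<tau> A' g' \<and> A \<subseteq> A' \<and> Y \<subseteq> g' ` A' \<and> g' \<in> near A g"
proof -
  have \<sigma>: "\<sigma> \<in> G" and \<tau>: "\<tau> \<in> G" using gen by (auto simp: generic_def)
  have g: "g \<in> G" and A: "A \<subseteq> X" using m by (auto simp: matches_def)
  obtain h where h: "matches \<tau> \<sigma> (g ` A \<union> Y) h" "h \<in> near (g ` A) (iv g)"
    using matches_forth[OF gen(2,1) matches_iv[OF m \<sigma> \<tau>] Y] by blast
  have hG: "h \<in> G" using h(1) by (simp add: matches_def)
  define A' where "A' = h ` (g ` A \<union> Y)"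
  have hg: "h (g a) = a" if "a \<in> A" for a using h(2) that A g by (auto simp: near_def)
  have "matches \<sigma> \<tau> A' (iv h)" unfolding A'_def by (rule matches_iv[OF h(1) \<tau> \<sigma>])
  moreover have "A \<subseteq> A'" unfolding A'_def using hg by force
  moreover have "Y \<subseteq> iv h ` A'" unfolding A'_def using hG Y(2) by (force simp: image_image image_Un)
  moreover have "iv h \<in> near A g"
  proof -
    have "iv h a = g a" if "a \<in> A" for a
      using hg[OF that] that A g hG Aut_closed[OF g] by (metis iv_app subsetD)
    then show ?thesis using hG by (simp add: near_def)
  qed
  ultimately show ?thesis by blast
qed

lemma generic_conjugate:
  assumes X: "countable X" and gen: "generic \<sigma>" "generic \<tau>" and start: "tp \<sigma> {} = tp \<tau> {}"
  shows "\<exists>\<phi>\<in>G. \<sigma> = conj_by \<phi> \<tau>"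
proof -
  have \<sigma>: "\<sigma> \<in> G" and \<tau>: "\<tau> \<in> G" using gen by (auto simp: generic_def)
  define E where "E n = {x \<in> X. to_nat_on X x < n}" for n
  have E: "finite (E n)" "E n \<subseteq> X" for n
    unfolding E_def using finite_vimage_IntI[of "{..<n}" "to_nat_on X" X] X
    by (auto simp: inj_on_to_nat_on vimage_def Int_def conj_commute)
  define P where "P s \<longleftrightarrow> matches \<sigma> \<tau> (fst s) (snd s)" for s :: "'a set \<times> ('a \<Rightarrow> 'a)"
  define R where "R n s t \<longleftrightarrow> fst s \<subseteq> fst t \<and> snd t \<in> near (fst s) (snd s) \<and>
      E n \<subseteq> fst t \<and> E n \<subseteq> snd t ` fst t" for n and s t :: "'a set \<times> ('a \<Rightarrow> 'a)"
  have "\<exists>t. P t \<and> R n s t" if s: "P s" for n s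
  proof -
    obtain g where g: "matches \<sigma> \<tau> (fst s \<union> E n) g" "g \<in> near (fst s) (snd s)"
      using matches_forth[OF gen s[unfolded P_def] E[of n]] by blast
    obtain A' g' where g': "matches \<sigma> \<tau> A' g'" "fst s \<union> E n \<subseteq> A'" "E n \<subseteq> g' ` A'" "g' \<in> near (fst s \<union> E n) g"
      using matches_back[OF gen g(1) E[of n]] by blast
    have "g' \<in> near (fst s) (snd s)" using g(2) g'(4) by (auto simp: near_def)
    then show ?thesis using g' by (intro exI[of _ "(A', g')"]) (auto simp: P_def R_def)
  qed
  moreover have "P ({}, \<one>\<^bsub>AutGroup T\<^esub>)"
    using start \<tau> by (simp add: P_def matches_def)
  ultimately obtain s where s: "\<And>n. P (s n)" "\<And>n. R n (s n) (s (Suc n))"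
    using dependent_nat_choice[of "\<lambda>_. P" R] by blast
  have EX: "x \<in> E (Suc (to_nat_on X x))" if "x \<in> X" for x using that by (simp add: E_def)
  have sX: "fst (s n) \<subseteq> X" "snd (s n) \<in> G" for n using s(1) by (auto simp: P_def matches_def)
  have sE: "E n \<subseteq> fst (s (Suc n))" "E n \<subseteq> snd (s (Suc n)) ` fst (s (Suc n))"
    and mono: "fst (s n) \<subseteq> fst (s (Suc n))" for n
    using s(2)[of n] by (auto simp: R_def)
  have cover: "x \<in> fst (s (Suc (Suc (to_nat_on X x))))" if "x \<in> X" for x
    using sE(1) EX[OF that] by blast
  have "\<exists>\<phi>\<in>G. \<forall>n. \<phi> \<in> near (fst (s n)) (snd (s n))"
  proof (rule chain_limit)
    show "snd (s n) \<in> G" "fst (s n) \<subseteq> fst (s (Suc n))" "snd (s (Suc n)) \<in> near (fst (s n)) (snd (s n))" for n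
      using sX mono s(2)[of n] by (auto simp: R_def)
    show "(\<Union>n. fst (s n)) = X" using sX(1) cover by blast
    show "X \<subseteq> (\<Union>n. snd (s n) ` fst (s n))"
    proof
      fix x assume "x \<in> X"
      then have "x \<in> snd (s (Suc (Suc (to_nat_on X x)))) ` fst (s (Suc (Suc (to_nat_on X x))))"
        using sE(2) EX by blast
      then show "x \<in> (\<Union>n. snd (s n) ` fst (s n))" by blast
    qed
  qed
  then obtain \<phi> where \<phi>: "\<phi> \<in> G" "\<And>n. \<phi> \<in> near (fst (s n)) (snd (s n))" by blast
  have fst_mono: "fst (s n) \<subseteq> fst (s k)" if "n \<le> k" for n k
    using lift_Suc_mono_le[of "\<lambda>n. fst (s n)"] mono that by blast
  have "\<sigma> x = conj_by \<phi> \<tau> x" if x: "x \<in> X" for x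
  proof -
    have \<sigma>x: "\<sigma> x \<in> X" using x \<sigma> Aut_closed by blast
    obtain n where n: "x \<in> fst (s n)" "\<sigma> x \<in> fst (s n)"
    proof -
      let ?n = "max (Suc (Suc (to_nat_on X x))) (Suc (Suc (to_nat_on X (\<sigma> x))))"
      have "x \<in> fst (s ?n)" using cover[OF x] fst_mono[OF max.cobounded1] by blast
      moreover have "\<sigma> x \<in> fst (s ?n)" using cover[OF \<sigma>x] fst_mono[OF max.cobounded2] by blast
      ultimately show thesis by (rule that)
    qed
    define g where "g = snd (s n)"
    have g: "g \<in> G" and tp: "tp \<sigma> (fst (s n)) = tp (conj_by g \<tau>) (fst (s n))"
      using s(1)[of n] by (auto simp: P_def matches_def g_def)
    \<comment> \<open>The equation between the shift of \<open>x\<close> and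
      \<open>\<sigma> x\<close> is part of the type, as two inequalities, because both points belong
      to the set. So the conjugate of \<open>\<tau>\<close> satisfies it too.\<close>
    have "(Shift (Gen x), Gen (\<sigma> x)) \<in> tp \<sigma> (fst (s n))" "(Gen (\<sigma> x), Shift (Gen x)) \<in> tp \<sigma> (fst (s n))"
      using n \<sigma>x le_refl by (auto simp: tp_def)
    then have "conj_by g \<tau> x = \<sigma> x" unfolding tp by (auto simp: tp_def intro: le_antisym)
    then have "\<tau> (g x) = g (\<sigma> x)" using x g \<tau> \<sigma>x Aut_closed by (simp add: iv_eq_iff)
    moreover have "g x = \<phi> x" "g (\<sigma> x) = \<phi> (\<sigma> x)" using \<phi>(2)[of n] n by (auto simp: near_def g_def)
    ultimately have "\<tau> (\<phi> x) = \<phi> (\<sigma> x)" by simp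
    then show ?thesis using x \<phi>(1) \<tau> \<sigma>x Aut_closed by (simp add: iv_eq_iff)
  qed
  then have "\<sigma> = conj_by \<phi> \<tau>" using \<phi>(1) \<sigma> \<tau> by (intro Aut_eqI) auto
  then show ?thesis using \<phi>(1) by blast
qed

end

text \<open>Terms contain no constants. Hence the type of the empty set is the same for all
  automorphisms, which lets the back-and-forth start.\<close>

lemma set_shift_term_not_empty: "set_shift_term t \<noteq> {}"
  by (induction t) auto

section \<open>Countably many dense open requirements for genericity\<close>

context universal_meet_tree
begin

text \<open>\<open>L\<close> stands for a finite piece of the automorphism \<open>r\<close> in
  \<open>realizing\<close>. Using finite data leaves only countably many conditions.\<close>

definition requirement :: "'a set \<Rightarrow> ('a \<times> 'a) set \<Rightarrow> ('a \<Rightarrow> 'a) set" where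
  "requirement A L = {f \<in> G. decided f A \<and>
     ((\<exists>r\<in>G. tp r A = tp f A \<and> (\<forall>(x, y)\<in>L. r x = y)) \<longrightarrow>
      (\<exists>g\<in>near A \<one>\<^bsub>AutGroup T\<^esub>. \<forall>(x, y)\<in>L. f (g x) = g y))}"

lemma decidedI:
  assumes f: "f \<in> G" and F: "finite F" "F \<subseteq> X" "\<And>h. h \<in> near F f \<Longrightarrow> tp h A = tp f A"
  shows "decided f A"
  unfolding decided_def using assms by (intro locally_trueI)

lemma decided_locally:
  assumes "decided f A"
  shows "locally_true (\<lambda>h. decided h A \<and> tp h A = tp f A) f"
proof -
  have "locally_true (locally_true (\<lambda>h. tp h A = tp f A)) f"
    using assms unfolding decided_def by (rule locally_true_idem)
  then show ?thesis
  proof (rule locally_true_mono)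
    fix h assume h: "locally_true (\<lambda>h. tp h A = tp f A) h"
    then have "tp h A = tp f A" by (rule locally_trueD)
    then show "decided h A \<and> tp h A = tp f A" using h by (simp add: decided_def)
  qed
qed

text \<open>The premise about \<open>r\<close> depends on \<open>f\<close> only through the type of
  \<open>A\<close>, which is constant nearby, and its consequence involves finitely many values;
  this gives openness. For density, \<open>f\<close> is moved to a point where the type is locally
  constant and then amalgamated with \<open>r\<close> over \<open>A\<close>.\<close>

lemma dense_open_requirement:
  assumes A: "finite A" "A \<subseteq> X" and L: "finite L" "L \<subseteq> X \<times> X"
  shows "dense_open (requirement A L)"
  unfolding dense_open_def
proof (intro conjI ballI allI impI)
  fix f assume f: "f \<in> requirement A L"
  then have fG: "f \<in> G" and dec: "locally_true (\<lambda>h. decided h A \<and> tp h A = tp f A) f"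
    using decided_locally by (auto simp: requirement_def)
  show "locally_true (\<lambda>h. h \<in> requirement A L) f"
  proof (cases "\<exists>r\<in>G. tp r A = tp f A \<and> (\<forall>(x, y)\<in>L. r x = y)")
    case False
    from dec show ?thesis
      by (rule locally_true_mono) (use False in \<open>auto simp: requirement_def\<close>)
  next
    case True
    then obtain g where g: "g \<in> near A \<one>\<^bsub>AutGroup T\<^esub>" "\<forall>(x, y)\<in>L. f (g x) = g y"
      using f by (auto simp: requirement_def)
    then have gG: "g \<in> G" by (simp add: near_def)
    have "locally_true (\<lambda>h. \<forall>(x, y)\<in>L. h (g x) = g y) f"
    proof (rule locally_trueI[OF fG])
      show "finite ((\<lambda>p. g (fst p)) ` L)" "(\<lambda>p. g (fst p)) ` L \<subseteq> X"
        using L Aut_closed[OF gG] by auto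
      fix h assume "h \<in> near ((\<lambda>p. g (fst p)) ` L) f"
      then show "\<forall>(x, y)\<in>L. h (g x) = g y" using g(2) by (fastforce simp: near_def)
    qed
    from locally_true_conj[OF dec this] show ?thesis
      by (rule locally_true_mono) (use g(1) in \<open>auto simp: requirement_def\<close>)
  qed
next
  fix f F assume f: "f \<in> G" and F: "finite F" "F \<subseteq> X"
  obtain k where k: "k \<in> near F f" "locally_true (\<lambda>h. tp h A = tp k A) k"
    using dense_locally_constant_tp[OF countable_X A f F] by blast
  have kG: "k \<in> G" using k(1) by (simp add: near_def)
  show "\<exists>g\<in>requirement A L. g \<in> near F f"
  proof (cases "\<exists>r\<in>G. tp r A = tp k A \<and> (\<forall>(x, y)\<in>L. r x = y)")
    case False
    then have "k \<in> requirement A L" using k(2) kG by (auto simp: requirement_def decided_def)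
    then show ?thesis using k(1) by blast
  next
    case True
    then obtain r where r: "r \<in> G" "tp r A = tp k A" "\<forall>(x, y)\<in>L. r x = y" by blast
    obtain F' where F': "finite F'" "F' \<subseteq> X" "\<And>h. h \<in> near F' k \<Longrightarrow> tp h A = tp k A"
      using k(2) unfolding locally_true_def by blast
    interpret am: amalgamation T k r A
      by unfold_locales (use kG r A in auto)
    \<comment> \<open>Values on \<open>F'\<close> preserve the type of \<open>A\<close>, those on
      \<open>F\<close> keep the result close to \<open>f\<close>.\<close>
    have fin: "finite (F \<union> F')" "F \<union> F' \<subseteq> X" "finite (fst ` L)" "fst ` L \<subseteq> X" using F F' L by auto
    obtain s g where s: "s \<in> G" "\<forall>x\<in>F \<union> F'. s x = k x"
      and g: "g \<in> G" "\<forall>a\<in>A. g a = a" and sg: "\<forall>x\<in>fst ` L. s (g x) = g (r x)"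
      using am.amalgam[OF A(1) fin] by blast
    have sk: "s \<in> near F' k" using s by (simp add: near_def)
    then have tps: "tp s A = tp k A" by (rule F'(3))
    have "decided s A"
      using near_trans[OF sk] F' tps by (intro decidedI[OF s(1) F'(1,2)]) auto
    moreover have "g \<in> near A \<one>\<^bsub>AutGroup T\<^esub>" using g by (simp add: near_one_iff[OF A(2)])
    moreover have "s (g x) = g y" if "(x, y) \<in> L" for x y
    proof -
      have "x \<in> fst ` L" using that by force
      moreover have "r x = y" using r(3) that by auto
      ultimately show ?thesis using bspec[OF sg, of x] by simp
    qed
    ultimately have "s \<in> requirement A L" using s(1) unfolding requirement_def by blast
    moreover have "s \<in> near F f" using s k(1) by (simp add: near_def)
    ultimately show ?thesis by blast
  qed
qed

definition requirements :: "('a \<Rightarrow> 'a) set set" where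
  "requirements = (\<lambda>(A, L). requirement A L) `
     ({A. finite A \<and> A \<subseteq> X} \<times> {L. finite L \<and> L \<subseteq> X \<times> X})"

lemma countable_requirements: "countable requirements"
  unfolding requirements_def
  by (intro countable_image countable_SIGMA countable_Collect_finite_subset countable_X)

lemma dense_open_requirements: "W \<in> requirements \<Longrightarrow> dense_open W"
  using dense_open_requirement by (auto simp: requirements_def)

lemma generic_if_requirements:
  assumes f: "f \<in> G" and req: "\<And>W. W \<in> requirements \<Longrightarrow> f \<in> W"
  shows "generic f"
  unfolding generic_def
proof (intro conjI allI impI)
  show "f \<in> G" by fact
  fix A assume A: "finite A" "A \<subseteq> X"
  have fL: "f \<in> requirement A L" if "finite L" "L \<subseteq> X \<times> X" for L
    using req[of "requirement A L"] A that by (auto simp: requirements_def)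
  then show "decided f A" using fL[of "{}"] by (simp add: requirement_def)
  show "realizing f A"
    unfolding realizing_def
  proof (intro ballI allI impI)
    fix r F assume r: "r \<in> G" "tp r A = tp f A" and F: "finite F" "F \<subseteq> X"
    let ?L = "(\<lambda>x. (x, r x)) ` F"
    have "f \<in> requirement A ?L" by (rule fL) (use F r(1) Aut_closed in auto)
    moreover have "\<forall>(x, y)\<in>?L. r x = y" by auto
    ultimately obtain g where g: "g \<in> near A \<one>\<^bsub>AutGroup T\<^esub>" "\<forall>(x, y)\<in>?L. f (g x) = g y"
      using r unfolding requirement_def by blast
    have gG: "g \<in> G" using g(1) by (simp add: near_def)
    have "conj_by g f x = r x" if "x \<in> F" for x
    proof -
      have x: "x \<in> X" "g x \<in> X" "f (g x) \<in> X" "r x \<in> X"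
        using that F(2) f gG r(1) Aut_closed by auto
      have "f (g x) = g (r x)" using g(2) that by auto
      then show ?thesis using x f gG by simp
    qed
    then have "conj_by g f \<in> near F r" using f gG by (simp add: near_def)
    then show "\<exists>g\<in>near A \<one>\<^bsub>AutGroup T\<^esub>. conj_by g f \<in> near F r" using g(1) by blast
  qed
qed

section \<open>Translation to the topology of pointwise convergence\<close>

lemma topspace_Aut [simp]: "topspace (Aut_topology T) = G"
  by (simp add: topspace_Aut_topology)

lemma dense_open_openin:
  assumes "dense_open W"
  shows "openin (Aut_topology T) W"
proof (subst openin_subopen, intro ballI)
  fix f assume "f \<in> W"
  then have "locally_true (\<lambda>g. g \<in> W) f" using assms unfolding dense_open_def by blast
  then obtain F where F: "f \<in> G" "finite F" "F \<subseteq> X" "\<And>g. g \<in> near F f \<Longrightarrow> g \<in> W"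
    unfolding locally_true_def by blast
  define U where "U x = (if x \<in> F then {f x} else X)" for x
  have "openin (product_topology (\<lambda>_. discrete_topology X) X) (PiE X U)"
    unfolding openin_product_topology_alt
  proof (intro ballI exI[of _ U] conjI)
    have "{i \<in> X. U i \<noteq> topspace (discrete_topology X)} \<subseteq> F" by (auto simp: U_def)
    then show "finite {i \<in> X. U i \<noteq> topspace (discrete_topology X)}"
      using F(2) finite_subset by blast
    show "openin (discrete_topology X) (U i)" if "i \<in> X" for i
      using that F(1) Aut_closed by (auto simp: U_def)
  qed auto
  then have "openin (Aut_topology T) (PiE X U \<inter> G)"
    unfolding Aut_topology_def openin_subtopology by blast
  moreover have "f \<in> PiE X U \<inter> G"
    using F(1) Aut_closed Aut_extensional by (auto simp: U_def PiE_def)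
  moreover have "PiE X U \<inter> G \<subseteq> W"
  proof
    fix g assume g: "g \<in> PiE X U \<inter> G"
    have "g x = f x" if "x \<in> F" for x
    proof -
      have "g x \<in> U x" using g that F(3) by blast
      then show ?thesis using that by (simp add: U_def)
    qed
    then show "g \<in> W" using F(4) g by (simp add: near_def)
  qed
  ultimately show "\<exists>S. openin (Aut_topology T) S \<and> f \<in> S \<and> S \<subseteq> W" by blast
qed

lemma dense_open_meets_openin:
  assumes W: "dense_open W" and S: "openin (Aut_topology T) S" and f: "f \<in> S"
  shows "S \<inter> W \<noteq> {}"
proof -
  obtain S' where S': "openin (product_topology (\<lambda>_. discrete_topology X) X) S'" "S = S' \<inter> G"
    using S unfolding Aut_topology_def openin_subtopology by blast
  then have fS': "f \<in> S'" "f \<in> G" using f by auto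
  obtain U where U: "finite {i \<in> X. U i \<noteq> topspace (discrete_topology X)}" "f \<in> PiE X U" "PiE X U \<subseteq> S'"
    using S'(1) fS'(1) unfolding openin_product_topology_alt by blast
  let ?F = "{i \<in> X. U i \<noteq> X}"
  have "finite ?F" "?F \<subseteq> X" using U(1) by auto
  then obtain g where g: "g \<in> W" "g \<in> near ?F f" using W fS'(2) unfolding dense_open_def by blast
  have gG: "g \<in> G" using g(2) by (simp add: near_def)
  have "g i \<in> U i" if "i \<in> X" for i
  proof (cases "U i = X")
    case True
    then show ?thesis using gG that Aut_closed by blast
  next
    case False
    then have "g i = f i" using g(2) that by (simp add: near_def)
    then show ?thesis using U(2) that by auto
  qed
  then have "g \<in> PiE X U" using Aut_extensional[OF gG] by (auto simp: PiE_def)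
  then show ?thesis using U(3) S'(2) gG g(1) by blast
qed

lemma nowhere_dense_complement:
  assumes W: "dense_open W" and N: "N \<subseteq> G - W"
  shows "nowhere_dense_in (Aut_topology T) N"
proof -
  let ?T = "Aut_topology T"
  have "closedin ?T (G - W)"
    using closedin_diff[OF closedin_topspace dense_open_openin[OF W]] by simp
  then have cl: "?T closure_of N \<subseteq> G - W" using N by (rule closure_of_minimal[rotated])
  have "?T interior_of (?T closure_of N) \<inter> W = {}"
    using interior_of_subset[of ?T "?T closure_of N"] cl by blast
  then have "?T interior_of (?T closure_of N) = {}"
    using dense_open_meets_openin[OF W openin_interior_of] by blast
  then show ?thesis using N by (auto simp: nowhere_dense_in_def)
qed

text \<open>Automorphisms meeting all requirements are generic and hence conjugate to
  \<open>\<sigma>\<close>, so every automorphism outside the class violates one of countably many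
  dense open conditions.\<close>

lemma generic_conjugacy_class_comeagre:
  "\<exists>\<sigma>\<in>G. comeagre_in (Aut_topology T) (conjugacy_class (AutGroup T) \<sigma>)"
proof -
  have "\<exists>\<sigma>\<in>near {} \<one>\<^bsub>AutGroup T\<^esub>. \<forall>W\<in>requirements. \<sigma> \<in> W"
    using countable_X countable_requirements dense_open_requirements by (intro Baire) auto
  then obtain \<sigma> where \<sigma>: "\<sigma> \<in> G" "\<And>W. W \<in> requirements \<Longrightarrow> \<sigma> \<in> W"
    by (auto simp: near_def)
  let ?C = "conjugacy_class (AutGroup T) \<sigma>"
  have conj: "\<tau> \<in> ?C" if \<tau>: "\<tau> \<in> G" "\<And>W. W \<in> requirements \<Longrightarrow> \<tau> \<in> W" for \<tau>
  proof -
    have "tp \<tau> {} = tp \<sigma> {}" by (simp add: tp_def set_shift_term_not_empty)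
    then obtain \<phi> where "\<phi> \<in> G" "\<tau> = conj_by \<phi> \<sigma>"
      using generic_conjugate[OF countable_X generic_if_requirements[OF \<tau>] generic_if_requirements[OF \<sigma>]]
      by blast
    \<comment> \<open>\<open>conj_by\<close> has the inverse on the left and
      \<open>conjugacy_class\<close> on the right, so the conjugating element is
      \<open>iv \<phi>\<close>.\<close>
    then have "\<tau> = (iv \<phi> \<bullet> \<sigma>) \<bullet> iv (iv \<phi>)" "iv \<phi> \<in> carrier (AutGroup T)"
      using \<sigma>(1) by (simp_all add: A.m_assoc)
    then show ?thesis unfolding conjugacy_class_def by blast
  qed
  have C: "?C \<subseteq> G" using \<sigma>(1) by (auto simp: conjugacy_class_def)
  define W where "W = from_nat_into requirements"
  have "requirements \<noteq> {}" by (auto simp: requirements_def)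
  then have W: "range W = requirements" "dense_open (W n)" for n
    unfolding W_def using countable_requirements
    by (auto intro: range_from_nat_into dense_open_requirements from_nat_into)
  \<comment> \<open>\<open>meagre_in\<close> asks for equality with a union of nowhere dense sets,
    so the class is removed from each complement.\<close>
  have "nowhere_dense_in (Aut_topology T) (G - ?C - W n)" for n
    by (rule nowhere_dense_complement[OF W(2)]) blast
  moreover have "G - ?C = (\<Union>n. G - ?C - W n)"
  proof (intro equalityI subsetI)
    fix \<tau> assume \<tau>: "\<tau> \<in> G - ?C"
    then obtain W' where "W' \<in> requirements" "\<tau> \<notin> W'" using conj by blast
    then show "\<tau> \<in> (\<Union>n. G - ?C - W n)" using \<tau> W(1) by auto
  qed blast
  ultimately have "comeagre_in (Aut_topology T) ?C"
    unfolding comeagre_in_def meagre_in_def topspace_Aut using C by (intro conjI exI[of _ "\<lambda>n. G - ?C - W n"]) auto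
  then show ?thesis using \<sigma>(1) by blast
qed

end

theorem theorem6p11:
  fixes T :: "'a meet_structure"
  assumes "universal_dense_meet_tree T"
  shows "\<exists>\<sigma>\<in>carrier (AutGroup T).
           comeagre_in (Aut_topology T) (conjugacy_class (AutGroup T) \<sigma>)"
proof -
  interpret universal_meet_tree T
    using assms by unfold_locales (auto simp: universal_dense_meet_tree_def)
  show ?thesis using generic_conjugacy_class_comeagre by simp
qed

end
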